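(* Fix an integer $t\ge 2$ and $\gamma>0$. There exists $c=c(t,\gamma)>0$ such that the following holds. Let the integer-valued functions $q=q(n)\ge 2$ and $s=s(n)\ge 1$ satisfy $\gamma n\le q$, $tq\le n$, and $s\le cq$. Then, for all sufficiently large $n$, $$\chi\bigl(\mathrm{KG}^q(n,t)_{s\text{-stab}}\bigr)=\left\lceil\frac{n-q(t-1)}{q-1}\right\rceil .$$
   Context: Regard $[n]=\{1,\dots,n\}$ as cyclically ordered; the cyclic distance of $i,j\in[n]$ is $\min\{|i-j|,\,n-|i-j|\}$. A $t$-subset of $[n]$ is $s$-stable if every two distinct elements of it have cyclic distance at least $s$. The Kneser hypergraph $\mathrm{KG}^q(n,t)$ is the $q$-uniform hypergraph whose vertices are the $t$-subsets of $[n]$ and whose edges are the collections of $q$ pairwise disjoint $t$-subsets. $\mathrm{KG}^q(n,t)_{s\text{-stab}}$ is the subhypergraph of $\mathrm{KG}^q(n,t)$ induced by the $s$-stable $t$-sets. The chromatic number $\chi$ of a hypergraph is the least number of colours in a colouring of its vertices with no monochromatic edge. *)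

theory Defs
  imports Complex_Main
begin

text \<open>A hypergraph is a pair of its vertex set and its edge set.\<close>

type_synonym 'a hypergraph = "'a set \<times> 'a set set"

definition induced_subhypergraph :: "'a hypergraph \<Rightarrow> 'a set \<Rightarrow> 'a hypergraph" where
  "induced_subhypergraph H W = (fst H \<inter> W, {e \<in> snd H. e \<subseteq> W})"

definition proper_colouring :: "'a hypergraph \<Rightarrow> nat \<Rightarrow> ('a \<Rightarrow> nat) \<Rightarrow> bool" where
  "proper_colouring H k f \<longleftrightarrow>
     f ` fst H \<subseteq> {..<k} \<and> (\<forall>e \<in> snd H. \<not> (\<exists>a. \<forall>v \<in> e. f v = a))"

text \<open>Meaningful when some finite proper colouring exists; for a finite vertex set this
  holds as soon as every edge is a set of at least two vertices (use an injective colouring).\<close>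

definition chromatic_number :: "'a hypergraph \<Rightarrow> nat" where
  "chromatic_number H = (LEAST k. \<exists>f. proper_colouring H k f)"

definition cyclic_dist :: "nat \<Rightarrow> nat \<Rightarrow> nat \<Rightarrow> int" where
  "cyclic_dist n i j = min \<bar>int i - int j\<bar> (int n - \<bar>int i - int j\<bar>)"

definition stable :: "nat \<Rightarrow> nat \<Rightarrow> nat set \<Rightarrow> bool" where
  "stable n s A \<longleftrightarrow> (\<forall>i \<in> A. \<forall>j \<in> A. i \<noteq> j \<longrightarrow> int s \<le> cyclic_dist n i j)"

definition subsets_of_size :: "nat \<Rightarrow> nat \<Rightarrow> nat set set" where
  "subsets_of_size n t = {A. A \<subseteq> {1..n} \<and> card A = t}"

definition kneser_hypergraph :: "nat \<Rightarrow> nat \<Rightarrow> nat \<Rightarrow> nat set hypergraph" where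
  "kneser_hypergraph q n t =
     (subsets_of_size n t,
      {e. e \<subseteq> subsets_of_size n t \<and> card e = q \<and> pairwise disjnt e})"

definition stable_kneser_hypergraph :: "nat \<Rightarrow> nat \<Rightarrow> nat \<Rightarrow> nat \<Rightarrow> nat set hypergraph" where
  "stable_kneser_hypergraph q n t s =
     induced_subhypergraph (kneser_hypergraph q n t) {A \<in> subsets_of_size n t. stable n s A}"

end

theory Submission
  imports Defs "HOL-Library.FuncSet"
begin

text \<open>Write \<open>N\<close> for the right-hand side. For the upper bound, a set is coloured by the block of \<open>q - 1\<close>
consecutive points that contains its minimum, all blocks from the \<open>N\<close>-th on sharing one colour:
disjoint sets have distinct minima, and fewer than \<open>t * q\<close> points lie in or beyond the last block
(\<open>kneser_colouring_exists\<close>).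

For the lower bound let \<open>k = N - 1\<close>, so that \<open>q * (t - 1 + k) < n + k\<close>, and let the stable sets be
coloured with \<open>k\<close> colours. It has to be shown that some colour contains \<open>q\<close> pairwise disjoint sets
(\<open>monochromatic_matching\<close>). Since \<open>q\<close> is linear in \<open>n\<close>, the number \<open>k\<close> is bounded in terms of
\<open>\<gamma>\<close>, and a vertex is cyclically close to only few others, so almost all \<open>t\<close>-tuples are stable.
The proof therefore only has to work for large \<open>n\<close>, bounded \<open>t\<close> and \<open>k\<close>, and colourings
that leave a small proportion of the tuples uncoloured. It replaces the topological
arguments known for the unrestricted problem by linear programming, densities and a stability
argument.

The asymptotic statement rests on two facts. If a maximum matching of one colour could be improved
fractionally inside a typical bounded sample of vertices, then a blow-up of that sample would yield
a larger integral matching. By duality, a typical sample of \<open>r\<close> vertices therefore has a fractional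
cover of its edges of that colour whose weight is about \<open>r\<close> times the matching number divided by \<open>n\<close>
(\<open>few_tuples_without_light_cover\<close>). On the other hand, \<open>k\<close> light covers cannot cover all \<open>t\<close>-sets of
the sample: a basic solution of a linear program has at most \<open>k\<close> fractional coordinates, and its
coordinates equal to one contain an uncovered \<open>t\<close>-set (\<open>uncovered_set_exists\<close>). This gives
\<open>points_le_of_matching_bounds\<close>. If the covers are just too heavy for this, the same rounding
produces a rainbow star, that is, \<open>t - 1\<close> points that are completed to a set of each colour by
suitable further points (\<open>rainbow_star_exists\<close>), and such stars are dense.

The exact statement comes from stability. Call a pattern gainful if it has fewer than
\<open>m * (t - 1 + k)\<close> points and contains \<open>m\<close> disjoint sets of every colour. If gainful patterns were
frequent, many disjoint ones could be removed, and the asymptotic statement applied to the rest would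
give a matching of size \<open>q\<close>. So almost all patterns have no gain, and duality describes them by a
weighting of the points by colours. Two rainbow stars force this weighting to be integral
(\<open>stars_force_blocks\<close>), and the vertices split into blocks \<open>B i\<close> with thresholds \<open>a i\<close> such that
the sum of \<open>a i - 1\<close> is \<open>t - 1\<close> and almost every set of colour \<open>i\<close> has at least \<open>a i\<close> points in
\<open>B i\<close> (\<open>block_structure\<close>). A typical set with \<open>a i\<close> points in \<open>B i\<close> and \<open>a j - 1\<close> points in each other
block has no choice but to have colour \<open>i\<close>. Finally each atypical vertex is attached to a block
for whose colour it has many completions. Since the numbers \<open>a i * q - 1\<close> sum up to less than \<open>n\<close>, some
block has at least \<open>a i * q\<close> vertices. Its atypical vertices are matched greedily, and the remaining
vertices are completed to a perfect matching by cyclic exchanges (\<open>matching_completion\<close>).\<close>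

section \<open>Samples and blow-ups\<close>

text \<open>Samples are drawn with repetition and with order, so that counting them needs no binomial
coefficients; the few samples with repeated entries are discarded where necessary.\<close>

definition tuples :: "'a set \<Rightarrow> nat \<Rightarrow> 'a list set" where
  "tuples V r = {xs. set xs \<subseteq> V \<and> length xs = r}"

lemma finite_tuples: "finite V \<Longrightarrow> finite (tuples V r)"
  unfolding tuples_def by (rule finite_lists_length_eq)

lemma card_tuples: "finite V \<Longrightarrow> card (tuples V r) = card V ^ r"
  unfolding tuples_def by (rule card_lists_length_eq)

lemma tuples_0 [simp]: "tuples V 0 = {[]}"
  by (auto simp: tuples_def)

lemma tuples_nth: "xs \<in> tuples V r \<Longrightarrow> j < r \<Longrightarrow> xs ! j \<in> V"
  by (auto simp: tuples_def subset_iff)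

lemma tuples_Suc: "tuples V (Suc r) = (\<lambda>(x, xs). x # xs) ` (V \<times> tuples V r)"
  by (auto simp: tuples_def image_iff length_Suc_conv)

lemma sum_tuples_Suc:
  "(\<Sum>xs\<in>tuples V (Suc r). f xs) = (\<Sum>x\<in>V. \<Sum>xs\<in>tuples V r. f (x # xs))"
proof -
  have "inj_on (\<lambda>(x, xs). x # xs) (V \<times> tuples V r)" by (auto simp: inj_on_def)
  then show ?thesis
    by (simp only: tuples_Suc sum.reindex sum.cartesian_product) (simp add: case_prod_beta)
qed

text \<open>A sample is determined by its entries at the positions \<open>p\<close> and at the other positions.\<close>

lemma card_projection_le:
  assumes "finite V" "finite A" "distinct p" "set p \<subseteq> {..<r}"
  shows "card {xs \<in> tuples V r. map ((!) xs) p \<in> A} \<le> card A * card V ^ (r - length p)"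
proof -
  let ?S = "{xs \<in> tuples V r. map ((!) xs) p \<in> A}"
  let ?I = "{..<r} - set p"
  let ?f = "\<lambda>xs. (map ((!) xs) p, restrict ((!) xs) ?I)"
  have "inj_on ?f ?S"
  proof (rule inj_onI)
    fix xs ys assume xs: "xs \<in> ?S" and ys: "ys \<in> ?S" and eq: "?f xs = ?f ys"
    have l: "length xs = r" "length ys = r" using xs ys by (auto simp: tuples_def)
    show "xs = ys"
    proof (rule nth_equalityI)
      fix i assume "i < length xs"
      then have i: "i < r" using l by simp
      show "xs ! i = ys ! i"
      proof (cases "i \<in> set p")
        case True then show ?thesis using eq by auto
      next
        case False
        have "restrict ((!) xs) ?I i = restrict ((!) ys) ?I i" using eq by simp
        then show ?thesis using False i by simp
      qed
    qed (use l in simp)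
  qed
  moreover have "?f ` ?S \<subseteq> A \<times> (\<Pi>\<^sub>E i\<in>?I. V)"
    by (auto simp: tuples_def PiE_def extensional_def)
  moreover have fin: "finite (A \<times> (\<Pi>\<^sub>E i\<in>?I. V))"
    using assms by (intro finite_cartesian_product finite_PiE) auto
  ultimately have "card ?S \<le> card (A \<times> (\<Pi>\<^sub>E i\<in>?I. V))"
    by (rule card_inj_on_le)
  also have "\<dots> = card A * card V ^ card ?I"
    by (simp add: card_cartesian_product card_PiE)
  also have "card ?I = r - length p"
    using assms by (simp add: card_Diff_subset distinct_card)
  finally show ?thesis .
qed

text \<open>The union bound behind all statements that a typical sample avoids a rare configuration.\<close>

lemma card_containing_subtuple_le:
  assumes "finite V" "finite A"
  shows "card {xs \<in> tuples V r. \<exists>p. distinct p \<and> length p = m \<and> set p \<subseteq> {..<r} \<and> map ((!) xs) p \<in> A}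
    \<le> r ^ m * (card A * card V ^ (r - m))"
proof -
  let ?P = "{p \<in> tuples {..<r} m. distinct p}"
  have fP: "finite ?P" by (simp add: finite_tuples)
  have "{xs \<in> tuples V r. \<exists>p. distinct p \<and> length p = m \<and> set p \<subseteq> {..<r} \<and> map ((!) xs) p \<in> A}
    = (\<Union>p\<in>?P. {xs \<in> tuples V r. map ((!) xs) p \<in> A})"
    by (auto simp: tuples_def)
  also have "card \<dots> \<le> (\<Sum>p\<in>?P. card {xs \<in> tuples V r. map ((!) xs) p \<in> A})"
    by (rule card_UN_le[OF fP])
  also have "\<dots> \<le> (\<Sum>p\<in>?P. card A * card V ^ (r - m))"
    by (rule sum_mono) (use card_projection_le[OF assms] in \<open>auto simp: tuples_def\<close>)
  also have "\<dots> = card ?P * (card A * card V ^ (r - m))" by simp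
  also have "\<dots> \<le> card (tuples {..<r} m) * (card A * card V ^ (r - m))"
    by (intro mult_le_mono1 card_mono finite_tuples) auto
  also have "\<dots> = r ^ m * (card A * card V ^ (r - m))" by (simp add: card_tuples)
  finally show ?thesis .
qed

lemma card_hitting_tuples_le:
  assumes "finite V" "finite X"
  shows "card {xs \<in> tuples V r. set xs \<inter> X \<noteq> {}} \<le> r * card X * card V ^ (r - 1)"
proof -
  let ?A = "(\<lambda>x. [x]) ` X"
  have cA: "card ?A = card X" by (simp add: card_image inj_on_def)
  have "{xs \<in> tuples V r. set xs \<inter> X \<noteq> {}} \<subseteq>
     {xs \<in> tuples V r. \<exists>p. distinct p \<and> length p = 1 \<and> set p \<subseteq> {..<r} \<and> map ((!) xs) p \<in> ?A}"
  proof clarify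
    fix xs assume xs: "xs \<in> tuples V r" and ne: "set xs \<inter> X \<noteq> {}"
    then obtain i where "i < r" "xs ! i \<in> X" by (auto simp: tuples_def in_set_conv_nth)
    then show "\<exists>p. distinct p \<and> length p = 1 \<and> set p \<subseteq> {..<r} \<and> map ((!) xs) p \<in> ?A"
      by (intro exI[of _ "[i]"]) auto
  qed
  then have "card {xs \<in> tuples V r. set xs \<inter> X \<noteq> {}} \<le> card {xs \<in> tuples V r. \<exists>p. distinct p \<and> length p = 1 \<and> set p \<subseteq> {..<r} \<and> map ((!) xs) p \<in> ?A}"
    using assms by (intro card_mono) (auto simp: finite_tuples)
  also have "\<dots> \<le> r ^ 1 * (card ?A * card V ^ (r - 1))"
    by (rule card_containing_subtuple_le) (use assms in auto)
  finally show ?thesis using cA by (simp add: mult.assoc)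
qed

text \<open>The relation is equality when repeated entries are discarded, membership in a common edge of a
matching, or cyclic closeness.\<close>

lemma card_colliding_tuples_le:
  assumes "finite V" and deg: "\<And>v. v \<in> V \<Longrightarrow> card {u \<in> V. R v u} \<le> d"
  shows "card {xs \<in> tuples V r. \<exists>i<r. \<exists>j<r. i \<noteq> j \<and> R (xs ! i) (xs ! j)} \<le> r ^ 2 * d * card V ^ (r - 1)"
proof (cases "r < 2")
  case True
  then have e: "{xs \<in> tuples V r. \<exists>i<r. \<exists>j<r. i \<noteq> j \<and> R (xs ! i) (xs ! j)} = {}" by auto
  show ?thesis unfolding e by simp
next
  case False
  let ?A = "\<Union>a\<in>V. (\<lambda>b. [a, b]) ` {b \<in> V. R a b}"
  have "card ?A \<le> (\<Sum>a\<in>V. card ((\<lambda>b. [a, b]) ` {b \<in> V. R a b}))"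
    by (rule card_UN_le[OF assms(1)])
  also have "\<dots> = (\<Sum>a\<in>V. card {b \<in> V. R a b})"
    by (intro sum.cong refl card_image) (auto simp: inj_on_def)
  also have "\<dots> \<le> (\<Sum>a\<in>V. d)" by (intro sum_mono deg)
  finally have cA: "card ?A \<le> card V * d" by simp
  have "{xs \<in> tuples V r. \<exists>i<r. \<exists>j<r. i \<noteq> j \<and> R (xs ! i) (xs ! j)} \<subseteq>
     {xs \<in> tuples V r. \<exists>p. distinct p \<and> length p = 2 \<and> set p \<subseteq> {..<r} \<and> map ((!) xs) p \<in> ?A}"
  proof clarify
    fix xs i j assume xs: "xs \<in> tuples V r" and ij: "i < r" "j < r" "i \<noteq> j" "R (xs ! i) (xs ! j)"
    then show "\<exists>p. distinct p \<and> length p = 2 \<and> set p \<subseteq> {..<r} \<and> map ((!) xs) p \<in> ?A"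
      using tuples_nth[OF xs ij(1)] tuples_nth[OF xs ij(2)]
      by (intro exI[of _ "[i, j]"]) (auto intro!: bexI[of _ "xs ! i"])
  qed
  then have "card {xs \<in> tuples V r. \<exists>i<r. \<exists>j<r. i \<noteq> j \<and> R (xs ! i) (xs ! j)} \<le>
    card {xs \<in> tuples V r. \<exists>p. distinct p \<and> length p = 2 \<and> set p \<subseteq> {..<r} \<and> map ((!) xs) p \<in> ?A}"
    using assms by (intro card_mono) (auto simp: finite_tuples)
  also have "\<dots> \<le> r ^ 2 * (card ?A * card V ^ (r - 2))"
    by (rule card_containing_subtuple_le) (use assms in auto)
  also have "\<dots> \<le> r ^ 2 * ((card V * d) * card V ^ (r - 2))"
    by (intro mult_le_mono order_refl cA)
  also have "\<dots> = r ^ 2 * d * (card V ^ Suc (r - 2))" by simp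
  also have "Suc (r - 2) = r - 1" using False by simp
  finally show ?thesis .
qed

text \<open>Jensen's inequality for the power function.\<close>

lemma power_mean_le:
  fixes f :: "'a \<Rightarrow> real"
  assumes "finite S" and pos: "\<And>s. s \<in> S \<Longrightarrow> 0 \<le> f s"
  shows "real (card S) * ((\<Sum>s\<in>S. f s) / card S) ^ h \<le> (\<Sum>s\<in>S. f s ^ h)"
proof -
  define a where "a = (\<Sum>s\<in>S. f s) / card S"
  have a0: "a \<ge> 0" unfolding a_def by (simp add: sum_nonneg pos)
  show ?thesis
  proof (cases "a = 0")
    case True
    then show ?thesis
      by (cases "h = 0") (auto simp: a_def[symmetric] power_0_left intro!: sum_nonneg zero_le_power pos)
  next
    case False
    then have a: "a > 0" using a0 by simp
    then have S: "card S > 0" by (cases "card S = 0") (auto simp: a_def)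
    \<comment> \<open>the tangent to \<open>x ^ h\<close> at the mean lies below the curve\<close>
    have tangent: "a ^ h + real h * a ^ h * (f s / a - 1) \<le> f s ^ h" if "s \<in> S" for s
    proof -
      have "1 + real h * (f s / a - 1) \<le> (1 + (f s / a - 1)) ^ h"
        by (rule Bernoulli_inequality) (use pos[OF that] a in simp)
      then have "a ^ h * (1 + real h * (f s / a - 1)) \<le> a ^ h * (f s / a) ^ h"
        using a by simp
      then show ?thesis using a by (simp add: power_divide algebra_simps)
    qed
    have "(\<Sum>s\<in>S. a ^ h + real h * a ^ h * (f s / a - 1)) =
        card S * a ^ h + real h * a ^ h * ((\<Sum>s\<in>S. f s) / a - card S)"
      by (simp add: sum.distrib sum_subtractf flip: sum_distrib_left sum_divide_distrib)
    also have "(\<Sum>s\<in>S. f s) / a = card S"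
      using S a False by (simp add: a_def field_simps)
    finally have "card S * a ^ h = (\<Sum>s\<in>S. a ^ h + real h * a ^ h * (f s / a - 1))" by simp
    also have "\<dots> \<le> (\<Sum>s\<in>S. f s ^ h)" by (intro sum_mono tangent)
    finally show ?thesis by (simp add: a_def)
  qed
qed

lemma listset_subset_tuples:
  assumes "us \<in> tuples (tuples V h) r"
  shows "listset (map set us) \<subseteq> tuples V r"
  using assms
proof (induction r arbitrary: us)
  case 0 then show ?case by simp
next
  case (Suc r)
  then obtain u us' where "us = u # us'" "u \<in> tuples V h" "us' \<in> tuples (tuples V h) r"
    by (auto simp: tuples_Suc)
  then show ?case using Suc.IH[of us'] by (force simp: set_Cons_def tuples_def)
qed

text \<open>A blow-up replaces each entry of a tuple by a list of \<open>h\<close> entries; all transversals have to lie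
in \<open>A\<close>. The exponent \<open>h ^ r\<close> is what one application of Jensen's inequality per coordinate costs.\<close>

lemma card_blowups_ge:
  assumes V: "finite V" "V \<noteq> {}" and A: "A \<subseteq> tuples V r"
  shows "(card A / card V ^ r) ^ (h ^ r) * card V ^ (r * h)
    \<le> real (card {us \<in> tuples (tuples V h) r. listset (map set us) \<subseteq> A})"
  using A
proof (induction r arbitrary: A)
  case 0
  then have "A = {} \<or> A = {[]}" by auto
  then show ?case
  proof
    assume "A = {[]}"
    then have "{us \<in> tuples (tuples V h) 0. listset (map set us) \<subseteq> A} = {[]}" by auto
    with \<open>A = {[]}\<close> show ?thesis by simp
  qed simp
next
  case (Suc r)
  let ?n = "real (card V)"
  have n: "?n > 0" using V by (simp add: card_gt_0_iff)
  define B where "B u = {z \<in> tuples V r. \<forall>x\<in>set u. x # z \<in> A}" for u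
  define d where "d z = card {x \<in> V. x # z \<in> A}" for z
  define N where "N u = card {us \<in> tuples (tuples V h) r. listset (map set us) \<subseteq> B u}" for u
  let ?T = "tuples V h"
  have fT: "finite ?T" by (simp add: finite_tuples V)
  have fr: "finite (tuples V r)" by (simp add: finite_tuples V)
  have finA: "finite A" using Suc.prems finite_tuples[OF V(1)] finite_subset by blast
  have "card {us \<in> tuples ?T (Suc r). listset (map set us) \<subseteq> A}
    = (\<Sum>us\<in>tuples ?T (Suc r). if listset (map set us) \<subseteq> A then 1 else 0)"
    by (simp add: finite_tuples fT flip: sum.inter_filter)
  also have "\<dots> = (\<Sum>u\<in>?T. \<Sum>us\<in>tuples ?T r. if listset (map set (u # us)) \<subseteq> A then 1 else 0)"
    by (rule sum_tuples_Suc)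
  also have "\<dots> = (\<Sum>u\<in>?T. \<Sum>us\<in>tuples ?T r. if listset (map set us) \<subseteq> B u then 1 else 0)"
  proof (intro sum.cong refl)
    fix u us assume "u \<in> ?T" "us \<in> tuples ?T r"
    then have "listset (map set us) \<subseteq> tuples V r" by (intro listset_subset_tuples)
    then have "listset (map set (u # us)) \<subseteq> A \<longleftrightarrow> listset (map set us) \<subseteq> B u"
      unfolding B_def by (fastforce simp: set_Cons_def)
    then show "(if listset (map set (u # us)) \<subseteq> A then 1 else 0) =
       (if listset (map set us) \<subseteq> B u then 1 else (0::nat))" by simp
  qed
  also have "\<dots> = (\<Sum>u\<in>?T. N u)"
    by (simp add: N_def finite_tuples fT flip: sum.inter_filter)
  finally have count: "card {us \<in> tuples ?T (Suc r). listset (map set us) \<subseteq> A} = (\<Sum>u\<in>?T. N u)" .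
  have sumA: "(\<Sum>z\<in>tuples V r. real (d z)) = card A"
  proof -
    have "card A = (\<Sum>xs\<in>tuples V (Suc r). if xs \<in> A then 1 else 0)"
      using Suc.prems by (simp add: finite_tuples V Int_absorb1 flip: sum.inter_filter)
        (metis Collect_mem_eq Int_absorb1 Int_def)
    also have "\<dots> = (\<Sum>x\<in>V. \<Sum>z\<in>tuples V r. if x # z \<in> A then 1 else 0)"
      by (rule sum_tuples_Suc)
    also have "\<dots> = (\<Sum>z\<in>tuples V r. \<Sum>x\<in>V. if x # z \<in> A then 1 else 0)"
      by (rule sum.swap)
    also have "\<dots> = (\<Sum>z\<in>tuples V r. d z)"
      by (simp add: d_def V flip: sum.inter_filter)
    finally show ?thesis by simp
  qed
  have sumB: "(\<Sum>u\<in>?T. real (card (B u))) = (\<Sum>z\<in>tuples V r. real (d z) ^ h)"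
  proof -
    have "(\<Sum>u\<in>?T. card (B u)) = (\<Sum>u\<in>?T. \<Sum>z\<in>tuples V r. if \<forall>x\<in>set u. x # z \<in> A then 1 else 0)"
      by (simp add: B_def fr flip: sum.inter_filter)
    also have "\<dots> = (\<Sum>z\<in>tuples V r. \<Sum>u\<in>?T. if \<forall>x\<in>set u. x # z \<in> A then 1 else 0)"
      by (rule sum.swap)
    also have "\<dots> = (\<Sum>z\<in>tuples V r. card {u \<in> ?T. \<forall>x\<in>set u. x # z \<in> A})"
      by (simp add: fT flip: sum.inter_filter)
    also have "\<dots> = (\<Sum>z\<in>tuples V r. card (tuples {x \<in> V. x # z \<in> A} h))"
      by (intro sum.cong refl arg_cong[where f = card]) (auto simp: tuples_def)
    also have "\<dots> = (\<Sum>z\<in>tuples V r. d z ^ h)"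
      by (simp add: card_tuples V d_def)
    finally show ?thesis by (metis (mono_tags, lifting) of_nat_power of_nat_sum sum.cong)
  qed
  have avg: "(card A / ?n ^ Suc r) ^ h \<le> (\<Sum>u\<in>?T. card (B u) / ?n ^ r) / card ?T"
  proof -
    have "?n ^ r * (card A / ?n ^ r) ^ h \<le> (\<Sum>z\<in>tuples V r. real (d z) ^ h)"
      using power_mean_le[OF fr, of "\<lambda>z. real (d z)" h] by (simp add: sumA card_tuples V)
    then have "?n ^ r * (card A / ?n ^ r) ^ h \<le> (\<Sum>u\<in>?T. real (card (B u)))" by (simp add: sumB)
    then have "(card A / ?n ^ r) ^ h \<le> (\<Sum>u\<in>?T. real (card (B u))) / ?n ^ r"
      using n by (simp add: field_simps)
    then have "(card A / ?n ^ r) ^ h / ?n ^ h \<le> (\<Sum>u\<in>?T. real (card (B u))) / ?n ^ r / ?n ^ h"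
      using n by (intro divide_right_mono) auto
    moreover have "(card A / ?n ^ Suc r) ^ h = (card A / ?n ^ r) ^ h / ?n ^ h"
      by (simp add: power_divide power_mult_distrib mult.commute)
    ultimately show ?thesis by (simp add: card_tuples V sum_divide_distrib)
  qed
  have "(card A / ?n ^ Suc r) ^ (h ^ Suc r) * ?n ^ (Suc r * h)
     = ?n ^ h * (((card A / ?n ^ Suc r) ^ h) ^ (h ^ r)) * ?n ^ (r * h)"
    by (simp add: power_add power_mult mult_ac flip: power_mult)
  also have "\<dots> \<le> ?n ^ h * ((\<Sum>u\<in>?T. card (B u) / ?n ^ r) / card ?T) ^ (h ^ r) * ?n ^ (r * h)"
    by (intro mult_right_mono mult_left_mono power_mono avg) auto
  also have "?n ^ h = real (card ?T)" by (simp add: card_tuples V)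
  also have "card ?T * ((\<Sum>u\<in>?T. card (B u) / ?n ^ r) / card ?T) ^ (h ^ r) * ?n ^ (r * h)
      \<le> (\<Sum>u\<in>?T. (card (B u) / ?n ^ r) ^ (h ^ r)) * ?n ^ (r * h)"
    by (intro mult_right_mono power_mean_le fT) auto
  also have "(\<Sum>u\<in>?T. (card (B u) / ?n ^ r) ^ (h ^ r)) * ?n ^ (r * h)
      = (\<Sum>u\<in>?T. (card (B u) / ?n ^ r) ^ (h ^ r) * ?n ^ (r * h))"
    by (rule sum_distrib_right)
  also have "\<dots> \<le> (\<Sum>u\<in>?T. real (N u))"
    unfolding N_def by (intro sum_mono order_trans[OF _ Suc.IH]) (auto simp: B_def)
  also have "\<dots> = real (card {us \<in> tuples ?T (Suc r). listset (map set us) \<subseteq> A})"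
    by (simp add: count)
  finally show ?case by simp
qed

text \<open>Blow-ups are read as ordinary samples of length \<open>r * h\<close>, to which the bounds on collisions
apply.\<close>

definition flat_tuple :: "nat \<Rightarrow> 'a list list \<Rightarrow> 'a list" where
  "flat_tuple h us = map (\<lambda>i. us ! (i div h) ! (i mod h)) [0..<length us * h]"

lemma flat_tuple_index:
  assumes "j < r" "l < h"
  shows "j * h + l < r * (h::nat)"
proof -
  have "j * h + l < Suc j * h" using assms by simp
  also have "\<dots> \<le> r * h" using assms by (intro mult_le_mono1) simp
  finally show ?thesis .
qed

lemma nth_flat_tuple:
  assumes "j < length us" "l < h"
  shows "flat_tuple h us ! (j * h + l) = us ! j ! l"
  using flat_tuple_index[OF assms] assms by (simp add: flat_tuple_def)

lemma flat_tuple_in_tuples: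
  assumes "us \<in> tuples (tuples V h) r"
  shows "flat_tuple h us \<in> tuples V (r * h)"
proof -
  have "us ! (i div h) ! (i mod h) \<in> V" if "i < r * h" for i
  proof -
    have "h > 0" using that by (cases h) auto
    moreover have "i div h < r" using that by (simp add: less_mult_imp_div_less)
    then have "us ! (i div h) \<in> tuples V h" by (rule tuples_nth[OF assms])
    ultimately show ?thesis by (intro tuples_nth[of _ V h]) auto
  qed
  then show ?thesis using assms by (auto simp: flat_tuple_def tuples_def)
qed

lemma inj_on_flat_tuple: "inj_on (flat_tuple h) (tuples (tuples V h) r)"
proof (rule inj_onI)
  fix us vs assume us: "us \<in> tuples (tuples V h) r" and vs: "vs \<in> tuples (tuples V h) r"
    and eq: "flat_tuple h us = flat_tuple h vs"
  have l: "length us = r" "length vs = r" using us vs by (auto simp: tuples_def)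
  show "us = vs"
  proof (rule nth_equalityI)
    fix j assume j: "j < length us"
    then have "us ! j \<in> tuples V h" "vs ! j \<in> tuples V h"
      using tuples_nth[OF us] tuples_nth[OF vs] l by auto
    then have lj: "length (us ! j) = h" "length (vs ! j) = h" by (auto simp: tuples_def)
    show "us ! j = vs ! j"
    proof (rule nth_equalityI)
      fix i assume i: "i < length (us ! j)"
      show "us ! j ! i = vs ! j ! i"
        using nth_flat_tuple[of j us i h] nth_flat_tuple[of j vs i h] i j l lj eq by simp
    qed (simp add: lj)
  qed (simp add: l)
qed

lemma map_in_listset:
  assumes "length As = r" "\<And>j. j < r \<Longrightarrow> f j \<in> As ! j"
  shows "map f [0..<r] \<in> listset As"
  using assms
proof (induction As arbitrary: f r)
  case Nil then show ?case by simp
next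
  case (Cons A As)
  have "map (\<lambda>j. f (Suc j)) [0..<length As] \<in> listset As"
  proof (rule Cons.IH)
    fix j assume "j < length As"
    then show "f (Suc j) \<in> As ! j" using Cons.prems(2)[of "Suc j"] Cons.prems(1) by simp
  qed simp
  moreover have "map f [0..<r] = f 0 # map (\<lambda>j. f (Suc j)) [0..<length As]"
    using Cons.prems(1) by (auto simp: map_upt_Suc simp del: upt_Suc)
  moreover have "f 0 \<in> A" using Cons.prems(2)[of 0] Cons.prems(1) by auto
  ultimately show ?case by (auto simp: set_Cons_def)
qed

text \<open>A set of tuples of positive density contains a blow-up without collisions that avoids any
given small set, because both kinds of exceptions have one factor \<open>card V\<close> less than the number of
all blow-ups.\<close>

lemma blowup_exists:
  assumes V: "finite V" and A: "A \<subseteq> tuples V r"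
    and dens: "\<delta> \<ge> 0" "real (card A) \<ge> \<delta> * real (card V) ^ r"
    and deg: "\<And>v. v \<in> V \<Longrightarrow> card {u \<in> V. R v u} \<le> d" and X: "X \<subseteq> V"
    and large: "\<delta> ^ (h ^ r) * real (card V) > real ((r * h) ^ 2 * d + r * h * card X)"
  obtains u where "\<And>j l. j < r \<Longrightarrow> l < h \<Longrightarrow> u j l \<in> V - X"
    "\<And>j l j' l'. \<lbrakk>j < r; l < h; j' < r; l' < h; (j, l) \<noteq> (j', l')\<rbrakk> \<Longrightarrow> \<not> R (u j l) (u j' l')"
    "\<And>f. (\<And>j. j < r \<Longrightarrow> f j < h) \<Longrightarrow> map (\<lambda>j. u j (f j)) [0..<r] \<in> A"
proof -
  let ?n = "card V"
  let ?B = "{us \<in> tuples (tuples V h) r. listset (map set us) \<subseteq> A}"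
  let ?C = "{xs \<in> tuples V (r * h). \<exists>i<r * h. \<exists>j<r * h. i \<noteq> j \<and> R (xs ! i) (xs ! j)}"
  let ?H = "{xs \<in> tuples V (r * h). set xs \<inter> X \<noteq> {}}"
  have n: "?n > 0"
  proof (rule ccontr)
    assume "\<not> ?n > 0"
    then have "\<delta> ^ (h ^ r) * real ?n = 0" by simp
    then show False using large of_nat_0_le_iff[of "(r * h)^2 * d + r * h * card X", where 'a = real] by linarith
  qed
  then have ne: "V \<noteq> {}" by auto
  have fT: "finite (tuples V m)" for m by (simp add: finite_tuples V)
  have fX: "finite X" using X V finite_subset by blast
  have "\<exists>us\<in>?B. flat_tuple h us \<notin> ?C \<union> ?H"
  proof (rule ccontr)
    assume "\<not> ?thesis"
    then have sub: "flat_tuple h ` ?B \<subseteq> ?C \<union> ?H" by blast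
    have "card ?B = card (flat_tuple h ` ?B)"
      by (rule card_image[symmetric], rule inj_on_subset[OF inj_on_flat_tuple]) auto
    also have "\<dots> \<le> card (?C \<union> ?H)" using fT by (intro card_mono sub) auto
    also have "\<dots> \<le> card ?C + card ?H" by (rule card_Un_le)
    also have "\<dots> \<le> (r * h)^2 * d * ?n ^ (r * h - 1) + r * h * card X * ?n ^ (r * h - 1)"
      by (intro add_mono card_colliding_tuples_le card_hitting_tuples_le V fX deg)
    finally have up: "card ?B \<le> ((r * h)^2 * d + r * h * card X) * ?n ^ (r * h - 1)"
      by (simp add: algebra_simps)
    have "\<delta> \<le> card A / ?n ^ r" using dens n by (simp add: field_simps)
    then have "\<delta> ^ (h ^ r) * real ?n ^ (r * h) \<le> (card A / ?n ^ r) ^ (h ^ r) * real ?n ^ (r * h)"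
      using dens by (intro mult_right_mono power_mono) auto
    also have "\<dots> \<le> card ?B" using card_blowups_ge[OF V ne A, of h] by simp
    also have "\<dots> \<le> real (((r * h)^2 * d + r * h * card X) * ?n ^ (r * h - 1))"
      using up by (simp only: of_nat_le_iff)
    finally have le: "\<delta> ^ (h ^ r) * real ?n ^ (r * h) \<le> real ((r * h)^2 * d + r * h * card X) * real ?n ^ (r * h - 1)"
      by simp
    show False
    proof (cases "r * h = 0")
      case True
      have "\<not> (\<delta> ^ (h ^ r) * real ?n ^ (r * h) \<le> real ((r * h)^2 * d + r * h * card X) * real ?n ^ (r * h - 1))"
      proof -
        have "\<delta> ^ (h ^ r) * real ?n > 0" using large by (meson le_less_trans of_nat_0_le_iff)
        then have "\<delta> ^ (h ^ r) > 0" using n by (simp add: zero_less_mult_iff)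
        then show ?thesis using True by auto
      qed
      then show False using le by blast
    next
      case False
      then have "real ?n ^ (r * h) = real ?n * real ?n ^ (r * h - 1)"
        by (metis power_eq_if)
      then have "(\<delta> ^ (h ^ r) * real ?n) * real ?n ^ (r * h - 1) \<le> real ((r * h)^2 * d + r * h * card X) * real ?n ^ (r * h - 1)"
        using le by (simp only: mult.assoc)
      then have "\<delta> ^ (h ^ r) * real ?n \<le> real ((r * h)^2 * d + r * h * card X)"
        by (rule mult_right_le_imp_le) (use n in simp)
      then show False using large by linarith
    qed
  qed
  then obtain us where us: "us \<in> tuples (tuples V h) r" "listset (map set us) \<subseteq> A"
    and notC: "flat_tuple h us \<notin> ?C" and notH: "flat_tuple h us \<notin> ?H" by blast
  have flat: "flat_tuple h us \<in> tuples V (r * h)" by (rule flat_tuple_in_tuples[OF us(1)])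
  have len: "length us = r" using us by (auto simp: tuples_def)
  have nth: "us ! j ! l = flat_tuple h us ! (j * h + l)" "j * h + l < r * h" if "j < r" "l < h" for j l
    using that len by (simp_all add: nth_flat_tuple flat_tuple_index)
  have lenj: "length (us ! j) = h" if "j < r" for j
    using tuples_nth[OF us(1) that] by (simp add: tuples_def)
  show thesis
  proof (rule that[of "\<lambda>j l. us ! j ! l"])
    fix j l assume jl: "j < r" "l < h"
    then have "flat_tuple h us ! (j * h + l) \<in> set (flat_tuple h us)"
      using flat by (intro nth_mem) (auto simp: tuples_def flat_tuple_index)
    then have "flat_tuple h us ! (j * h + l) \<in> V - X" using notH flat unfolding tuples_def by blast
    then show "us ! j ! l \<in> V - X" by (simp only: nth(1)[OF jl])
  next
    fix j l j' l' assume jl: "j < r" "l < h" "j' < r" "l' < h" "(j, l) \<noteq> (j', l')"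
    have "j * h + l \<noteq> j' * h + l'"
    proof
      assume eq: "j * h + l = j' * h + l'"
      then have "(j * h + l) div h = (j' * h + l') div h" "(j * h + l) mod h = (j' * h + l') mod h"
        by simp_all
      then show False using jl by simp
    qed
    then have "\<not> R (flat_tuple h us ! (j * h + l)) (flat_tuple h us ! (j' * h + l'))"
      using notC flat flat_tuple_index[OF jl(1,2)] flat_tuple_index[OF jl(3,4)] by blast
    then show "\<not> R (us ! j ! l) (us ! j' ! l')" by (simp only: nth(1)[OF jl(1,2)] nth(1)[OF jl(3,4)] not_False_eq_True)
  next
    fix f assume f: "\<And>j. j < r \<Longrightarrow> f j < h"
    have "map (\<lambda>j. us ! j ! f j) [0..<r] \<in> listset (map set us)"
      by (rule map_in_listset) (use len lenj f in auto)
    then show "map (\<lambda>j. us ! j ! f j) [0..<r] \<in> A" using us(2) by blast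
  qed
qed

section \<open>Covers and packings\<close>

text \<open>The convex set lies on one side of a line through the origin whose normal vector is
non-negative; the slope of the line is the infimum of the slopes dictated by the points below the
horizontal axis.\<close>

lemma planar_separation:
  fixes C :: "(real \<times> real) set"
  assumes conv: "\<And>a b c d \<alpha>. \<lbrakk>(a, b) \<in> C; (c, d) \<in> C; 0 \<le> \<alpha>; \<alpha> \<le> 1\<rbrakk>
      \<Longrightarrow> (\<alpha> * a + (1 - \<alpha>) * c, \<alpha> * b + (1 - \<alpha>) * d) \<in> C"
    and avoid: "\<And>a b. (a, b) \<in> C \<Longrightarrow> 0 \<le> a \<or> 0 \<le> b"
  obtains p where "0 \<le> p" "p \<le> 1" "\<And>a b. (a, b) \<in> C \<Longrightarrow> 0 \<le> p * a + (1 - p) * b"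
proof (cases "\<forall>a b. (a, b) \<in> C \<longrightarrow> 0 \<le> b")
  case True
  then show thesis by (intro that[of 0]) auto
next
  case False
  then obtain a0 b0 where 0: "(a0, b0) \<in> C" "b0 < 0" by force
  have key: "(- a) * (- d) \<le> b * c" if "(a, b) \<in> C" "a < 0" "(c, d) \<in> C" "d < 0" for a b c d
  proof (rule ccontr)
    assume "\<not> ?thesis"
    then have neg: "b * c < (- a) * (- d)" by simp
    have bc: "b \<ge> 0" "c \<ge> 0" using avoid[OF that(1)] avoid[OF that(3)] that by auto
    \<comment> \<open>Some point of the segment lies in the open negative quadrant; this weight balances
      the first coordinate slightly below zero.\<close>
    define e where "e = ((- a) * (- d) - b * c) / (2 * (b - d))"
    have bd: "b - d > 0" using bc that by simp
    have e: "e > 0" unfolding e_def using neg bd by simp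
    define s where "s = c - a + e"
    have s: "s > 0" unfolding s_def using bc that e by simp
    define \<alpha> where "\<alpha> = (c + e) / s"
    have 1: "1 - \<alpha> = - a / s" unfolding \<alpha>_def s_def using s by (simp add: s_def field_simps)
    have \<alpha>: "0 \<le> \<alpha>" "\<alpha> \<le> 1"
      using s bc e that 1 by (auto simp: \<alpha>_def s_def field_simps)
    have "\<alpha> * a + (1 - \<alpha>) * c = (e * a) / s"
      unfolding 1 unfolding \<alpha>_def using s by (simp add: field_simps)
    also have "\<dots> < 0" using e that s by (simp add: divide_neg_pos mult_pos_neg)
    finally have A: "\<alpha> * a + (1 - \<alpha>) * c < 0" .
    have eb: "e * (b - d) = ((- a) * (- d) - b * c) / 2" unfolding e_def using bd by (simp add: divide_simps)
    have "e * d \<le> 0" using e that by (simp add: mult_le_0_iff)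
    then have eb': "e * b \<le> ((- a) * (- d) - b * c) / 2" using eb by (simp add: algebra_simps)
    have "\<alpha> * b + (1 - \<alpha>) * d = (b * c + e * b - a * d) / s"
      unfolding 1 unfolding \<alpha>_def using s by (simp add: field_simps)
    also have "\<dots> < 0" using eb' neg s by (intro divide_neg_pos) (auto simp: field_simps)
    finally have B: "\<alpha> * b + (1 - \<alpha>) * d < 0" .
    show False using avoid[OF conv[OF that(1) that(3) \<alpha>]] A B by linarith
  qed
  \<comment> \<open>\<open>\<rho>\<close> is the slope of a line through the origin that separates the set from the quadrant.\<close>
  define D where "D = {c / (- d) | c d. (c, d) \<in> C \<and> d < 0}"
  define \<rho> where "\<rho> = Inf D"
  have Dne: "D \<noteq> {}" using 0 unfolding D_def by auto
  have Dpos: "0 \<le> x" if xD: "x \<in> D" for x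
  proof -
    obtain c d where "x = c / (- d)" "(c, d) \<in> C" "d < 0" using xD unfolding D_def by auto
    then show ?thesis using avoid[of c d] by (auto simp: divide_nonneg_neg divide_le_0_iff)
  qed
  have bdd: "bdd_below D" using Dpos by (intro bdd_belowI[of _ 0]) auto
  have \<rho>0: "\<rho> \<ge> 0" unfolding \<rho>_def by (intro cInf_greatest Dne Dpos)
  have main: "0 \<le> a + \<rho> * b" if ab: "(a, b) \<in> C" for a b
  proof (cases "b < 0")
    case True
    have "\<rho> \<le> a / (- b)" unfolding \<rho>_def
      by (rule cInf_lower) (use ab True bdd in \<open>auto simp: D_def\<close>)
    then show ?thesis using True by (simp add: field_simps)
  next
    case b: False
    show ?thesis
    proof (cases "a < 0")
      case False then show ?thesis using b \<rho>0 by simp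
    next
      case a: True
      have "b \<noteq> 0"
      proof
        assume "b = 0"
        then have "(- a) * (- b0) \<le> 0" using key[OF ab a 0] by simp
        then show False using a 0 by (simp add: mult_le_0_iff)
      qed
      then have bp: "b > 0" using b by simp
      have "(- a) / b \<le> \<rho>" unfolding \<rho>_def
      proof (rule cInf_greatest[OF Dne])
        fix x assume "x \<in> D"
        then obtain c d where cd: "x = c / (- d)" "(c, d) \<in> C" "d < 0" unfolding D_def by auto
        have "(- a) * (- d) \<le> c * b" using key[OF ab a cd(2,3)] by (simp add: mult.commute)
        then have "- a \<le> c * b / (- d)" using cd(3) by (subst pos_le_divide_eq) auto
        then show "(- a) / b \<le> x" unfolding cd(1) using bp by (subst pos_divide_le_eq) auto
      qed
      then show ?thesis using bp by (simp add: field_simps)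
    qed
  qed
  show thesis
  proof (rule that[of "1 / (1 + \<rho>)"])
    fix a b assume "(a, b) \<in> C"
    then have "0 \<le> (a + \<rho> * b) / (1 + \<rho>)" using main \<rho>0 by simp
    also have "\<dots> = 1 / (1 + \<rho>) * a + \<rho> / (1 + \<rho>) * b" by (simp add: add_divide_distrib)
    also have "\<rho> / (1 + \<rho>) = 1 - 1 / (1 + \<rho>)" using \<rho>0 by (simp add: field_simps)
    finally show "0 \<le> 1 / (1 + \<rho>) * a + (1 - 1 / (1 + \<rho>)) * b" .
  qed (use \<rho>0 in auto)
qed

text \<open>Induction on the dimension: the points with negative coordinate \<open>x\<close> are handled by the induction
hypothesis, and the functional obtained for them is combined with the coordinate \<open>x\<close> by planar
separation.\<close>

lemma orthant_separation:
  fixes C :: "('b \<Rightarrow> real) set"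
  assumes "finite Y" "Y \<noteq> {}"
    and "\<And>c d \<alpha>. \<lbrakk>c \<in> C; d \<in> C; 0 \<le> \<alpha>; \<alpha> \<le> 1\<rbrakk> \<Longrightarrow> (\<lambda>b. \<alpha> * c b + (1 - \<alpha>) * d b) \<in> C"
    and "\<And>c. c \<in> C \<Longrightarrow> \<exists>b\<in>Y. 0 \<le> c b"
  shows "\<exists>p. (\<forall>b\<in>Y. 0 \<le> p b) \<and> sum p Y = 1 \<and> (\<forall>c\<in>C. 0 \<le> (\<Sum>b\<in>Y. p b * c b))"
  using assms
proof (induction Y arbitrary: C rule: finite_ne_induct)
  case (singleton x)
  then show ?case by (intro exI[of _ "\<lambda>_. 1"]) auto
next
  case (insert x Y)
  define C' where "C' = {c \<in> C. c x < 0}"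
  have "\<exists>p. (\<forall>b\<in>Y. 0 \<le> p b) \<and> sum p Y = 1 \<and> (\<forall>c\<in>C'. 0 \<le> (\<Sum>b\<in>Y. p b * c b))"
  proof (rule insert.IH)
    fix c d and \<alpha> :: real
    assume cd: "c \<in> C'" "d \<in> C'" and \<alpha>: "0 \<le> \<alpha>" "\<alpha> \<le> 1"
    have "\<alpha> * c x + (1 - \<alpha>) * d x < 0"
    proof (cases "\<alpha> = 0")
      case False
      then have "\<alpha> * c x < 0" using \<alpha> cd by (simp add: C'_def mult_pos_neg)
      moreover have "(1 - \<alpha>) * d x \<le> 0" using \<alpha> cd by (simp add: C'_def mult_nonneg_nonpos)
      ultimately show ?thesis by linarith
    qed (use cd in \<open>simp add: C'_def\<close>)
    then show "(\<lambda>b. \<alpha> * c b + (1 - \<alpha>) * d b) \<in> C'"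
      using insert.prems(1) cd \<alpha> by (simp add: C'_def)
  next
    fix c assume "c \<in> C'"
    then show "\<exists>b\<in>Y. 0 \<le> c b" using insert.prems(2)[of c] by (auto simp: C'_def)
  qed
  then obtain p where p: "\<forall>b\<in>Y. 0 \<le> p b" "sum p Y = 1" "\<forall>c\<in>C'. 0 \<le> (\<Sum>b\<in>Y. p b * c b)" by blast
  define s where "s c = (\<Sum>b\<in>Y. p b * c b)" for c
  have s_lin: "s (\<lambda>b. \<alpha> * c b + (1 - \<alpha>) * d b) = \<alpha> * s c + (1 - \<alpha>) * s d" for \<alpha> c d
    by (simp add: s_def sum_distrib_left algebra_simps flip: sum.distrib)
  obtain l where l: "0 \<le> l" "l \<le> 1"
    "\<And>a b. (a, b) \<in> (\<lambda>c. (s c, c x)) ` C \<Longrightarrow> 0 \<le> l * a + (1 - l) * b"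
  proof (rule planar_separation[of "(\<lambda>c. (s c, c x)) ` C"])
    fix a b c d and \<alpha> :: real
    assume "(a, b) \<in> (\<lambda>c. (s c, c x)) ` C" "(c, d) \<in> (\<lambda>c. (s c, c x)) ` C" and \<alpha>: "0 \<le> \<alpha>" "\<alpha> \<le> 1"
    then obtain u v where uv: "u \<in> C" "v \<in> C" and eqs: "a = s u" "b = u x" "c = s v" "d = v x" by auto
    show "(\<alpha> * a + (1 - \<alpha>) * c, \<alpha> * b + (1 - \<alpha>) * d) \<in> (\<lambda>c. (s c, c x)) ` C"
      unfolding eqs
      by (intro image_eqI[OF _ insert.prems(1)[OF uv \<alpha>]]) (simp add: s_lin)
  next
    fix a b assume "(a, b) \<in> (\<lambda>c. (s c, c x)) ` C"
    then show "0 \<le> a \<or> 0 \<le> b" using p(3) by (force simp: C'_def s_def)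
  qed blast
  have p': "(\<Sum>b\<in>insert x Y. if b = x then 1 - l else l * p b) = 1"
    and s': "(\<Sum>b\<in>insert x Y. (if b = x then 1 - l else l * p b) * c b) = (1 - l) * c x + l * s c" for c
  proof -
    have e: "(\<Sum>b\<in>Y. if b = x then 1 - l else l * p b) = (\<Sum>b\<in>Y. l * p b)"
      "(\<Sum>b\<in>Y. (if b = x then 1 - l else l * p b) * c b) = (\<Sum>b\<in>Y. l * (p b * c b))"
      using insert.hyps by (auto intro!: sum.cong split: if_splits)
    show "(\<Sum>b\<in>insert x Y. if b = x then 1 - l else l * p b) = 1"
      using insert.hyps p(2) by (simp add: e flip: sum_distrib_left)
    show "(\<Sum>b\<in>insert x Y. (if b = x then 1 - l else l * p b) * c b) = (1 - l) * c x + l * s c"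
      using insert.hyps by (simp add: e s_def flip: sum_distrib_left)
  qed
  have "0 \<le> (1 - l) * c x + l * s c" if "c \<in> C" for c
    using l(3)[of "s c" "c x"] that by auto
  then show ?case using l(1,2) p(1)
    by (intro exI[of _ "\<lambda>b. if b = x then 1 - l else l * p b"]) (auto simp: p' s')
qed

text \<open>The minimax theorem for matrix games, as an alternative for the value \<open>\<theta>\<close>.\<close>

lemma matrix_game_alternative:
  fixes M :: "'a \<Rightarrow> 'b \<Rightarrow> real"
  assumes "finite Y" "Y \<noteq> {}" and fX: "finite X"
  shows "(\<exists>y. (\<forall>a\<in>X. 0 \<le> y a) \<and> sum y X = 1 \<and> (\<forall>b\<in>Y. (\<Sum>a\<in>X. y a * M a b) < \<theta>))
    \<or> (\<exists>p. (\<forall>b\<in>Y. 0 \<le> p b) \<and> sum p Y = 1 \<and> (\<forall>a\<in>X. \<theta> \<le> (\<Sum>b\<in>Y. p b * M a b)))"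
proof (cases "(\<forall>y. (\<forall>a\<in>X. 0 \<le> y a) \<longrightarrow> sum y X = 1 \<longrightarrow> (\<exists>b\<in>Y. \<theta> \<le> (\<Sum>a\<in>X. y a * M a b)))")
  case True
  then have *: "\<And>y. (\<forall>a\<in>X. 0 \<le> y a) \<Longrightarrow> sum y X = 1 \<Longrightarrow> (\<exists>b\<in>Y. \<theta> \<le> (\<Sum>a\<in>X. y a * M a b))"
    by blast+
  define C where "C = {\<lambda>b. (\<Sum>a\<in>X. y a * M a b) - \<theta> | y. (\<forall>a\<in>X. 0 \<le> y a) \<and> sum y X = 1}"
  have "\<exists>p. (\<forall>b\<in>Y. 0 \<le> p b) \<and> sum p Y = 1 \<and> (\<forall>c\<in>C. 0 \<le> (\<Sum>b\<in>Y. p b * c b))"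
  proof (rule orthant_separation[OF assms(1,2)])
    fix c d and \<alpha> :: real assume "c \<in> C" "d \<in> C" and \<alpha>: "0 \<le> \<alpha>" "\<alpha> \<le> 1"
    then obtain y z where y: "\<forall>a\<in>X. 0 \<le> y a" "sum y X = 1" "c = (\<lambda>b. (\<Sum>a\<in>X. y a * M a b) - \<theta>)"
      and z: "\<forall>a\<in>X. 0 \<le> z a" "sum z X = 1" "d = (\<lambda>b. (\<Sum>a\<in>X. z a * M a b) - \<theta>)"
      unfolding C_def by blast
    let ?w = "\<lambda>a. \<alpha> * y a + (1 - \<alpha>) * z a"
    have "(\<lambda>b. \<alpha> * c b + (1 - \<alpha>) * d b) = (\<lambda>b. (\<Sum>a\<in>X. ?w a * M a b) - \<theta>)"
      unfolding y z by (rule ext) (simp add: algebra_simps sum.distrib sum_subtractf sum_distrib_left)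
    moreover have "sum ?w X = 1"
      using y(2) z(2) by (simp add: sum.distrib flip: sum_distrib_left)
    moreover have "\<forall>a\<in>X. 0 \<le> ?w a" using y(1) z(1) \<alpha> by simp
    ultimately show "(\<lambda>b. \<alpha> * c b + (1 - \<alpha>) * d b) \<in> C" unfolding C_def
      by (intro CollectI exI[of _ ?w] conjI)
  next
    fix c assume "c \<in> C"
    then show "\<exists>b\<in>Y. 0 \<le> c b" unfolding C_def using * by fastforce
  qed
  then obtain p where p: "\<forall>b\<in>Y. 0 \<le> p b" "sum p Y = 1" "\<forall>c\<in>C. 0 \<le> (\<Sum>b\<in>Y. p b * c b)" by blast
  have "\<theta> \<le> (\<Sum>b\<in>Y. p b * M a b)" if "a \<in> X" for a
  proof -
    have e: "(\<Sum>a'\<in>X. (if a' = a then 1 else 0) * M a' b) = M a b" for b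
      using that fX by (simp add: if_distrib[of "\<lambda>x. x * _"] sum.delta cong: if_cong)
    have "sum (\<lambda>a'. if a' = a then 1 else (0::real)) X = 1" using that fX by simp
    then have "(\<lambda>b. M a b - \<theta>) \<in> C" unfolding C_def
      by (intro CollectI exI[of _ "\<lambda>a'. if a' = a then 1 else 0"]) (simp add: e)
    then have "0 \<le> (\<Sum>b\<in>Y. p b * (M a b - \<theta>))" using p(3) by (rule bspec[rotated])
    then show ?thesis
      using p(2) by (simp add: right_diff_distrib sum_subtractf flip: sum_distrib_right)
  qed
  then show ?thesis using p by blast
next
  case False
  then show ?thesis by (meson not_le)
qed

text \<open>An edge is a set of pairs, each pair standing for option \<open>p\<close> at place \<open>j\<close>. A place is charged for its most used option
only. In the game behind this alternative, one player picks an edge and the other picks an option at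
each place; a mixed strategy of the latter is a weighting \<open>w\<close>. The alternative is used twice: with
the vertices of a matching edge as options, to bound a matching number, and with the
colours as options, to find gains in all colours at once.\<close>

lemma cover_or_packing:
  fixes E :: "('a \<times> 'b) set set" and \<theta> :: real
  assumes J: "finite J" and P: "finite P" "P \<noteq> {}" and E: "finite E" and \<theta>: "\<theta> \<ge> 0"
  shows "(\<exists>gs. set gs \<subseteq> E \<and> real (\<Sum>j\<in>J. MAX p\<in>P. card {a. a < length gs \<and> (j, p) \<in> gs ! a}) < \<theta> * length gs)
    \<or> (\<exists>w. (\<forall>j\<in>J. \<forall>p\<in>P. 0 \<le> w j p) \<and> (\<forall>j\<in>J. (\<Sum>p\<in>P. w j p) = 1)
         \<and> (\<forall>g\<in>E. \<theta> \<le> (\<Sum>j\<in>J. \<Sum>p\<in>P. if (j, p) \<in> g then w j p else 0)))"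
proof -
  let ?Y = "\<Pi>\<^sub>E j\<in>J. P"
  let ?M = "\<lambda>g \<sigma>. real (\<Sum>j\<in>J. if (j, \<sigma> j) \<in> g then 1 else 0)"
  have fY: "finite ?Y" using J P by (intro finite_PiE) auto
  have Yne: "?Y \<noteq> {}" using P by (auto simp: PiE_eq_empty_iff)
  consider (pack) y where "\<And>g. g \<in> E \<Longrightarrow> 0 \<le> y g" "sum y E = 1" "\<And>\<sigma>. \<sigma> \<in> ?Y \<Longrightarrow> (\<Sum>g\<in>E. y g * ?M g \<sigma>) < \<theta>"
    | (cover) p where "\<And>\<sigma>. \<sigma> \<in> ?Y \<Longrightarrow> 0 \<le> p \<sigma>" "sum p ?Y = 1" "\<And>g. g \<in> E \<Longrightarrow> \<theta> \<le> (\<Sum>\<sigma>\<in>?Y. p \<sigma> * ?M g \<sigma>)"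
    using matrix_game_alternative[OF fY Yne E, of ?M \<theta>] by blast
  then show ?thesis
  proof cases
    case cover
    define w where "w j q = (\<Sum>\<sigma>\<in>?Y. if \<sigma> j = q then p \<sigma> else 0)" for j q
    have "0 \<le> w j q" for j q unfolding w_def by (intro sum_nonneg) (use cover(1) in auto)
    moreover have "(\<Sum>q\<in>P. w j q) = 1" if "j \<in> J" for j
    proof -
      have "(\<Sum>q\<in>P. w j q) = (\<Sum>\<sigma>\<in>?Y. \<Sum>q\<in>P. if \<sigma> j = q then p \<sigma> else 0)"
        unfolding w_def by (rule sum.swap)
      also have "\<dots> = (\<Sum>\<sigma>\<in>?Y. p \<sigma>)"
      proof (intro sum.cong refl)
        fix \<sigma> assume "\<sigma> \<in> ?Y"
        then have "\<sigma> j \<in> P" using that by auto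
        then show "(\<Sum>q\<in>P. if \<sigma> j = q then p \<sigma> else 0) = p \<sigma>" using P(1) by simp
      qed
      finally show ?thesis using cover(2) by simp
    qed
    moreover have "\<theta> \<le> (\<Sum>j\<in>J. \<Sum>q\<in>P. if (j, q) \<in> g then w j q else 0)" if "g \<in> E" for g
    proof -
      have "(\<Sum>q\<in>P. if (j, q) \<in> g then w j q else 0) = (\<Sum>\<sigma>\<in>?Y. if (j, \<sigma> j) \<in> g then p \<sigma> else 0)"
        if j: "j \<in> J" for j
      proof -
        have "(\<Sum>q\<in>P. if (j, q) \<in> g then w j q else 0)
          = (\<Sum>q\<in>P. \<Sum>\<sigma>\<in>?Y. if \<sigma> j = q then (if (j, \<sigma> j) \<in> g then p \<sigma> else 0) else 0)"
          unfolding w_def by (intro sum.cong refl) (auto intro!: sum.cong sum.neutral)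
        also have "\<dots> = (\<Sum>\<sigma>\<in>?Y. \<Sum>q\<in>P. if \<sigma> j = q then (if (j, \<sigma> j) \<in> g then p \<sigma> else 0) else 0)"
          by (rule sum.swap)
        also have "\<dots> = (\<Sum>\<sigma>\<in>?Y. if (j, \<sigma> j) \<in> g then p \<sigma> else 0)"
        proof (intro sum.cong refl)
          fix \<sigma> assume "\<sigma> \<in> ?Y"
          then have "\<sigma> j \<in> P" using j by auto
          then show "(\<Sum>q\<in>P. if \<sigma> j = q then (if (j, \<sigma> j) \<in> g then p \<sigma> else 0) else 0) = (if (j, \<sigma> j) \<in> g then p \<sigma> else 0)"
            using P(1) by simp
        qed
        finally show ?thesis .
      qed
      then have "(\<Sum>j\<in>J. \<Sum>q\<in>P. if (j, q) \<in> g then w j q else 0) = (\<Sum>j\<in>J. \<Sum>\<sigma>\<in>?Y. if (j, \<sigma> j) \<in> g then p \<sigma> else 0)"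
        by (intro sum.cong refl)
      also have "\<dots> = (\<Sum>\<sigma>\<in>?Y. \<Sum>j\<in>J. if (j, \<sigma> j) \<in> g then p \<sigma> else 0)" by (rule sum.swap)
      also have "\<dots> = (\<Sum>\<sigma>\<in>?Y. p \<sigma> * ?M g \<sigma>)"
        by (intro sum.cong refl) (auto simp: sum_distrib_left intro!: sum.cong)
      finally show ?thesis using cover(3)[OF that] by simp
    qed
    ultimately show ?thesis by blast
  next
    case pack
    define load where "load j p = (\<Sum>g\<in>E. if (j, p) \<in> g then y g else 0)" for j p
    define mx where "mx j = (MAX p\<in>P. load j p)" for j
    have "\<exists>\<sigma>. \<forall>j\<in>J. \<sigma> j \<in> P \<and> load j (\<sigma> j) = mx j"
    proof (rule bchoice, rule ballI)
      fix j
      have "mx j \<in> load j ` P" unfolding mx_def using P by (intro Max_in) auto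
      then show "\<exists>p. p \<in> P \<and> load j p = mx j" by auto
    qed
    then obtain \<sigma> where \<sigma>: "\<And>j. j \<in> J \<Longrightarrow> \<sigma> j \<in> P" "\<And>j. j \<in> J \<Longrightarrow> load j (\<sigma> j) = mx j" by blast
    let ?s = "restrict \<sigma> J"
    have "(\<Sum>j\<in>J. mx j) = (\<Sum>j\<in>J. \<Sum>g\<in>E. if (j, ?s j) \<in> g then y g else 0)"
      using \<sigma>(2) by (intro sum.cong refl) (simp add: load_def)
    also have "\<dots> = (\<Sum>g\<in>E. \<Sum>j\<in>J. if (j, ?s j) \<in> g then y g else 0)" by (rule sum.swap)
    also have "\<dots> = (\<Sum>g\<in>E. y g * ?M g ?s)"
      by (intro sum.cong refl) (auto simp: sum_distrib_left intro!: sum.cong)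
    also have "\<dots> < \<theta>" using \<sigma>(1) by (intro pack(3)) auto
    finally have lt: "(\<Sum>j\<in>J. mx j) < \<theta>" .
    \<comment> \<open>The strict inequality leaves room to round a large multiple of the packing down to
      an integral one.\<close>
    obtain h :: nat where h: "real h * (\<theta> - (\<Sum>j\<in>J. mx j)) > \<theta> * card E"
      using reals_Archimedean3[of "\<theta> - (\<Sum>j\<in>J. mx j)"] lt by auto
    define N where "N g = nat \<lfloor>real h * y g\<rfloor>" for g
    obtain es where es: "set es = E" "distinct es" using finite_distinct_list[OF E] by blast
    define gs where "gs = concat (map (\<lambda>g. replicate (N g) g) es)"
    have Nle: "real (N g) \<le> h * y g" if "g \<in> E" for g
      using pack(1)[OF that] by (simp add: N_def)
    have Nge: "real (N g) \<ge> h * y g - 1" if "g \<in> E" for g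
      using pack(1)[OF that] unfolding N_def by linarith
    have sub: "set gs \<subseteq> E" using es by (auto simp: gs_def)
    have len: "real (length gs) = (\<Sum>g\<in>E. real (N g))"
    proof -
      have "length gs = (\<Sum>g\<leftarrow>es. N g)" by (simp add: gs_def length_concat comp_def)
      also have "\<dots> = (\<Sum>g\<in>E. N g)" using es by (simp add: sum_list_distinct_conv_sum_set)
      finally show ?thesis by simp
    qed
    have cnt: "card {a. a < length gs \<and> (j, p) \<in> gs ! a} = (\<Sum>g\<in>E. if (j, p) \<in> g then N g else 0)" for j p
    proof -
      have "card {a. a < length gs \<and> (j, p) \<in> gs ! a} = length (filter (\<lambda>g. (j, p) \<in> g) gs)"
        by (simp add: length_filter_conv_card)
      also have "\<dots> = (\<Sum>g\<leftarrow>es. if (j, p) \<in> g then N g else 0)"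
        unfolding gs_def by (induction es) auto
      also have "\<dots> = (\<Sum>g\<in>E. if (j, p) \<in> g then N g else 0)"
        using es by (simp add: sum_list_distinct_conv_sum_set)
      finally show ?thesis .
    qed
    have le: "real (MAX p\<in>P. card {a. a < length gs \<and> (j, p) \<in> gs ! a}) \<le> h * mx j" for j
    proof -
      have "(MAX p\<in>P. card {a. a < length gs \<and> (j, p) \<in> gs ! a}) \<in> (\<lambda>p. card {a. a < length gs \<and> (j, p) \<in> gs ! a}) ` P"
        using P by (intro Max_in) auto
      then obtain p where p: "p \<in> P" "(MAX p\<in>P. card {a. a < length gs \<and> (j, p) \<in> gs ! a}) = card {a. a < length gs \<and> (j, p) \<in> gs ! a}"
        by blast
      have "real (card {a. a < length gs \<and> (j, p) \<in> gs ! a}) = (\<Sum>g\<in>E. if (j, p) \<in> g then real (N g) else 0)"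
        unfolding cnt by (simp add: of_nat_sum if_distrib cong: if_cong)
      also have "\<dots> \<le> (\<Sum>g\<in>E. h * (if (j, p) \<in> g then y g else 0))"
        by (intro sum_mono) (use Nle in auto)
      also have "\<dots> = h * load j p" by (simp add: load_def sum_distrib_left)
      also have "\<dots> \<le> h * mx j" unfolding mx_def using P p by (intro mult_left_mono Max_ge) auto
      finally show ?thesis using p by simp
    qed
    have "real (\<Sum>j\<in>J. MAX p\<in>P. card {a. a < length gs \<and> (j, p) \<in> gs ! a}) \<le> (\<Sum>j\<in>J. h * mx j)"
      unfolding of_nat_sum by (intro sum_mono le)
    also have "\<dots> = h * (\<Sum>j\<in>J. mx j)" by (simp add: sum_distrib_left)
    also have "\<dots> < \<theta> * (real h - card E)" using h by (simp add: algebra_simps)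
    also have "real h - card E = (\<Sum>g\<in>E. h * y g - 1)"
      using pack(2) by (simp add: sum_subtractf flip: sum_distrib_left)
    also have "\<theta> * (\<Sum>g\<in>E. h * y g - 1) \<le> \<theta> * (\<Sum>g\<in>E. real (N g))"
      by (intro mult_left_mono sum_mono Nge \<theta>)
    also have "\<dots> = \<theta> * length gs" by (simp add: len)
    finally show ?thesis using sub by blast
  qed
qed

section \<open>Rounding light covers\<close>

lemma homogeneous_system_nontrivial:
  fixes c :: "'t \<Rightarrow> 's \<Rightarrow> real"
  assumes "finite T" "finite S" "card T < card S"
  shows "\<exists>d. (\<exists>s\<in>S. d s \<noteq> 0) \<and> (\<forall>t\<in>T. (\<Sum>s\<in>S. c t s * d s) = 0)"
  using assms
proof (induction T arbitrary: S c rule: finite_induct)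
  case empty
  then obtain s where "s \<in> S" by (metis card.empty ex_in_conv less_irrefl)
  then show ?case by (intro exI[of _ "\<lambda>_. 1"]) auto
next
  case (insert t T)
  show ?case
  proof (cases "\<forall>s\<in>S. c t s = 0")
    case True
    obtain d where "\<exists>s\<in>S. d s \<noteq> 0" "\<forall>t\<in>T. (\<Sum>s\<in>S. c t s * d s) = 0"
      using insert.IH[of S c] insert.prems insert.hyps by auto
    then show ?thesis using True by (intro exI[of _ d]) auto
  next
    case False
    then obtain s0 where s0: "s0 \<in> S" "c t s0 \<noteq> 0" by blast
    let ?S = "S - {s0}"
    define c' where "c' t' s = c t' s - c t' s0 * c t s / c t s0" for t' s
    have "card T < card ?S" using insert.prems insert.hyps s0 by simp
    then obtain d where d: "\<exists>s\<in>?S. d s \<noteq> 0" "\<forall>t'\<in>T. (\<Sum>s\<in>?S. c' t' s * d s) = 0"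
      using insert.IH[of ?S c'] insert.prems by auto
    define e where "e = d(s0 := - (\<Sum>s\<in>?S. c t s * d s) / c t s0)"
    have sum_e: "(\<Sum>s\<in>S. a s * e s) = (\<Sum>s\<in>?S. a s * d s) - a s0 * (\<Sum>s\<in>?S. c t s * d s) / c t s0" for a
    proof -
      have "(\<Sum>s\<in>S. a s * e s) = a s0 * e s0 + (\<Sum>s\<in>?S. a s * e s)"
        using insert.prems s0 by (simp add: sum.remove)
      also have "(\<Sum>s\<in>?S. a s * e s) = (\<Sum>s\<in>?S. a s * d s)"
        by (intro sum.cong) (auto simp: e_def)
      finally show ?thesis by (simp add: e_def)
    qed
    have "(\<Sum>s\<in>S. c t' s * e s) = 0" if "t' \<in> insert t T" for t'
    proof (cases "t' = t")
      case True then show ?thesis using s0 by (simp add: sum_e)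
    next
      case False
      then have "(\<Sum>s\<in>?S. c' t' s * d s) = 0" using d that by auto
      moreover have "(\<Sum>s\<in>?S. c' t' s * d s) = (\<Sum>s\<in>?S. c t' s * d s) - c t' s0 * (\<Sum>s\<in>?S. c t s * d s) / c t s0"
        by (simp add: c'_def left_diff_distrib sum_subtractf sum_distrib_left sum_divide_distrib mult.assoc)
      ultimately show ?thesis by (simp add: sum_e)
    qed
    moreover have "\<exists>s\<in>S. e s \<noteq> 0" using d(1) by (auto simp: e_def)
    ultimately show ?thesis by blast
  qed
qed

text \<open>As long as there are more fractional coordinates than tight constraints, some direction
keeps all tight constraints and does not decrease the objective; moving along it makes one more
coordinate integral or one more constraint tight.\<close>

lemma few_fractional_coordinates:
  fixes w :: "nat \<Rightarrow> 'a \<Rightarrow> real" and p :: "'a \<Rightarrow> real"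
  assumes I: "finite I"
    and "\<And>j. j \<in> I \<Longrightarrow> 0 \<le> x j \<and> x j \<le> 1" "\<And>i. i < k \<Longrightarrow> (\<Sum>j\<in>I. w i j * x j) \<le> b"
  shows "\<exists>y. (\<forall>j\<in>I. 0 \<le> y j \<and> y j \<le> 1) \<and> (\<forall>i<k. (\<Sum>j\<in>I. w i j * y j) \<le> b)
    \<and> (\<Sum>j\<in>I. p j * x j) \<le> (\<Sum>j\<in>I. p j * y j)
    \<and> card {j \<in> I. 0 < y j \<and> y j < 1} \<le> card {i. i < k \<and> (\<Sum>j\<in>I. w i j * y j) = b}"
  using assms(2,3)
proof (induction "card {j \<in> I. 0 < x j \<and> x j < 1} + card {i. i < k \<and> (\<Sum>j\<in>I. w i j * x j) < b}"
    arbitrary: x rule: less_induct)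
  case less
  let ?D = "\<lambda>x. {j \<in> I. 0 < x j \<and> x j < 1}"
  let ?T = "\<lambda>x. {i. i < k \<and> (\<Sum>j\<in>I. w i j * x j) = b}"
  let ?N = "\<lambda>x. {i. i < k \<and> (\<Sum>j\<in>I. w i j * x j) < b}"
  show ?case
  proof (cases "card (?D x) \<le> card (?T x)")
    case True
    then show ?thesis using less.prems by (intro exI[of _ x]) auto
  next
    case False
    have fD: "finite (?D x)" using I by simp
    obtain d0 where d0: "\<exists>s\<in>?D x. d0 s \<noteq> 0" "\<forall>i\<in>?T x. (\<Sum>s\<in>?D x. w i s * d0 s) = 0"
      using homogeneous_system_nontrivial[of "?T x" "?D x" w] False fD by auto
    define d1 where "d1 j = (if j \<in> ?D x then d0 j else 0)" for j
    define d where "d = (if (\<Sum>j\<in>I. p j * d1 j) \<ge> 0 then d1 else (\<lambda>j. - d1 j))"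
    have d1_sum: "(\<Sum>j\<in>I. w i j * d1 j) = (\<Sum>s\<in>?D x. w i s * d0 s)" for i
      using I by (intro sum.mono_neutral_cong_right) (auto simp: d1_def)
    have d_psi: "0 \<le> (\<Sum>j\<in>I. p j * d j)" by (auto simp: d_def sum_negf)
    have d_T: "(\<Sum>j\<in>I. w i j * d j) = 0" if "i \<in> ?T x" for i
      using d0(2) that by (auto simp: d_def sum_negf d1_sum)
    have d_out: "d j = 0" if "j \<notin> ?D x" for j using that by (auto simp: d_def d1_def)
    obtain s0 where s0: "s0 \<in> ?D x" "d s0 \<noteq> 0" using d0(1) by (auto simp: d_def d1_def)
    let ?dw = "\<lambda>i. \<Sum>j\<in>I. w i j * d j"
    let ?xw = "\<lambda>i. \<Sum>j\<in>I. w i j * x j"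
    \<comment> \<open>the first moment at which a coordinate or a constraint stops the movement along \<open>d\<close>\<close>
    define \<Lambda> where "\<Lambda> = (\<lambda>j. (if d j > 0 then 1 - x j else - x j) / d j) ` {j \<in> ?D x. d j \<noteq> 0}
       \<union> (\<lambda>i. (b - ?xw i) / ?dw i) ` {i. i < k \<and> ?dw i > 0}"
    have fin: "finite \<Lambda>" using I by (simp add: \<Lambda>_def)
    have ne: "\<Lambda> \<noteq> {}" using s0 by (auto simp: \<Lambda>_def)
    define l where "l = Min \<Lambda>"
    have lin: "l \<in> \<Lambda>" unfolding l_def using fin ne by (rule Min_in)
    have lle: "l \<le> y" if "y \<in> \<Lambda>" for y unfolding l_def using fin that by (rule Min_le)
    have pos: "0 < y" if y: "y \<in> \<Lambda>" for y
    proof -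
      consider j where "j \<in> ?D x" "d j \<noteq> 0" "y = (if d j > 0 then 1 - x j else - x j) / d j"
        | i where "i < k" "?dw i > 0" "y = (b - ?xw i) / ?dw i" using y unfolding \<Lambda>_def by blast
      then show ?thesis
      proof cases
        case 1 then show ?thesis by (auto simp: zero_less_divide_iff not_less)
      next
        case 2
        then have "?xw i \<noteq> b" using d_T[of i] by auto
        then show ?thesis using 2 less.prems(2)[of i] by auto
      qed
    qed
    have l0: "l > 0" using pos lin by blast
    define y where "y j = x j + l * d j" for j
    have yw: "(\<Sum>j\<in>I. w i j * y j) = ?xw i + l * ?dw i" for i
      by (simp add: y_def algebra_simps sum.distrib sum_distrib_left)
    have y01: "0 \<le> y j \<and> y j \<le> 1" if j: "j \<in> I" for j
    proof (cases "j \<in> ?D x \<and> d j \<noteq> 0")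
      case False
      then have "d j = 0" using d_out by blast
      then show ?thesis using less.prems(1)[OF j] by (simp add: y_def)
    next
      case True
      then have "l \<le> (if d j > 0 then 1 - x j else - x j) / d j" by (intro lle) (auto simp: \<Lambda>_def)
      note le = this
      show ?thesis
      proof (cases "d j > 0")
        case dj: True
        then have "l * d j \<le> 1 - x j" using le by (simp add: pos_le_divide_eq)
        moreover have "0 < l * d j" using l0 dj by simp
        moreover have "0 < x j" using True by auto
        ultimately show ?thesis unfolding y_def by linarith
      next
        case dj: False
        then have neg: "d j < 0" using True by auto
        have "(- x j / d j) * d j \<le> l * d j" using le dj neg by (intro mult_right_mono_neg) auto
        then have "- x j \<le> l * d j" using neg by simp
        moreover have "l * d j < 0" using l0 neg by (simp add: mult_pos_neg)
        moreover have "x j < 1" using True by auto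
        ultimately show ?thesis unfolding y_def by linarith
      qed
    qed
    have yb: "(\<Sum>j\<in>I. w i j * y j) \<le> b" if i: "i < k" for i
    proof (cases "?dw i > 0")
      case True
      then have "l \<le> (b - ?xw i) / ?dw i" using i by (intro lle) (auto simp: \<Lambda>_def)
      then show ?thesis using True by (simp add: yw pos_le_divide_eq)
    next
      case False
      then have "l * ?dw i \<le> 0" using l0 by (simp add: mult_le_0_iff)
      then show ?thesis using less.prems(2)[OF i] by (simp add: yw)
    qed
    have Dsub: "?D y \<subseteq> ?D x"
    proof
      fix j assume j: "j \<in> ?D y"
      show "j \<in> ?D x"
      proof (rule ccontr)
        assume "j \<notin> ?D x"
        moreover from this have "y j = x j" using d_out by (simp add: y_def)
        ultimately show False using j by simp
      qed
    qed
    have Nsub: "?N y \<subseteq> ?N x"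
    proof
      fix i assume i: "i \<in> ?N y"
      then have "?xw i \<noteq> b" using d_T[of i] by (auto simp: yw)
      then show "i \<in> ?N x" using i less.prems(2)[of i] by auto
    qed
    have "?D y \<subset> ?D x \<or> ?N y \<subset> ?N x"
    proof -
      consider j where "j \<in> ?D x" "d j \<noteq> 0" "l = (if d j > 0 then 1 - x j else - x j) / d j"
        | i where "i < k" "?dw i > 0" "l = (b - ?xw i) / ?dw i" using lin unfolding \<Lambda>_def by blast
      then show ?thesis
      proof cases
        case 1
        then have "y j = 0 \<or> y j = 1" by (auto simp: y_def)
        then have "j \<notin> ?D y" by auto
        then show ?thesis using 1(1) Dsub by blast
      next
        case 2
        then have "?xw i \<noteq> b" using d_T[of i] by auto
        moreover have "(\<Sum>j\<in>I. w i j * y j) = b" using 2 by (simp add: yw)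
        ultimately have "i \<in> ?N x" "i \<notin> ?N y" using 2(1) less.prems(2)[of i] by auto
        then show ?thesis using Nsub by blast
      qed
    qed
    then have "card (?D y) + card (?N y) < card (?D x) + card (?N x)"
    proof
      assume "?D y \<subset> ?D x"
      then have "card (?D y) < card (?D x)" by (intro psubset_card_mono fD)
      moreover have "card (?N y) \<le> card (?N x)" by (intro card_mono Nsub) simp
      ultimately show ?thesis by linarith
    next
      assume "?N y \<subset> ?N x"
      then have "card (?N y) < card (?N x)" by (intro psubset_card_mono) auto
      moreover have "card (?D y) \<le> card (?D x)" by (intro card_mono Dsub fD)
      ultimately show ?thesis by linarith
    qed
    from less.hyps[OF this y01 yb] obtain z where z: "\<forall>j\<in>I. 0 \<le> z j \<and> z j \<le> 1" "\<forall>i<k. (\<Sum>j\<in>I. w i j * z j) \<le> b"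
      "(\<Sum>j\<in>I. p j * y j) \<le> (\<Sum>j\<in>I. p j * z j)" "card (?D z) \<le> card (?T z)" by blast
    have "(\<Sum>j\<in>I. p j * y j) = (\<Sum>j\<in>I. p j * x j) + l * (\<Sum>j\<in>I. p j * d j)"
      by (simp add: y_def algebra_simps sum.distrib sum_distrib_left)
    then have "(\<Sum>j\<in>I. p j * x j) \<le> (\<Sum>j\<in>I. p j * z j)" using z(3) l0 d_psi
        mult_nonneg_nonneg[of l "\<Sum>j\<in>I. p j * d j"] by linarith
    then show ?thesis using z by blast
  qed
qed

lemma sum_le_ones_plus_fractional:
  fixes x :: "'a \<Rightarrow> real"
  assumes I: "finite I" and x: "\<And>j. j \<in> I \<Longrightarrow> 0 \<le> x j \<and> x j \<le> 1"
  shows "(\<Sum>j\<in>I. x j) = card {j \<in> I. x j = 1} + (\<Sum>j\<in>{j \<in> I. 0 < x j \<and> x j < 1}. x j)"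
proof -
  let ?E = "{j \<in> I. x j = 1}" and ?D = "{j \<in> I. 0 < x j \<and> x j < 1}"
  have "(\<Sum>j\<in>I. x j) = (\<Sum>j\<in>?E \<union> ?D. x j)"
  proof (rule sum.mono_neutral_right[OF I])
    show "\<forall>j\<in>I - (?E \<union> ?D). x j = 0" using x by force
  qed auto
  also have "\<dots> = (\<Sum>j\<in>?E. x j) + (\<Sum>j\<in>?D. x j)"
    using I by (intro sum.union_disjoint) auto
  also have "(\<Sum>j\<in>?E. x j) = card ?E" by simp
  finally show ?thesis .
qed

text \<open>The solution has at most as many fractional coordinates as there are tight constraints, and every tight
constraint contributes almost one to the difference between the number of chosen points
and the objective. So at least \<open>t\<close> coordinates equal one.\<close>

lemma uncovered_set_exists:
  fixes w :: "nat \<Rightarrow> 'a \<Rightarrow> real"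
  assumes I: "finite I" and w: "\<And>i j. i < k \<Longrightarrow> j \<in> I \<Longrightarrow> 0 \<le> w i j"
    and c: "\<And>i. i < k \<Longrightarrow> (\<Sum>j\<in>I. w i j) \<le> c i" and Q: "\<And>i. i < k \<Longrightarrow> c i \<le> Q" "Q \<ge> 1"
    and t: "t \<ge> 1" and large: "real (card I) > (real t - 1) * Q + (\<Sum>i<k. c i)"
  shows "\<exists>e. e \<subseteq> I \<and> card e = t \<and> (\<forall>i<k. (\<Sum>j\<in>e. w i j) < 1)"
proof -
  define M where "M = (card I - (\<Sum>i<k. c i)) / Q"
  define g where "g = M - (real t - 1)"
  have g: "g > 0" using large Q(2) by (simp add: g_def M_def field_simps)
  have M0: "M \<ge> 0" using g t by (simp add: g_def)
  define e where "e = min (1/2) (g / (2 * (k + M + 1)))"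
  define b where "b = 1 - e"
  have e: "e > 0" "e \<le> 1/2" using g M0 unfolding e_def by (simp, intro min.cobounded1)
  have eg: "e * (k + M) < g"
  proof -
    have "e * (k + M) \<le> g / (2 * (k + M + 1)) * (k + M)"
      using M0 by (intro mult_right_mono) (auto simp: e_def)
    also have "\<dots> = g * ((k + M) / (2 * (k + M + 1)))" by simp
    also have "\<dots> < g * 1" using g M0 by (intro mult_strict_left_mono) (auto simp: field_simps)
    finally show ?thesis by simp
  qed
  have b: "0 < b" "b < 1" using e by (auto simp: b_def)
  have bQ: "b / Q \<le> 1" using b Q(2) by simp
  \<comment> \<open>maximising the total weight not spent on any cover\<close>
  define p where "p j = 1 - (\<Sum>i<k. w i j)" for j
  have start: "(\<Sum>j\<in>I. w i j * (b / Q)) \<le> b" if i: "i < k" for i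
  proof -
    have "(\<Sum>j\<in>I. w i j * (b / Q)) = (\<Sum>j\<in>I. w i j) * (b / Q)" by (rule sum_distrib_right[symmetric])
    also have "\<dots> \<le> Q * (b / Q)" using c[OF i] Q(1)[OF i] Q(2) b by (intro mult_right_mono) auto
    finally show ?thesis using Q(2) by simp
  qed
  obtain x where x: "\<And>j. j \<in> I \<Longrightarrow> 0 \<le> x j \<and> x j \<le> 1" "\<And>i. i < k \<Longrightarrow> (\<Sum>j\<in>I. w i j * x j) \<le> b"
    "(\<Sum>j\<in>I. p j * (b / Q)) \<le> (\<Sum>j\<in>I. p j * x j)"
    "card {j \<in> I. 0 < x j \<and> x j < 1} \<le> card {i. i < k \<and> (\<Sum>j\<in>I. w i j * x j) = b}"
    using few_fractional_coordinates[OF I, of "\<lambda>_. b / Q" k w b p] bQ b Q(2) start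
    by (auto simp: zero_le_divide_iff)
  let ?E = "{j \<in> I. x j = 1}" and ?D = "{j \<in> I. 0 < x j \<and> x j < 1}"
  let ?T = "{i. i < k \<and> (\<Sum>j\<in>I. w i j * x j) = b}"
  have "b * M \<le> (\<Sum>j\<in>I. p j * (b / Q))"
  proof -
    have "(\<Sum>j\<in>I. p j * (b / Q)) = (card I - (\<Sum>i<k. \<Sum>j\<in>I. w i j)) * (b / Q)"
      unfolding sum_distrib_right[symmetric] p_def by (simp add: sum_subtractf sum.swap[of _ I])
    also have "\<dots> \<ge> (card I - (\<Sum>i<k. c i)) * (b / Q)"
      using b Q(2) by (intro mult_right_mono diff_left_mono sum_mono c) auto
    finally show ?thesis using Q(2) by (simp add: M_def mult.commute)
  qed
  then have psi: "b * M \<le> (\<Sum>j\<in>I. p j * x j)" using x(3) by linarith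
  have "(\<Sum>j\<in>I. x j) = (\<Sum>j\<in>I. p j * x j) + (\<Sum>i<k. \<Sum>j\<in>I. w i j * x j)"
    by (simp add: p_def left_diff_distrib sum_subtractf sum_distrib_right sum.swap[of _ I])
  moreover have "(\<Sum>i<k. \<Sum>j\<in>I. w i j * x j) \<ge> card ?T * b"
  proof -
    have "(\<Sum>i<k. \<Sum>j\<in>I. w i j * x j) \<ge> (\<Sum>i\<in>?T. \<Sum>j\<in>I. w i j * x j)"
      using w x(1) by (intro sum_mono2) (auto intro!: sum_nonneg)
    then show ?thesis by simp
  qed
  moreover have "(\<Sum>j\<in>?D. x j) \<le> card ?D"
    using sum_bounded_above[of ?D x 1] by force
  moreover have "card ?T \<le> k" using card_mono[of "{..<k}" ?T] by auto
  ultimately have "card ?E \<ge> b * M + card ?T * b - card ?T"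
    using psi sum_le_ones_plus_fractional[OF I, of x] x(1,4) by simp
  also have "b * M + card ?T * b - card ?T = M - e * (card ?T + M)" by (simp add: b_def algebra_simps)
  finally have "real (card ?E) \<ge> M - e * (card ?T + M)" .
  moreover have "e * (card ?T + M) \<le> e * (k + M)"
    using e \<open>card ?T \<le> k\<close> by (intro mult_left_mono) auto
  ultimately have "real (card ?E) > real t - 1" using eg by (simp add: g_def)
  then have "t \<le> card ?E" by linarith
  then obtain e' where e': "e' \<subseteq> ?E" "card e' = t" by (rule obtain_subset_with_card_n)
  have "(\<Sum>j\<in>e'. w i j) < 1" if i: "i < k" for i
  proof -
    have "(\<Sum>j\<in>e'. w i j) = (\<Sum>j\<in>e'. w i j * x j)" using e' by (intro sum.cong) auto
    also have "\<dots> \<le> (\<Sum>j\<in>I. w i j * x j)"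
      using e' i I w x(1) by (intro sum_mono2) (auto intro!: mult_nonneg_nonneg)
    also have "\<dots> \<le> b" by (rule x(2)[OF i])
    finally show ?thesis using b by simp
  qed
  then show ?thesis using e' by (intro exI[of _ e']) auto
qed

text \<open>Maximising the number of points under the constraint that no cover reaches one gives almost
\<open>t - 1 + k\<close> points. At most \<open>t - 1\<close> coordinates equal one since these points contain no
covered set, so there are exactly \<open>k\<close> fractional ones and they are close to one. Two of them cannot complete
the \<open>t - 1\<close> points to sets covered by the same cover.\<close>

lemma rainbow_star_exists:
  fixes w :: "nat \<Rightarrow> 'a \<Rightarrow> real"
  assumes I: "finite I" and w: "\<And>i j. i < k \<Longrightarrow> j \<in> I \<Longrightarrow> 0 \<le> w i j"
    and c: "\<And>i. i < k \<Longrightarrow> (\<Sum>j\<in>I. w i j) \<le> c" "c \<ge> 1"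
    and k: "k \<ge> 1" and t: "t \<ge> 1" and large: "real (card I) \<ge> (real (t - 1 + k) - 1/4) * c"
    and cov: "\<And>e. e \<subseteq> I \<Longrightarrow> card e = t \<Longrightarrow> \<exists>i<k. e \<in> F i"
    and F: "\<And>i e. i < k \<Longrightarrow> e \<subseteq> I \<Longrightarrow> card e = t \<Longrightarrow> e \<in> F i \<Longrightarrow> 1 \<le> (\<Sum>j\<in>e. w i j)"
  shows "\<exists>Q v. Q \<subseteq> I \<and> card Q = t - 1 \<and> inj_on v {..<k} \<and> (\<forall>i<k. v i \<in> I - Q \<and> insert (v i) Q \<in> F i)"
proof -
  define L where "L = real (t - 1 + k)"
  have L: "L \<ge> 1" "L = real t - 1 + k" using k t by (auto simp: L_def of_nat_diff)
  define b where "b = 1 - 1 / (4 * L)"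
  have b: "0 < b" "b < 1" using L by (auto simp: b_def field_simps)
  have start: "(\<Sum>j\<in>I. w i j * (b / c)) \<le> b" if i: "i < k" for i
  proof -
    have "(\<Sum>j\<in>I. w i j * (b / c)) = (\<Sum>j\<in>I. w i j) * (b / c)" by (rule sum_distrib_right[symmetric])
    also have "\<dots> \<le> c * (b / c)" using c(1)[OF i] c(2) b by (intro mult_right_mono) auto
    finally show ?thesis using c(2) by simp
  qed
  have bc: "0 \<le> b / c" "b / c \<le> 1" using b c(2) by auto
  obtain x where x: "\<And>j. j \<in> I \<Longrightarrow> 0 \<le> x j \<and> x j \<le> 1" "\<And>i. i < k \<Longrightarrow> (\<Sum>j\<in>I. w i j * x j) \<le> b"
    "(\<Sum>j\<in>I. 1 * (b / c)) \<le> (\<Sum>j\<in>I. 1 * x j)"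
    "card {j \<in> I. 0 < x j \<and> x j < 1} \<le> card {i. i < k \<and> (\<Sum>j\<in>I. w i j * x j) = b}"
    using few_fractional_coordinates[OF I, of "\<lambda>_. b / c" k w b "\<lambda>_. 1"] bc start by blast
  let ?E = "{j \<in> I. x j = 1}" and ?D = "{j \<in> I. 0 < x j \<and> x j < 1}"
  have fE: "finite ?E" "finite ?D" using I by auto
  have wE: "(\<Sum>j\<in>?E. w i j) + (\<Sum>j\<in>A. w i j * x j) \<le> b" if i: "i < k" and A: "A \<subseteq> ?D" for i A
  proof -
    have "(\<Sum>j\<in>?E. w i j) + (\<Sum>j\<in>A. w i j * x j) = (\<Sum>j\<in>?E. w i j * x j) + (\<Sum>j\<in>A. w i j * x j)"
      by (intro arg_cong2[where f = "(+)"] sum.cong) auto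
    also have "\<dots> = (\<Sum>j\<in>?E \<union> A. w i j * x j)"
      using fE A by (intro sum.union_disjoint[symmetric]) (auto intro: finite_subset)
    also have "\<dots> \<le> (\<Sum>j\<in>I. w i j * x j)"
      using I A i w x(1) by (intro sum_mono2) (auto intro!: mult_nonneg_nonneg)
    finally show ?thesis using x(2)[OF i] by simp
  qed
  have E: "card ?E \<le> t - 1"
  proof (rule ccontr)
    assume "\<not> ?thesis"
    then have "t \<le> card ?E" by simp
    then obtain e where e: "e \<subseteq> ?E" "card e = t" by (rule obtain_subset_with_card_n)
    then obtain i where i: "i < k" "e \<in> F i" using cov[of e] by auto
    then have "1 \<le> (\<Sum>j\<in>e. w i j)" using e by (intro F) auto
    also have "\<dots> \<le> (\<Sum>j\<in>?E. w i j)" using e fE w i by (intro sum_mono2) auto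
    finally show False using wE[OF i(1), of "{}"] b by simp
  qed
  have Dk: "card ?D \<le> k"
  proof -
    have "card {i. i < k \<and> (\<Sum>j\<in>I. w i j * x j) = b} \<le> card {..<k}" by (intro card_mono) auto
    then show ?thesis using x(4) by simp
  qed
  have xsum: "(\<Sum>j\<in>I. x j) \<ge> L - 1/2"
  proof -
    have "(L - 1/4) * c * (b / c) \<le> card I * (b / c)"
      using large bc unfolding L_def by (intro mult_right_mono) auto
    moreover have "(L - 1/4) * c * (b / c) = (L - 1/4) * b" using c(2) by simp
    moreover have "(L - 1/4) * b \<ge> L - 1/2" using L by (simp add: b_def field_simps)
    ultimately show ?thesis using x(3) by simp
  qed
  have Dsum: "(\<Sum>j\<in>A. x j) \<le> card A" if "A \<subseteq> ?D" for A
    using sum_bounded_above[of A x 1] that by force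
  have tot: "L - 1/2 \<le> card ?E + (\<Sum>j\<in>?D. x j)"
    using xsum sum_le_ones_plus_fractional[OF I x(1)] by simp
  then have "real (card ?E) \<ge> real t - 1 - 1/2" using Dsum[OF order_refl] Dk L by linarith
  then have E_eq: "card ?E = t - 1" using E t by linarith
  have Dge: "(\<Sum>j\<in>?D. x j) \<ge> k - 1/2" using tot E_eq L t by (simp add: of_nat_diff)
  have D_eq: "card ?D = k" using Dge Dsum[OF order_refl] Dk by linarith
  have big: "x u + x v \<ge> 1" if uv: "u \<in> ?D" "v \<in> ?D" "u \<noteq> v" for u v
  proof -
    have "(\<Sum>j\<in>?D. x j) = (\<Sum>j\<in>?D - {u, v}. x j) + (\<Sum>j\<in>{u, v}. x j)"
      using uv fE by (intro sum.subset_diff) auto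
    moreover have "(\<Sum>j\<in>?D - {u, v}. x j) \<le> card (?D - {u, v})" by (rule Dsum) auto
    moreover have "card (?D - {u, v}) = k - 2" using uv fE D_eq by (simp add: card_Diff_subset)
    moreover have "k \<ge> 2" using card_mono[of ?D "{u, v}"] uv fE D_eq by auto
    ultimately show ?thesis using Dge uv by (simp add: of_nat_diff)
  qed
  have "\<forall>v\<in>?D. \<exists>i. i < k \<and> insert v ?E \<in> F i"
  proof
    fix v assume v: "v \<in> ?D"
    have "card (insert v ?E) = t" using v E_eq fE t by auto
    then show "\<exists>i. i < k \<and> insert v ?E \<in> F i" using cov[of "insert v ?E"] v by auto
  qed
  then obtain col where col: "\<And>v. v \<in> ?D \<Longrightarrow> col v < k \<and> insert v ?E \<in> F (col v)"
    using bchoice[of ?D "\<lambda>v i. i < k \<and> insert v ?E \<in> F i"] by blast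
  have wv: "(\<Sum>j\<in>?E. w (col v) j) + w (col v) v \<ge> 1" if v: "v \<in> ?D" for v
  proof -
    have "card (insert v ?E) = t" using v E_eq fE t by auto
    then have "1 \<le> (\<Sum>j\<in>insert v ?E. w (col v) j)" using col[OF v] v by (intro F) auto
    then show ?thesis using v fE by simp
  qed
  have inj: "inj_on col ?D"
  proof (rule inj_onI, rule ccontr)
    fix u v assume uv: "u \<in> ?D" "v \<in> ?D" "col u = col v" "u \<noteq> v"
    let ?i = "col u"
    have i: "?i < k" using col uv by blast
    define g where "g = 1 - (\<Sum>j\<in>?E. w ?i j)"
    have g: "g > 0" using wE[OF i, of "{}"] b by (simp add: g_def)
    have wu: "w ?i u \<ge> g" "w ?i v \<ge> g" using wv[OF uv(1)] wv[OF uv(2)] uv(3) by (auto simp: g_def)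
    have "(1 - g) + (w ?i u * x u + w ?i v * x v) \<le> b"
      using wE[OF i, of "{u, v}"] uv by (simp add: g_def)
    moreover have "g * x u \<le> w ?i u * x u" "g * x v \<le> w ?i v * x v"
      using wu uv by (auto intro!: mult_right_mono)
    moreover have "g * 1 \<le> g * (x u + x v)" using g big[OF uv(1,2,4)] by (intro mult_left_mono) auto
    ultimately show False using b by (simp add: algebra_simps)
  qed
  have "col ` ?D = {..<k}"
  proof (rule card_subset_eq)
    show "card (col ` ?D) = card {..<k}" using inj D_eq by (simp add: card_image)
  qed (use col in auto)
  then have bij: "bij_betw col ?D {..<k}" using inj by (simp add: bij_betw_def)
  define v where "v = inv_into ?D col"
  have v: "v i \<in> ?D" "col (v i) = i" if "i < k" for i
  proof -
    have i: "i \<in> col ` ?D" using bij that by (simp add: bij_betw_def)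
    show "v i \<in> ?D" unfolding v_def by (rule inv_into_into[OF i])
    show "col (v i) = i" unfolding v_def by (rule f_inv_into_f[OF i])
  qed
  have "inj_on v {..<k}" by (rule inj_onI) (metis v(2) lessThan_iff)
  moreover have "v i \<in> I - ?E \<and> insert (v i) ?E \<in> F i" if "i < k" for i
    using v[OF that] col[OF v(1)[OF that]] by auto
  ultimately show ?thesis using E_eq by (intro exI[of _ ?E] exI[of _ v]) auto
qed

section \<open>Maximum matchings and covers of samples\<close>

text \<open>The number of earlier occurrences of \<open>x\<close>: consecutive occurrences of a vertex in a packing are
assigned to consecutive copies of that vertex in a blow-up.\<close>

definition label :: "'b set list \<Rightarrow> nat \<Rightarrow> 'b \<Rightarrow> nat" where
  "label gs a x = card {b. b < a \<and> x \<in> gs ! b}"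

lemma label_less:
  assumes "a < b" "x \<in> gs ! a"
  shows "label gs a x < label gs b x"
  unfolding label_def by (rule psubset_card_mono) (use assms in auto)

lemma label_less_length:
  assumes "a < length gs" "x \<in> gs ! a"
  shows "label gs a x < card {b. b < length gs \<and> x \<in> gs ! b}"
  using label_less[OF assms] by (simp add: label_def)

lemma label_le: "label gs a x \<le> a"
  unfolding label_def using card_mono[of "{..<a}" "{b. b < a \<and> x \<in> gs ! b}"] by auto

text \<open>Vertices are grouped by the matching: a matched vertex with its edge, an unmatched one alone.\<close>

definition match_class :: "'a set set \<Rightarrow> 'a \<Rightarrow> 'a set" where
  "match_class M v = (if v \<in> \<Union>M then THE e. e \<in> M \<and> v \<in> e else {v})"

context
  fixes M :: "'a set set"
  assumes disj: "pairwise disjnt M"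
begin

lemma match_class_eq: "e \<in> M \<Longrightarrow> v \<in> e \<Longrightarrow> match_class M v = e"
proof -
  assume e: "e \<in> M" "v \<in> e"
  have "(THE e. e \<in> M \<and> v \<in> e) = e"
    using e disj by (intro the_equality) (auto simp: pairwise_def disjnt_def)
  then show ?thesis using e by (auto simp: match_class_def)
qed

lemma match_class_unmatched: "v \<notin> \<Union>M \<Longrightarrow> match_class M v = {v}"
  by (simp add: match_class_def)

lemma match_class_self: "v \<in> match_class M v"
  using match_class_eq match_class_unmatched by (metis UnionE singletonI)

lemma match_class_cong: "u \<in> match_class M v \<Longrightarrow> match_class M u = match_class M v"
  using match_class_eq match_class_unmatched by (metis UnionE singletonD)

lemma match_class_in_iff: "match_class M v \<in> M \<longleftrightarrow> v \<in> \<Union>M"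
  using match_class_eq match_class_self by (metis UnionE UnionI)

end

definition enumeration :: "'a set \<Rightarrow> nat \<Rightarrow> 'a" where
  "enumeration c = (SOME f. bij_betw f {..<card c} c)"

lemma bij_betw_enumeration:
  assumes "finite c" shows "bij_betw (enumeration c) {..<card c} c"
proof -
  have "\<exists>f. bij_betw f {..<card c} c"
    using ex_bij_betw_nat_finite[OF assms] by (simp add: atLeast0LessThan)
  then show ?thesis unfolding enumeration_def by (rule someI_ex[of "\<lambda>f. bij_betw f {..<card c} c"])
qed

text \<open>The pattern contains a packing that uses fewer copies of matching edges than it has edges.\<close>

definition packable :: "bool list \<times> (nat \<times> nat) set set \<Rightarrow> nat \<Rightarrow> bool" where
  "packable \<pi> t \<longleftrightarrow> (\<exists>gs. set gs \<subseteq> snd \<pi> \<and>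
     (\<Sum>j | j < length (fst \<pi>) \<and> fst \<pi> ! j. MAX p\<in>{..<t}. card {a. a < length gs \<and> (j, p) \<in> gs ! a}) < length gs)"

text \<open>All that is remembered of a sample for one colour: which entries are matched, and which choices of one vertex
from each of several matching edges form an edge. The number of patterns does not depend on the
size of the vertex set.\<close>

definition class_pattern :: "nat \<Rightarrow> 'a set set \<Rightarrow> 'a set set \<Rightarrow> 'a set list \<Rightarrow> bool list \<times> (nat \<times> nat) set set" where
  "class_pattern t F M C = (map (\<lambda>c. c \<in> M) C,
     {g \<in> Pow ({..<length C} \<times> {..<t}). (\<forall>x\<in>g. snd x < card (C ! fst x)) \<and> inj_on fst g \<and> card g = t \<and>
        (\<lambda>x. enumeration (C ! fst x) (snd x)) ` g \<in> F})"

text \<open>A vertex weighting that spends one unit on each sampled matching edge and nothing on unmatched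
vertices. Its average over a class is known although the weighting itself depends on the sample.\<close>

definition class_cover :: "nat \<Rightarrow> 'a set set \<Rightarrow> 'a set set \<Rightarrow> 'a set list \<Rightarrow> (nat \<Rightarrow> 'a \<Rightarrow> real) \<Rightarrow> bool" where
  "class_cover t F M C w \<longleftrightarrow> (\<forall>j v. 0 \<le> w j v) \<and>
     (\<forall>j<length C. (\<Sum>v\<in>C ! j. w j v) = (if C ! j \<in> M then 1 else 0)) \<and>
     (\<forall>zs\<in>listset C. \<forall>e. e \<subseteq> {..<length C} \<and> card e = t \<and> inj_on ((!) zs) e \<and> (!) zs ` e \<in> F \<longrightarrow> 1 \<le> (\<Sum>j\<in>e. w j (zs ! j)))"

lemma listset_nth: "zs \<in> listset C \<Longrightarrow> length zs = length C \<and> (\<forall>j<length C. zs ! j \<in> C ! j)"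
proof (induction C arbitrary: zs)
  case (Cons A C)
  then obtain x xs where "zs = x # xs" "x \<in> A" "xs \<in> listset C" by (auto simp: set_Cons_def)
  then show ?case using Cons.IH[of xs] by (auto simp: nth_Cons')
qed simp

lemma class_cover_if_not_packable:
  assumes C: "\<And>c. c \<in> set C \<Longrightarrow> finite c \<and> card c \<le> t" "\<And>c. c \<in> set C \<Longrightarrow> c \<in> M \<Longrightarrow> card c = t"
    and t: "t \<ge> 1" and np: "\<not> packable (class_pattern t F M C) t"
  shows "\<exists>w. class_cover t F M C w"
proof -
  define E where "E = snd (class_pattern t F M C)"
  define J where "J = {j. j < length C \<and> C ! j \<in> M}"
  have J: "{j. j < length (fst (class_pattern t F M C)) \<and> fst (class_pattern t F M C) ! j} = J"
    by (auto simp: class_pattern_def J_def)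
  have finE: "finite E" unfolding E_def class_pattern_def by simp
  have nogs: "\<not> (\<exists>gs. set gs \<subseteq> E \<and> real (\<Sum>j\<in>J. MAX p\<in>{..<t}. card {a. a < length gs \<and> (j, p) \<in> gs ! a}) < 1 * real (length gs))"
    using np unfolding packable_def J E_def by (simp flip: of_nat_sum)
  then obtain w where w: "\<And>j p. j \<in> J \<Longrightarrow> p < t \<Longrightarrow> 0 \<le> w j p" "\<And>j. j \<in> J \<Longrightarrow> (\<Sum>p<t. w j p) = 1"
    "\<And>g. g \<in> E \<Longrightarrow> 1 \<le> (\<Sum>j\<in>J. \<Sum>p<t. if (j, p) \<in> g then w j p else (0::real))"
  proof -
    have "finite J" "finite {..<t}" "{..<t} \<noteq> {}" using t by (auto simp: J_def lessThan_empty_iff)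
    note cp = cover_or_packing[OF this finE zero_le_one]
    have "\<exists>w. (\<forall>j\<in>J. \<forall>p\<in>{..<t}. 0 \<le> w j p) \<and> (\<forall>j\<in>J. (\<Sum>p<t. w j p) = 1)
         \<and> (\<forall>g\<in>E. 1 \<le> (\<Sum>j\<in>J. \<Sum>p<t. if (j, p) \<in> g then w j p else (0::real)))"
    proof (rule disjE[OF cp])
      assume "\<exists>gs. set gs \<subseteq> E \<and> real (\<Sum>j\<in>J. MAX p\<in>{..<t}. card {a. a < length gs \<and> (j, p) \<in> gs ! a}) < 1 * real (length gs)"
      with nogs show ?thesis by (rule notE)
    qed
    then show thesis using that unfolding Ball_def lessThan_iff by blast
  qed
  define idx where "idx j = inv_into {..<card (C ! j)} (enumeration (C ! j))" for j
  define w' where "w' j v = (if j \<in> J \<and> v \<in> C ! j then w j (idx j v) else 0)" for j v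
  have fin: "finite (C ! j)" "card (C ! j) \<le> t" if "j < length C" for j using C(1) that by auto
  have bij: "bij_betw (enumeration (C ! j)) {..<card (C ! j)} (C ! j)" if "j < length C" for j
    using bij_betw_enumeration fin(1)[OF that] .
  have idx: "idx j v < card (C ! j)" "enumeration (C ! j) (idx j v) = v" if "j < length C" "v \<in> C ! j" for j v
    using bij[OF that(1)] that(2) inv_into_into[of v "enumeration (C ! j)" "{..<card (C ! j)}"]
    by (auto simp: idx_def bij_betw_def f_inv_into_f)
  have cJ: "card (C ! j) = t" if "j \<in> J" for j using that C(2) by (auto simp: J_def)
  have nonneg: "0 \<le> w' j v" for j v
  proof (cases "j \<in> J \<and> v \<in> C ! j")
    case True
    then have "j < length C" by (simp add: J_def)
    then have "idx j v < t" using idx(1)[of j v] True cJ by auto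
    then show ?thesis using True w(1) by (simp add: w'_def)
  qed (auto simp: w'_def)
  have total: "(\<Sum>v\<in>C ! j. w' j v) = (if C ! j \<in> M then 1 else 0)" if j: "j < length C" for j
  proof (cases "C ! j \<in> M")
    case True
    then have jJ: "j \<in> J" using j by (simp add: J_def)
    have "(\<Sum>v\<in>C ! j. w' j v) = (\<Sum>p<t. w' j (enumeration (C ! j) p))"
      using sum.reindex_bij_betw[OF bij[OF j], of "w' j"] cJ[OF jJ] by simp
    also have "\<dots> = (\<Sum>p<t. w j p)"
    proof (intro sum.cong refl)
      fix p assume "p \<in> {..<t}"
      then have p: "p \<in> {..<card (C ! j)}" using cJ[OF jJ] by simp
      then have "idx j (enumeration (C ! j) p) = p" "enumeration (C ! j) p \<in> C ! j"
        using bij[OF j] by (auto simp: idx_def bij_betw_def inv_into_f_f)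
      then show "w' j (enumeration (C ! j) p) = w j p" using jJ by (simp add: w'_def)
    qed
    finally show ?thesis using w(2)[OF jJ] True by simp
  qed (simp add: w'_def J_def)
  have cover: "1 \<le> (\<Sum>j\<in>e. w' j (zs ! j))"
    if zs: "zs \<in> listset C" and e: "e \<subseteq> {..<length C}" "card e = t" "inj_on ((!) zs) e" "(!) zs ` e \<in> F" for zs e
  proof -
    define g where "g = (\<lambda>j. (j, idx j (zs ! j))) ` e"
    have zC: "zs ! j \<in> C ! j" "j < length C" if "j \<in> e" for j using listset_nth[OF zs] e(1) that by auto
    have fe: "finite e" using e(1) finite_subset by blast
    have idx_e: "idx j (zs ! j) < card (C ! j)" "idx j (zs ! j) < t" if "j \<in> e" for j
      using idx(1)[OF zC(2,1)[OF that]] fin(2)[OF zC(2)[OF that]] by auto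
    have "g \<subseteq> {..<length C} \<times> {..<t}"
      using idx_e zC by (auto simp: g_def)
    moreover have "\<forall>x\<in>g. snd x < card (C ! fst x)" using idx_e by (auto simp: g_def)
    moreover have "inj_on fst g" by (auto simp: g_def inj_on_def)
    moreover have "card g = t" unfolding g_def using e(2) by (subst card_image) (auto simp: inj_on_def)
    moreover have "(\<lambda>x. enumeration (C ! fst x) (snd x)) ` g = (!) zs ` e"
      unfolding g_def image_image by (intro image_cong) (use idx(2) zC in auto)
    ultimately have "g \<in> E" using e(4) by (simp add: E_def class_pattern_def)
    then have "1 \<le> (\<Sum>j\<in>J. \<Sum>p<t. if (j, p) \<in> g then w j p else 0)" by (rule w(3))
    also have "\<dots> = (\<Sum>j\<in>J. if j \<in> e then w' j (zs ! j) else 0)"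
    proof (intro sum.cong refl)
      fix j assume j: "j \<in> J"
      show "(\<Sum>p<t. if (j, p) \<in> g then w j p else 0) = (if j \<in> e then w' j (zs ! j) else 0)"
      proof (cases "j \<in> e")
        case True
        have "(\<Sum>p<t. if (j, p) \<in> g then w j p else 0) = (\<Sum>p<t. if p = idx j (zs ! j) then w j p else 0)"
          using True by (intro sum.cong refl) (auto simp: g_def)
        also have "\<dots> = w j (idx j (zs ! j))" using idx_e(2)[OF True] by simp
        finally show ?thesis using True zC j by (simp add: w'_def)
      next
        case False
        then have "(j, p) \<notin> g" for p by (auto simp: g_def)
        then show ?thesis using False by simp
      qed
    qed
    also have "\<dots> = (\<Sum>j\<in>J \<inter> e. w' j (zs ! j))" by (intro sum.inter_restrict[symmetric]) (simp add: J_def)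
    also have "\<dots> \<le> (\<Sum>j\<in>e. w' j (zs ! j))" using nonneg fe by (intro sum_mono2) auto
    finally show ?thesis .
  qed
  show ?thesis unfolding class_cover_def using nonneg total cover by (intro exI[of _ w']) blast
qed

text \<open>The packing is realised in the blow-up, with the occurrences of each pair distributed over
different copies; the matching edges it touches are then exchanged for the edges of the packing.\<close>

lemma larger_matching_of_blowup:
  assumes disj: "pairwise disjnt M" and M: "M \<subseteq> F" "finite M"
    and F: "\<And>e. e \<in> F \<Longrightarrow> finite e \<and> card e = t" and t: "t \<ge> 1"
    and gs: "set gs \<subseteq> snd \<pi>" "(\<Sum>j | j < r \<and> fst \<pi> ! j. MAX p\<in>{..<t}. card {a. a < length gs \<and> (j, p) \<in> gs ! a}) < length gs"
    and u: "\<And>j l j' l'. \<lbrakk>j < r; l < length gs; j' < r; l' < length gs; (j, l) \<noteq> (j', l')\<rbrakk> \<Longrightarrow> match_class M (u j l) \<noteq> match_class M (u j' l')"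
    and pat: "\<And>f. (\<And>j. j < r \<Longrightarrow> f j < length gs) \<Longrightarrow> class_pattern t F M (map (\<lambda>j. match_class M (u j (f j))) [0..<r]) = \<pi>"
  shows "\<exists>M'. M' \<subseteq> F \<and> pairwise disjnt M' \<and> finite M' \<and> card M' > card M"
proof -
  let ?m = "length gs"
  let ?X = "\<lambda>j. MAX p\<in>{..<t}. card {a. a < ?m \<and> (j, p) \<in> gs ! a}"
  let ?c = "\<lambda>j l. match_class M (u j l)"
  define new where "new a = (\<lambda>x. enumeration (?c (fst x) (label gs a x)) (snd x)) ` (gs ! a)" for a
  have g: "gs ! a \<subseteq> {..<r} \<times> {..<t}" "inj_on fst (gs ! a)" "new a \<in> F"
    "\<And>x. x \<in> gs ! a \<Longrightarrow> snd x < card (?c (fst x) (label gs a x))" if a: "a < ?m" for a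
  proof -
    define f where "f j = (if \<exists>p. (j, p) \<in> gs ! a then label gs a (j, SOME p. (j, p) \<in> gs ! a) else 0)" for j
    have f: "f j < ?m" for j
      using label_le[of gs a] a unfolding f_def by (auto intro: le_less_trans)
    have mem: "gs ! a \<in> snd (class_pattern t F M (map (\<lambda>j. ?c j (f j)) [0..<r]))"
      using pat[of f] f gs(1) a nth_mem by blast
    then show sub: "gs ! a \<subseteq> {..<r} \<times> {..<t}" and inj: "inj_on fst (gs ! a)"
      by (auto simp: class_pattern_def)
    have fx: "f (fst x) = label gs a x" if "x \<in> gs ! a" for x
    proof -
      obtain j p where x: "x = (j, p)" by force
      have "(SOME p. (j, p) \<in> gs ! a) = p"
      proof (rule some_equality)
        fix p' assume "(j, p') \<in> gs ! a"
        then show "p' = p" using inj_onD[OF inj, of "(j, p')" "(j, p)"] that x by simp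
      qed (use that x in simp)
      then show ?thesis using that x by (auto simp: f_def)
    qed
    have C: "map (\<lambda>j. ?c j (f j)) [0..<r] ! fst x = ?c (fst x) (label gs a x)" if "x \<in> gs ! a" for x
      using fx[OF that] sub that by auto
    have "(\<lambda>x. enumeration (map (\<lambda>j. ?c j (f j)) [0..<r] ! fst x) (snd x)) ` (gs ! a) = new a"
      unfolding new_def by (intro image_cong refl) (simp only: C)
    then show "new a \<in> F" using mem by (simp add: class_pattern_def)
    show "snd x < card (?c (fst x) (label gs a x))" if "x \<in> gs ! a" for x
      using mem that C[OF that] by (auto simp: class_pattern_def)
  qed
  have cls: "finite (?c j l)" for j l
    using match_class_eq[OF disj] match_class_unmatched[OF disj, of "u j l"] F M(1)
    by (metis UnionE finite.emptyI finite.insertI subsetD)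
  have en: "bij_betw (enumeration (?c j l)) {..<card (?c j l)} (?c j l)" for j l
    by (rule bij_betw_enumeration[OF cls])
  have mult: "card {b. b < ?m \<and> (j, p) \<in> gs ! b} \<le> ?X j" if "p < t" for j p
    using that by (intro Max_ge) auto
  have lX: "label gs a x < ?X (fst x)" "label gs a x < ?m" if "a < ?m" "x \<in> gs ! a" for a x
  proof -
    have "snd x < t" using g(1)[OF that(1)] that(2) by auto
    then show "label gs a x < ?X (fst x)"
      using label_less_length[OF that] mult[of "snd x" "fst x"] by simp
    show "label gs a x < ?m" using label_le[of gs a x] that(1) by simp
  qed
  have vert: "\<exists>x\<in>gs ! a. v = enumeration (?c (fst x) (label gs a x)) (snd x) \<and> match_class M v = ?c (fst x) (label gs a x)"
    if a: "a < ?m" and v: "v \<in> new a" for a v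
  proof -
    obtain x where x: "x \<in> gs ! a" "v = enumeration (?c (fst x) (label gs a x)) (snd x)" using v by (auto simp: new_def)
    then have "v \<in> ?c (fst x) (label gs a x)" using g(4)[OF a x(1)] en by (auto simp: bij_betw_def)
    then show ?thesis using x match_class_cong[OF disj] by blast
  qed
  have new_disj: "disjnt (new a) (new b)" if ab: "a < b" "b < ?m" for a b
  proof (rule ccontr)
    assume "\<not> ?thesis"
    then obtain v where v: "v \<in> new a" "v \<in> new b" by (auto simp: disjnt_def)
    have a: "a < ?m" using ab by simp
    obtain x where x: "x \<in> gs ! a" "v = enumeration (?c (fst x) (label gs a x)) (snd x)" "match_class M v = ?c (fst x) (label gs a x)"
      using vert[OF a v(1)] by blast
    obtain y where y: "y \<in> gs ! b" "v = enumeration (?c (fst y) (label gs b y)) (snd y)" "match_class M v = ?c (fst y) (label gs b y)"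
      using vert[OF ab(2) v(2)] by blast
    have r: "fst x < r" "fst y < r" using g(1)[OF a] g(1)[OF ab(2)] x(1) y(1) by auto
    have eq: "fst x = fst y \<and> label gs a x = label gs b y"
      using u[OF r(1) lX(2)[OF a x(1)] r(2) lX(2)[OF ab(2) y(1)]] x(3) y(3) by auto
    have "snd x = snd y"
    proof (rule inj_onD)
      show "inj_on (enumeration (?c (fst x) (label gs a x))) {..<card (?c (fst x) (label gs a x))}"
        using en by (auto simp: bij_betw_def)
    qed (use x y eq g(4)[OF a x(1)] g(4)[OF ab(2) y(1)] in auto)
    then have "x = y" using eq by (simp add: prod_eq_iff)
    then show False using label_less[OF ab(1) x(1)] eq by simp
  qed
  have new_disj': "disjnt (new a) (new b)" if "a < ?m" "b < ?m" "a \<noteq> b" for a b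
    using new_disj[of a b] new_disj[of b a] that disjnt_sym by (metis linorder_neqE_nat)
  have ne: "new a \<noteq> {}" if "a < ?m" for a using F[OF g(3)[OF that]] t by auto
  have inj_new: "inj_on new {..<?m}"
  proof (rule inj_onI, rule ccontr)
    fix a b assume ab: "a \<in> {..<?m}" "b \<in> {..<?m}" "new a = new b" "a \<noteq> b"
    then show False using new_disj'[of a b] ne[of a] by (auto simp: disjnt_def)
  qed
  define J where "J = {j. j < r \<and> fst \<pi> ! j}"
  define old where "old = (\<Union>j\<in>J. ?c j ` {..<?X j})"
  have card_old: "card old < ?m"
  proof -
    have "card old \<le> (\<Sum>j\<in>J. card (?c j ` {..<?X j}))" unfolding old_def by (rule card_UN_le) (simp add: J_def)
    also have "\<dots> \<le> (\<Sum>j\<in>J. ?X j)" 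
    proof (rule sum_mono)
      fix j show "card (?c j ` {..<?X j}) \<le> ?X j"
        using card_image_le[OF finite_lessThan, of "?c j" "?X j"] by (simp only: card_lessThan)
    qed
    finally show ?thesis using gs(2) by (simp add: J_def)
  qed
  have old_new: "disjnt e (new a)" if e: "e \<in> M - old" and a: "a < ?m" for e a
  proof (rule ccontr)
    assume "\<not> ?thesis"
    then obtain v where v: "v \<in> e" "v \<in> new a" by (auto simp: disjnt_def)
    obtain x where x: "x \<in> gs ! a" "match_class M v = ?c (fst x) (label gs a x)" using vert[OF a v(2)] by blast
    have ec: "e = ?c (fst x) (label gs a x)" using match_class_eq[OF disj, of e v] e v x by simp
    have r: "fst x < r" using g(1)[OF a] x(1) by auto
    define f where "f j = (if j = fst x then label gs a x else 0)" for j
    have "f j < ?m" for j using lX(2)[OF a x(1)] by (auto simp: f_def intro: le_less_trans)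
    then have "fst \<pi> = map (\<lambda>c. c \<in> M) (map (\<lambda>j. ?c j (f j)) [0..<r])"
      using pat[of f] by (auto simp: class_pattern_def)
    then have "fst \<pi> ! fst x" using r e ec by (simp add: f_def)
    then have "e \<in> old" using ec r lX(1)[OF a x(1)] by (auto simp: old_def J_def)
    then show False using e by simp
  qed
  define M' where "M' = (M - old) \<union> new ` {..<?m}"
  have "M' \<subseteq> F" using M g(3) by (auto simp: M'_def)
  moreover have "pairwise disjnt M'"
  proof (rule pairwiseI)
    fix x y assume xy: "x \<in> M'" "y \<in> M'" "x \<noteq> y"
    consider "x \<in> M - old" "y \<in> M - old" | a where "x \<in> M - old" "a < ?m" "y = new a"
      | a where "y \<in> M - old" "a < ?m" "x = new a" | a b where "a < ?m" "b < ?m" "x = new a" "y = new b"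
      using xy by (auto simp: M'_def)
    then show "disjnt x y"
    proof cases
      case 1 then show ?thesis using disj xy(3) by (auto simp: pairwise_def)
    next
      case 2 then show ?thesis using old_new by blast
    next
      case 3 then show ?thesis using old_new disjnt_sym by blast
    next
      case 4 then show ?thesis using new_disj' xy(3) by blast
    qed
  qed
  moreover have "finite M'" using M by (simp add: M'_def)
  moreover have "card M' > card M"
  proof -
    have "(M - old) \<inter> new ` {..<?m} = {}"
      using old_new ne by (fastforce simp: disjnt_def)
    then have "card M' = card (M - old) + ?m"
      using M(2) inj_new by (simp add: M'_def card_Un_disjoint card_image)
    moreover have "finite old" by (auto simp: old_def J_def)
    then have "card (M - old) \<ge> card M - card old" by (rule diff_card_le_card_Diff)
    ultimately show ?thesis using card_old by linarith
  qed
  ultimately show ?thesis by blast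
qed

text \<open>A frequent pattern without a cover would have a packing, by duality, and a blow-up of the
pattern in which the packing enlarges the maximum matching.\<close>

lemma few_tuples_without_class_cover:
  fixes \<delta> :: real
  assumes t: "t \<ge> 1" and \<delta>: "\<delta> > 0"
  shows "\<exists>n0. \<forall>(V :: 'a set) F M. finite V \<longrightarrow> n0 \<le> card V \<longrightarrow> F \<subseteq> {e. e \<subseteq> V \<and> card e = t} \<longrightarrow> M \<subseteq> F \<longrightarrow>
     pairwise disjnt M \<longrightarrow> (\<forall>M'. M' \<subseteq> F \<longrightarrow> pairwise disjnt M' \<longrightarrow> card M' \<le> card M) \<longrightarrow>
     real (card {xs \<in> tuples V r. \<nexists>w. class_cover t F M (map (match_class M) xs) w}) \<le> \<delta> * real (card V) ^ r"
proof -
  define Fin where "Fin = {bs :: bool list. length bs = r} \<times> Pow (Pow ({..<r} \<times> {..<t}))"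
  have finF: "finite Fin" using finite_lists_length_eq[of "UNIV :: bool set" r] by (simp add: Fin_def)
  define P where "P = {\<pi> \<in> Fin. packable \<pi> t}"
  have finP: "finite P" using finF by (simp add: P_def)
  define N where "N = real (card P) + 1"
  have N: "N > 0" "real (card P) \<le> N" by (auto simp: N_def)
  have "\<forall>\<pi>\<in>P. \<exists>gs. set gs \<subseteq> snd \<pi> \<and>
     (\<Sum>j | j < r \<and> fst \<pi> ! j. MAX p\<in>{..<t}. card {a. a < length gs \<and> (j, p) \<in> gs ! a}) < length gs"
    unfolding P_def packable_def Fin_def by auto
  from bchoice[OF this] obtain G where G0: "\<forall>\<pi>\<in>P. set (G \<pi>) \<subseteq> snd \<pi> \<and>
     (\<Sum>j | j < r \<and> fst \<pi> ! j. MAX p\<in>{..<t}. card {a. a < length (G \<pi>) \<and> (j, p) \<in> G \<pi> ! a}) < length (G \<pi>)" ..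
  have G: "\<And>\<pi>. \<pi> \<in> P \<Longrightarrow> set (G \<pi>) \<subseteq> snd \<pi>"
     "\<And>\<pi>. \<pi> \<in> P \<Longrightarrow> (\<Sum>j | j < r \<and> fst \<pi> ! j. MAX p\<in>{..<t}. card {a. a < length (G \<pi>) \<and> (j, p) \<in> G \<pi> ! a}) < length (G \<pi>)"
    using G0 by blast+
  have "\<forall>\<pi>\<in>P. \<exists>n0. \<forall>n\<ge>n0. (\<delta> / N) ^ (length (G \<pi>) ^ r) * real n > real ((r * length (G \<pi>)) ^ 2 * t)"
  proof
    fix \<pi>
    have pos: "(\<delta> / N) ^ (length (G \<pi>) ^ r) > 0" using \<delta> N by simp
    obtain n0 :: nat where "real n0 * (\<delta> / N) ^ (length (G \<pi>) ^ r) > real ((r * length (G \<pi>)) ^ 2 * t)"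
      using reals_Archimedean3[OF pos] by blast
    then have "(\<delta> / N) ^ (length (G \<pi>) ^ r) * real n > real ((r * length (G \<pi>)) ^ 2 * t)" if "n \<ge> n0" for n
      using that pos by (smt (verit) mult.commute mult_right_mono of_nat_le_iff)
    then show "\<exists>n0. \<forall>n\<ge>n0. (\<delta> / N) ^ (length (G \<pi>) ^ r) * real n > real ((r * length (G \<pi>)) ^ 2 * t)" by blast
  qed
  from bchoice[OF this] obtain n1 where n1': "\<forall>\<pi>\<in>P. \<forall>n\<ge>n1 \<pi>. (\<delta> / N) ^ (length (G \<pi>) ^ r) * real n > real ((r * length (G \<pi>)) ^ 2 * t)" ..
  have n1: "\<And>\<pi> n. \<pi> \<in> P \<Longrightarrow> n \<ge> n1 \<pi> \<Longrightarrow> (\<delta> / N) ^ (length (G \<pi>) ^ r) * real n > real ((r * length (G \<pi>)) ^ 2 * t)"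
    using n1' by blast
  show ?thesis
  proof (intro exI[of _ "\<Sum>\<pi>\<in>P. n1 \<pi>"] allI impI)
    fix V :: "'a set" and F M
    assume V: "finite V" "(\<Sum>\<pi>\<in>P. n1 \<pi>) \<le> card V" and F: "F \<subseteq> {e. e \<subseteq> V \<and> card e = t}" and M: "M \<subseteq> F"
      and disj: "pairwise disjnt M" and max: "\<forall>M'. M' \<subseteq> F \<longrightarrow> pairwise disjnt M' \<longrightarrow> card M' \<le> card M"
    let ?n = "card V"
    let ?pat = "\<lambda>xs. class_pattern t F M (map (match_class M) xs)"
    have Ft: "finite e \<and> card e = t" if "e \<in> F" for e using F that V(1) finite_subset by blast
    have finM: "finite M"
      by (rule finite_subset[of _ "Pow V"]) (use M F V in auto)
    have cls: "finite (match_class M v)" "card (match_class M v) \<le> t" "match_class M v \<in> M \<Longrightarrow> card (match_class M v) = t" for v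
    proof -
      have "match_class M v \<in> M \<or> match_class M v = {v}"
        using match_class_in_iff[OF disj, of v] match_class_unmatched[OF disj, of v] by blast
      then show "finite (match_class M v)" "card (match_class M v) \<le> t" using Ft M t by auto
      show "match_class M v \<in> M \<Longrightarrow> card (match_class M v) = t" using Ft M by auto
    qed
    have each: "real (card {xs \<in> tuples V r. ?pat xs = \<pi>}) \<le> \<delta> / N * real ?n ^ r" if \<pi>: "\<pi> \<in> P" for \<pi>
    proof (rule ccontr)
      assume "\<not> ?thesis"
      then have dens: "\<delta> / N * real ?n ^ r \<le> real (card {xs \<in> tuples V r. ?pat xs = \<pi>})" by simp
      let ?R = "\<lambda>v u. match_class M v = match_class M u"
      have deg: "card {u \<in> V. ?R v u} \<le> t" for v
      proof -
        have "{u \<in> V. ?R v u} \<subseteq> match_class M v" using match_class_self[OF disj] by auto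
        then show ?thesis using cls(1,2)[of v] card_mono order_trans by blast
      qed
      have "?n \<ge> n1 \<pi>" using V(2) finP \<pi> member_le_sum[of \<pi> P n1] by auto
      then have large: "(\<delta> / N) ^ (length (G \<pi>) ^ r) * real ?n > real ((r * length (G \<pi>)) ^ 2 * t + r * length (G \<pi>) * card ({} :: 'a set))"
        using n1[OF \<pi>] by simp
      obtain u where u: "\<And>j l j' l'. \<lbrakk>j < r; l < length (G \<pi>); j' < r; l' < length (G \<pi>); (j, l) \<noteq> (j', l')\<rbrakk> \<Longrightarrow> \<not> ?R (u j l) (u j' l')"
        "\<And>f. (\<And>j. j < r \<Longrightarrow> f j < length (G \<pi>)) \<Longrightarrow> map (\<lambda>j. u j (f j)) [0..<r] \<in> {xs \<in> tuples V r. ?pat xs = \<pi>}"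
      proof (rule blowup_exists[where R = ?R and X = "{}", OF V(1) _ _ dens deg _ large])
        show "0 \<le> \<delta> / N" using \<delta> N by simp
        show "{xs \<in> tuples V r. ?pat xs = \<pi>} \<subseteq> tuples V r" by blast
      qed (blast+)
      have "\<exists>M'. M' \<subseteq> F \<and> pairwise disjnt M' \<and> finite M' \<and> card M' > card M"
      proof (rule larger_matching_of_blowup[OF disj M finM Ft t G(1)[OF \<pi>] G(2)[OF \<pi>] u(1)])
        fix f assume "\<And>j. j < r \<Longrightarrow> f j < length (G \<pi>)"
        from u(2)[OF this] show "class_pattern t F M (map (\<lambda>j. match_class M (u j (f j))) [0..<r]) = \<pi>"
          by (simp add: comp_def)
      qed
      then show False using max by (meson not_le)
    qed
    let ?B = "{xs \<in> tuples V r. \<nexists>w. class_cover t F M (map (match_class M) xs) w}"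
    have fin: "finite (tuples V r)" by (rule finite_tuples[OF V(1)])
    have "?B \<subseteq> (\<Union>\<pi>\<in>P. {xs \<in> tuples V r. ?pat xs = \<pi>})"
    proof
      fix xs assume xs: "xs \<in> ?B"
      have "packable (?pat xs) t"
      proof (rule ccontr)
        assume "\<not> ?thesis"
        then have "\<exists>w. class_cover t F M (map (match_class M) xs) w"
          by (rule class_cover_if_not_packable[OF _ _ t, rotated -1]) (use cls in auto)
        then show False using xs by simp
      qed
      moreover have "?pat xs \<in> Fin" using xs by (auto simp: Fin_def class_pattern_def tuples_def)
      ultimately show "xs \<in> (\<Union>\<pi>\<in>P. {xs \<in> tuples V r. ?pat xs = \<pi>})" using xs by (auto simp: P_def)
    qed
    then have "card ?B \<le> card (\<Union>\<pi>\<in>P. {xs \<in> tuples V r. ?pat xs = \<pi>})"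
      using fin finP by (intro card_mono) auto
    also have "\<dots> \<le> (\<Sum>\<pi>\<in>P. card {xs \<in> tuples V r. ?pat xs = \<pi>})" by (rule card_UN_le[OF finP])
    finally have "real (card ?B) \<le> (\<Sum>\<pi>\<in>P. real (card {xs \<in> tuples V r. ?pat xs = \<pi>}))"
      by (simp only: of_nat_le_iff flip: of_nat_sum)
    also have "\<dots> \<le> (\<Sum>\<pi>\<in>P. \<delta> / N * real ?n ^ r)" by (intro sum_mono each)
    also have "\<dots> = (card P / N) * (\<delta> * real ?n ^ r)" by simp
    also have "\<dots> \<le> 1 * (\<delta> * real ?n ^ r)" using N \<delta> by (intro mult_right_mono) auto
    finally show "real (card ?B) \<le> \<delta> * real ?n ^ r" by simp
  qed
qed

section \<open>Concentration of the weight of a cover\<close>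

lemma listset_Cons_image: "listset (A # As) = (\<lambda>(x, xs). x # xs) ` (A \<times> listset As)"
  by (auto simp: set_Cons_def image_iff)

lemma sum_listset_Cons:
  "(\<Sum>xs\<in>listset (A # As). f xs) = (\<Sum>x\<in>A. \<Sum>xs\<in>listset As. f (x # xs))"
proof -
  have "inj_on (\<lambda>(x, xs). x # xs) (A \<times> listset As)" by (auto simp: inj_on_def)
  then show ?thesis
    by (simp only: listset_Cons_image sum.reindex sum.cartesian_product) (simp add: case_prod_beta)
qed

text \<open>The cross terms vanish because the coordinates are independent and centred.\<close>

lemma second_moment_listset:
  fixes f :: "nat \<Rightarrow> 'a \<Rightarrow> real"
  assumes "\<And>A. A \<in> set As \<Longrightarrow> finite A"
    and "\<And>j. j < length As \<Longrightarrow> (\<Sum>a\<in>As ! j. f j a) = 0"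
    and "\<And>j a. j < length As \<Longrightarrow> a \<in> As ! j \<Longrightarrow> \<bar>f j a\<bar> \<le> 1"
  shows "(\<Sum>xs\<in>listset As. \<Sum>j<length As. f j (xs ! j)) = 0
    \<and> (\<Sum>xs\<in>listset As. (\<Sum>j<length As. f j (xs ! j))\<^sup>2) \<le> length As * card (listset As)"
  using assms
proof (induction As arbitrary: f)
  case Nil then show ?case by simp
next
  case (Cons A As)
  define S where "S xs = (\<Sum>j<length As. f (Suc j) (xs ! j))" for xs
  have IH: "(\<Sum>xs\<in>listset As. S xs) = 0" "(\<Sum>xs\<in>listset As. (S xs)\<^sup>2) \<le> length As * card (listset As)"
    using Cons.IH[of "\<lambda>j. f (Suc j)"] Cons.prems(1) Cons.prems(2)[of "Suc _"] Cons.prems(3)[of "Suc _"]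
    unfolding S_def by force+
  have A: "finite A" "(\<Sum>a\<in>A. f 0 a) = 0" "\<And>a. a \<in> A \<Longrightarrow> \<bar>f 0 a\<bar> \<le> 1"
    using Cons.prems(1) Cons.prems(2)[of 0] Cons.prems(3)[of 0] by auto
  have step: "(\<Sum>j<length (A # As). f j ((x # xs) ! j)) = f 0 x + S xs" for x xs
    by (simp add: S_def sum.lessThan_Suc_shift del: sum.lessThan_Suc)
  have c: "card (listset (A # As)) = card A * card (listset As)"
    by (simp only: listset_Cons_image) (subst card_image, auto simp: inj_on_def card_cartesian_product)
  have "(\<Sum>x\<in>A. \<Sum>xs\<in>listset As. f 0 x + S xs) = 0"
    using IH(1) A(2) by (simp add: sum.distrib flip: sum_distrib_left)
  moreover have "(\<Sum>x\<in>A. \<Sum>xs\<in>listset As. (f 0 x + S xs)\<^sup>2) \<le> length (A # As) * card (listset (A # As))"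
  proof -
    have "(\<Sum>xs\<in>listset As. (f 0 x + S xs)\<^sup>2) = card (listset As) * (f 0 x)\<^sup>2 + (\<Sum>xs\<in>listset As. (S xs)\<^sup>2)" for x
      using IH(1) by (simp add: power2_sum sum.distrib flip: sum_distrib_left)
    then have "(\<Sum>x\<in>A. \<Sum>xs\<in>listset As. (f 0 x + S xs)\<^sup>2)
        = (\<Sum>x\<in>A. card (listset As) * (f 0 x)\<^sup>2 + (\<Sum>xs\<in>listset As. (S xs)\<^sup>2))" by simp
    also have "\<dots> \<le> (\<Sum>x\<in>A. real (card (listset As)) * 1 + real (length As * card (listset As)))"
    proof (intro sum_mono add_mono mult_left_mono)
      fix x assume "x \<in> A"
      then show "(f 0 x)\<^sup>2 \<le> 1" using A(3) by (simp add: abs_square_le_1)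
    qed (use IH(2) in auto)
    also have "\<dots> = length (A # As) * card (listset (A # As))" unfolding c by (simp add: algebra_simps)
    finally show ?thesis .
  qed
  ultimately show ?case unfolding sum_listset_Cons step by blast
qed

lemma chebyshev_listset:
  fixes f :: "nat \<Rightarrow> 'a \<Rightarrow> real" and s :: real
  assumes "\<And>A. A \<in> set As \<Longrightarrow> finite A"
    and "\<And>j. j < length As \<Longrightarrow> (\<Sum>a\<in>As ! j. f j a) = 0"
    and "\<And>j a. j < length As \<Longrightarrow> a \<in> As ! j \<Longrightarrow> \<bar>f j a\<bar> \<le> 1" and s: "s > 0"
  shows "card {xs \<in> listset As. (\<Sum>j<length As. f j (xs ! j)) > s} * s\<^sup>2 \<le> length As * card (listset As)"
proof -
  have fin: "finite (listset As)" using assms(1) by (induction As) (auto simp: listset_Cons_image simp del: listset.simps(2))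
  let ?S = "\<lambda>xs. \<Sum>j<length As. f j (xs ! j)"
  have "card {xs \<in> listset As. ?S xs > s} * s\<^sup>2 = (\<Sum>xs\<in>{xs \<in> listset As. ?S xs > s}. s\<^sup>2)" by simp
  also have "\<dots> \<le> (\<Sum>xs\<in>{xs \<in> listset As. ?S xs > s}. (?S xs)\<^sup>2)"
    using s by (intro sum_mono power_mono) auto
  also have "\<dots> \<le> (\<Sum>xs\<in>listset As. (?S xs)\<^sup>2)" by (intro sum_mono2 fin) auto
  also have "\<dots> \<le> length As * card (listset As)" using second_moment_listset[OF assms(1-3)] by blast
  finally show ?thesis .
qed


lemma listset_iff: "zs \<in> listset C \<longleftrightarrow> length zs = length C \<and> (\<forall>j<length C. zs ! j \<in> C ! j)"
proof
  assume "length zs = length C \<and> (\<forall>j<length C. zs ! j \<in> C ! j)"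
  then have "map ((!) zs) [0..<length zs] \<in> listset C" by (intro map_in_listset) auto
  then show "zs \<in> listset C" by (simp add: map_nth)
qed (rule listset_nth)

lemma tuples_eq_listset: "tuples V r = listset (replicate r V)"
  by (auto simp: tuples_def listset_iff subset_code(1) all_set_conv_all_nth)

text \<open>The weights are attached to the positions of the sample rather than to the vertices.\<close>

definition light_cover :: "nat \<Rightarrow> 'a set set \<Rightarrow> 'a list \<Rightarrow> (nat \<Rightarrow> real) \<Rightarrow> real \<Rightarrow> bool" where
  "light_cover t F xs w s \<longleftrightarrow> (\<forall>j. 0 \<le> w j) \<and> (\<Sum>j<length xs. w j) \<le> s \<and>
     (\<forall>e. e \<subseteq> {..<length xs} \<and> card e = t \<and> inj_on ((!) xs) e \<and> (!) xs ` e \<in> F \<longrightarrow> 1 \<le> (\<Sum>j\<in>e. w j))"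

text \<open>Conditioned on the classes of its entries, a sample chooses a uniform vertex of each class, so
the weight of a class cover concentrates around the number of matched entries divided by \<open>t\<close>; this number in
turn concentrates around \<open>r * t * card M / card V\<close>. Both deviations are bounded by Chebyshev's inequality.\<close>

lemma few_tuples_without_light_cover:
  fixes \<epsilon> \<delta> :: real
  assumes t: "t \<ge> 1" and r: "r \<ge> 1" and \<epsilon>: "\<epsilon> > 0" and \<delta>: "\<delta> > 0"
  shows "\<exists>n0. \<forall>(V :: 'a set) F M. finite V \<longrightarrow> n0 \<le> card V \<longrightarrow> F \<subseteq> {e. e \<subseteq> V \<and> card e = t} \<longrightarrow> M \<subseteq> F \<longrightarrow>
     pairwise disjnt M \<longrightarrow> (\<forall>M'. M' \<subseteq> F \<longrightarrow> pairwise disjnt M' \<longrightarrow> card M' \<le> card M) \<longrightarrow>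
     real (card {xs \<in> tuples V r. \<nexists>w. light_cover t F xs w (r * (card M / card V + \<epsilon>))}) \<le> (\<delta> + 8 / (\<epsilon>\<^sup>2 * r)) * real (card V) ^ r"
proof -
  obtain n0 where n0: "\<And>(V :: 'a set) F M. finite V \<Longrightarrow> n0 \<le> card V \<Longrightarrow> F \<subseteq> {e. e \<subseteq> V \<and> card e = t} \<Longrightarrow> M \<subseteq> F \<Longrightarrow>
     pairwise disjnt M \<Longrightarrow> (\<forall>M'. M' \<subseteq> F \<longrightarrow> pairwise disjnt M' \<longrightarrow> card M' \<le> card M) \<Longrightarrow>
     real (card {xs \<in> tuples V r. \<nexists>w. class_cover t F M (map (match_class M) xs) w}) \<le> \<delta> * real (card V) ^ r"
    using few_tuples_without_class_cover[OF t \<delta>, of r, where 'a = 'a] by blast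
  show ?thesis
  proof (intro exI[of _ "Suc n0"] allI impI)
    fix V :: "'a set" and F M
    assume V: "finite V" "Suc n0 \<le> card V" and F: "F \<subseteq> {e. e \<subseteq> V \<and> card e = t}" and M: "M \<subseteq> F"
      and disj: "pairwise disjnt M" and max: "\<forall>M'. M' \<subseteq> F \<longrightarrow> pairwise disjnt M' \<longrightarrow> card M' \<le> card M"
    let ?n = "card V"
    let ?cls = "match_class M"
    let ?T = "tuples V r"
    have n: "?n > 0" using V by simp
    have fT: "finite ?T" by (rule finite_tuples[OF V(1)])
    have MV: "e \<subseteq> V" "card e = t" "finite e" if "e \<in> M" for e
    proof -
      have e: "e \<in> {e. e \<subseteq> V \<and> card e = t}" using M F that by blast
      then show "e \<subseteq> V" "card e = t" by auto
      then show "finite e" using V(1) finite_subset by blast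
    qed
    have finM: "finite M" by (rule finite_subset[of _ "Pow V"]) (use MV(1) V(1) in auto)
    have cls: "?cls v \<in> M \<or> ?cls v = {v}" for v
      using match_class_in_iff[OF disj, of v] match_class_unmatched[OF disj, of v] by blast
    have cls_fin: "finite (?cls v)" for v using cls[of v] MV(3) by auto
    have cls_pos: "card (?cls v) > 0" for v
      using cls_fin match_class_self[OF disj, of v] card_gt_0_iff by blast
    have cls_V: "?cls v \<subseteq> V" if "v \<in> V" for v using cls[of v] MV(1) that by auto
    have fibre: "{ys \<in> ?T. map ?cls ys = map ?cls xs} = listset (map ?cls xs)" if xs: "xs \<in> ?T" for xs
    proof (intro set_eqI iffI)
      fix ys assume "ys \<in> {ys \<in> ?T. map ?cls ys = map ?cls xs}"
      then have ys: "map ?cls ys = map ?cls xs" by simp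
      show "ys \<in> listset (map ?cls xs)"
        unfolding ys[symmetric] by (simp add: listset_iff match_class_self[OF disj])
    next
      fix ys assume "ys \<in> listset (map ?cls xs)"
      then have ys: "length ys = length xs" "\<And>j. j < length xs \<Longrightarrow> ys ! j \<in> ?cls (xs ! j)"
        by (auto simp: listset_iff)
      have "length xs = r" using xs by (simp add: tuples_def)
      have "ys ! j \<in> V" if "j < length ys" for j
        using ys(2)[of j] cls_V[of "xs ! j"] tuples_nth[OF xs, of j] that ys(1) \<open>length xs = r\<close> by auto
      then have "ys \<in> ?T" using ys(1) \<open>length xs = r\<close> by (auto simp: tuples_def in_set_conv_nth)
      moreover have "map ?cls ys = map ?cls xs"
        by (rule nth_equalityI) (use ys match_class_cong[OF disj] in auto)
      ultimately show "ys \<in> {ys \<in> ?T. map ?cls ys = map ?cls xs}" by simp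
    qed
    define has where "has C \<longleftrightarrow> (\<exists>w. class_cover t F M C w)" for C
    define W where "W C = (SOME w. class_cover t F M C w)" for C
    have W: "class_cover t F M C (W C)" if "has C" for C
      unfolding W_def using that by (intro someI_ex[of "\<lambda>w. class_cover t F M C w"]) (simp add: has_def)
    define u where "u c = (if c \<in> M then 1 else 0 :: real)" for c
    let ?s = "r * \<epsilon> / 2"
    have s: "?s > 0" using r \<epsilon> by simp
    define S0 where "S0 = {xs \<in> ?T. \<not> has (map ?cls xs)}"
    define S1 where "S1 = {xs \<in> ?T. has (map ?cls xs) \<and>
       (\<Sum>j<r. W (map ?cls xs) j (xs ! j) - u (?cls (xs ! j)) / card (?cls (xs ! j))) > ?s}"
    define S2 where "S2 = {xs \<in> ?T. (\<Sum>j<r. u (?cls (xs ! j)) / t - card M / ?n) > ?s}"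
    have c0: "real (card S0) \<le> \<delta> * real ?n ^ r"
      unfolding S0_def has_def by (rule n0[OF V(1) _ F M disj max]) (use V in simp)
    have c2: "real (card S2) * ?s\<^sup>2 \<le> r * real ?n ^ r"
    proof -
      have "card {xs \<in> listset (replicate r V). (\<Sum>j<length (replicate r V). u (?cls (xs ! j)) / t - card M / ?n) > ?s} * ?s\<^sup>2
        \<le> length (replicate r V) * card (listset (replicate r V))"
      proof (rule chebyshev_listset[OF _ _ _ s])
        fix j assume "j < length (replicate r V)"
        then have jr: "replicate r V ! j = V" by simp
        have "card (\<Union>M) = t * card M"
          using disj MV by (subst card_Union_disjoint) auto
        then have "(\<Sum>v\<in>V. u (?cls v)) = t * real (card M)"
        proof -
          have "(\<Sum>v\<in>V. u (?cls v)) = (\<Sum>v\<in>V. if v \<in> \<Union>M then 1 else 0)"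
            by (intro sum.cong refl) (simp add: u_def match_class_in_iff[OF disj])
          also have "\<dots> = card (V \<inter> \<Union>M)" using V(1) by (simp flip: sum.inter_filter) (simp add: Int_def)
          also have "V \<inter> \<Union>M = \<Union>M" using MV(1) by blast
          finally show ?thesis using \<open>card (\<Union>M) = t * card M\<close> by simp
        qed
        then show "(\<Sum>v\<in>replicate r V ! j. u (?cls v) / t - card M / ?n) = 0"
          unfolding jr using n t by (simp add: sum_subtractf flip: sum_divide_distrib)
      next
        fix j v assume "j < length (replicate r V)" "v \<in> replicate r V ! j"
        have "card (\<Union>M) \<le> ?n" using MV(1) V(1) by (intro card_mono) auto
        moreover have "card M \<le> card (\<Union>M)"
          using disj MV t by (subst card_Union_disjoint) auto
        ultimately have "card M \<le> ?n" by simp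
        then have "0 \<le> card M / ?n" "card M / ?n \<le> 1" using n by auto
        moreover have "0 \<le> u (?cls v) / t" "u (?cls v) / t \<le> 1" using t by (auto simp: u_def)
        ultimately show "\<bar>u (?cls v) / t - card M / ?n\<bar> \<le> 1" by linarith
      qed (use V in auto)
      then show ?thesis unfolding S2_def tuples_eq_listset[symmetric] by (simp add: card_tuples V)
    qed
    have c1: "real (card S1) * ?s\<^sup>2 \<le> r * real ?n ^ r"
    proof -
      let ?I = "map ?cls ` ?T"
      have part: "card A = (\<Sum>C\<in>?I. card {xs \<in> A. map ?cls xs = C})" if "A \<subseteq> ?T" for A
      proof -
        have fA: "finite A" using that fT finite_subset by blast
        have "card A = (\<Sum>C\<in>map ?cls ` A. card {xs \<in> A. map ?cls xs = C})"
          using sum.image_gen[OF fA, of "\<lambda>_. 1::nat" "map ?cls"] by simp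
        also have "\<dots> = (\<Sum>C\<in>?I. card {xs \<in> A. map ?cls xs = C})"
        proof (rule sum.mono_neutral_left)
          show "\<forall>C\<in>?I - map ?cls ` A. card {xs \<in> A. map ?cls xs = C} = 0"
          proof
            fix C assume "C \<in> ?I - map ?cls ` A"
            then have "{xs \<in> A. map ?cls xs = C} = {}" by blast
            then show "card {xs \<in> A. map ?cls xs = C} = 0" by (simp only: card.empty)
          qed
        qed (use fT that in auto)
        finally show ?thesis .
      qed
      have each: "card {xs \<in> S1. map ?cls xs = C} * ?s\<^sup>2 \<le> r * card {xs \<in> ?T. map ?cls xs = C}" if CI: "C \<in> ?I" for C
      proof -
        obtain xs0 where xs0: "xs0 \<in> ?T" "C = map ?cls xs0" using CI by blast
        have lenC: "length C = r" using xs0 by (simp add: tuples_def)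
        have fib: "{xs \<in> ?T. map ?cls xs = C} = listset C" using fibre[OF xs0(1)] xs0(2) by simp
        show ?thesis
        proof (cases "has C")
          case False
          then have e: "{xs \<in> S1. map ?cls xs = C} = {}" by (auto simp: S1_def)
          show ?thesis unfolding e by simp
        next
          case True
          note cov = W[OF True, unfolded class_cover_def]
          have Cj: "finite (C ! j)" "card (C ! j) > 0" if "j < r" for j
            using that xs0 cls_fin cls_pos by (auto simp: tuples_def)
          let ?f = "\<lambda>j v. W C j v - u (C ! j) / card (C ! j)"
          have "{xs \<in> S1. map ?cls xs = C} \<subseteq> {xs \<in> listset C. (\<Sum>j<length C. ?f j (xs ! j)) > ?s}"
          proof
            fix xs assume xs: "xs \<in> {xs \<in> S1. map ?cls xs = C}"
            then have xT: "xs \<in> ?T" and mC: "map ?cls xs = C" by (auto simp: S1_def)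
            have "xs \<in> listset C" using fib xT mC by blast
            moreover have "?cls (xs ! j) = C ! j" if "j < r" for j using that mC xT by (auto simp: tuples_def)
            then have "(\<Sum>j<r. W (map ?cls xs) j (xs ! j) - u (?cls (xs ! j)) / card (?cls (xs ! j))) = (\<Sum>j<length C. ?f j (xs ! j))"
              unfolding mC lenC by (intro sum.cong refl) simp
            ultimately show "xs \<in> {xs \<in> listset C. (\<Sum>j<length C. ?f j (xs ! j)) > ?s}"
              using xs by (auto simp: S1_def)
          qed
          moreover have "finite (listset C)" unfolding fib[symmetric] using fT by simp
          ultimately have "card {xs \<in> S1. map ?cls xs = C} \<le> card {xs \<in> listset C. (\<Sum>j<length C. ?f j (xs ! j)) > ?s}"
            by (intro card_mono) auto
          then have "card {xs \<in> S1. map ?cls xs = C} * ?s\<^sup>2 \<le> card {xs \<in> listset C. (\<Sum>j<length C. ?f j (xs ! j)) > ?s} * ?s\<^sup>2"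
            by (intro mult_right_mono) auto
          also have "\<dots> \<le> length C * card (listset C)"
          proof (rule chebyshev_listset[OF _ _ _ s])
            fix A assume "A \<in> set C" then show "finite A" using Cj(1) lenC by (auto simp: in_set_conv_nth)
          next
            fix j assume j: "j < length C"
            then have "(\<Sum>v\<in>C ! j. W C j v) = u (C ! j)" using cov by (simp add: u_def)
            then show "(\<Sum>v\<in>C ! j. ?f j v) = 0" using Cj(2)[of j] j lenC by (simp add: sum_subtractf)
          next
            fix j v assume j: "j < length C" and v: "v \<in> C ! j"
            have "W C j v \<le> (\<Sum>v\<in>C ! j. W C j v)"
              using cov v Cj(1)[of j] j lenC by (intro member_le_sum) auto
            also have "\<dots> \<le> 1" using cov j by simp
            finally have "W C j v \<le> 1" .
            moreover have "0 \<le> W C j v" using cov by simp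
            moreover have "0 \<le> u (C ! j) / card (C ! j)" "u (C ! j) / card (C ! j) \<le> 1"
              using Cj(2)[of j] j lenC by (auto simp: u_def)
            ultimately show "\<bar>?f j v\<bar> \<le> 1" by linarith
          qed
          finally show ?thesis by (simp add: fib lenC)
        qed
      qed
      have "real (card S1) * ?s\<^sup>2 = (\<Sum>C\<in>?I. card {xs \<in> S1. map ?cls xs = C} * ?s\<^sup>2)"
        using part[of S1] by (simp add: S1_def sum_distrib_right)
      also have "\<dots> \<le> (\<Sum>C\<in>?I. real (r * card {xs \<in> ?T. map ?cls xs = C}))"
        using each by (intro sum_mono) auto
      also have "\<dots> = real (r * card ?T)"
        using part[of ?T] by (simp add: sum_distrib_left)
      finally show ?thesis by (simp add: card_tuples V)
    qed
    have bound: "real x \<le> 4 / (\<epsilon>\<^sup>2 * r) * real ?n ^ r" if "real x * ?s\<^sup>2 \<le> r * real ?n ^ r" for x :: nat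
    proof -
      have "real x \<le> r * real ?n ^ r / ?s\<^sup>2" using that zero_less_power[OF s, of 2] by (subst pos_le_divide_eq) auto
      also have "\<dots> = 4 / (\<epsilon>\<^sup>2 * r) * real ?n ^ r" using r \<epsilon> by (simp add: power2_eq_square field_simps)
      finally show ?thesis .
    qed
    have "{xs \<in> ?T. \<nexists>w. light_cover t F xs w (r * (card M / ?n + \<epsilon>))} \<subseteq> S0 \<union> S1 \<union> S2"
    proof (rule subsetI, rule ccontr)
      fix xs assume xs: "xs \<in> {xs \<in> ?T. \<nexists>w. light_cover t F xs w (r * (card M / ?n + \<epsilon>))}"
        and not: "xs \<notin> S0 \<union> S1 \<union> S2"
      let ?C = "map ?cls xs"
      have len: "length xs = r" using xs by (simp add: tuples_def)
      have has: "has ?C" using not xs by (auto simp: S0_def)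
      note cov = W[OF has, unfolded class_cover_def]
      have 1: "(\<Sum>j<r. W ?C j (xs ! j) - u (?cls (xs ! j)) / card (?cls (xs ! j))) \<le> ?s"
        using not xs has by (auto simp: S1_def)
      have 2: "(\<Sum>j<r. u (?cls (xs ! j)) / t - card M / ?n) \<le> ?s"
        using not xs by (auto simp: S2_def)
      have ut: "u c / card c = u c / t" for c using MV(2) by (simp add: u_def)
      have "(\<Sum>j<r. W ?C j (xs ! j)) \<le> r * (card M / ?n + \<epsilon>)"
      proof -
        have "(\<Sum>j<r. W ?C j (xs ! j)) - (\<Sum>j<r. u (?cls (xs ! j)) / t) \<le> ?s"
          using 1 by (simp only: ut sum_subtractf)
        moreover have "(\<Sum>j<r. u (?cls (xs ! j)) / t) - r * (card M / ?n) \<le> ?s"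
          using 2 by (simp add: sum_subtractf)
        ultimately have "(\<Sum>j<r. W ?C j (xs ! j)) \<le> r * (card M / ?n) + 2 * ?s" by linarith
        also have "\<dots> = r * (card M / ?n + \<epsilon>)" by (simp add: distrib_left)
        finally show ?thesis .
      qed
      moreover have "1 \<le> (\<Sum>j\<in>e. W ?C j (xs ! j))"
        if "e \<subseteq> {..<length xs}" "card e = t" "inj_on ((!) xs) e" "(!) xs ` e \<in> F" for e
      proof -
        have "xs \<in> listset ?C" by (simp add: listset_iff match_class_self[OF disj])
        then show ?thesis using cov that by auto
      qed
      moreover have "\<forall>j. 0 \<le> W ?C j (xs ! j)" using cov by blast
      ultimately have "light_cover t F xs (\<lambda>j. W ?C j (xs ! j)) (r * (card M / ?n + \<epsilon>))"
        unfolding light_cover_def len by blast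
      then show False using xs by blast
    qed
    then have "card {xs \<in> ?T. \<nexists>w. light_cover t F xs w (r * (card M / ?n + \<epsilon>))} \<le> card (S0 \<union> S1 \<union> S2)"
      using fT by (intro card_mono) (auto simp: S0_def S1_def S2_def)
    also have "\<dots> \<le> card S0 + card S1 + card S2" by (meson add_le_mono1 card_Un_le order_trans)
    finally have "real (card {xs \<in> ?T. \<nexists>w. light_cover t F xs w (r * (card M / ?n + \<epsilon>))}) \<le> card S0 + card S1 + card S2"
      by linarith
    also have "\<dots> \<le> \<delta> * real ?n ^ r + 4 / (\<epsilon>\<^sup>2 * r) * real ?n ^ r + 4 / (\<epsilon>\<^sup>2 * r) * real ?n ^ r"
      unfolding of_nat_add using c0 bound[OF c1] bound[OF c2] by linarith
    also have "\<dots> = (\<delta> + 8 / (\<epsilon>\<^sup>2 * r)) * real ?n ^ r" by (simp add: algebra_simps)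
    finally show "real (card {xs \<in> ?T. \<nexists>w. light_cover t F xs w (r * (card M / ?n + \<epsilon>))}) \<le> (\<delta> + 8 / (\<epsilon>\<^sup>2 * r)) * real ?n ^ r" .
  qed
qed

section \<open>The asymptotic bound and rainbow stars\<close>

definition matching_le :: "'a set set \<Rightarrow> nat \<Rightarrow> bool" where
  "matching_le F m \<longleftrightarrow> (\<forall>M. M \<subseteq> F \<longrightarrow> pairwise disjnt M \<longrightarrow> card M \<le> m)"

lemma maximum_matching_exists:
  assumes "finite F"
  obtains M where "M \<subseteq> F" "pairwise disjnt M" "\<And>M'. M' \<subseteq> F \<Longrightarrow> pairwise disjnt M' \<Longrightarrow> card M' \<le> card M"
proof -
  let ?S = "{M. M \<subseteq> F \<and> pairwise disjnt M}"
  have fin: "finite ?S" using assms by simp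
  have "{} \<in> ?S" by simp
  then have "Max (card ` ?S) \<in> card ` ?S" using fin by (intro Max_in) auto
  then obtain M where M: "M \<in> ?S" "card M = Max (card ` ?S)" by auto
  have "card M' \<le> card M" if "M' \<subseteq> F" "pairwise disjnt M'" for M'
    unfolding M(2) using fin that by (intro Max_ge) auto
  then show thesis using M(1) that by blast
qed

lemma few_tuples_without_light_covers:
  fixes \<epsilon> \<delta> :: real and k :: nat
  assumes t: "t \<ge> 1" and r: "r \<ge> 1" and \<epsilon>: "\<epsilon> > 0" and \<delta>: "\<delta> > 0"
  shows "\<exists>n0. \<forall>(V :: 'a set) F m. finite V \<longrightarrow> n0 \<le> card V \<longrightarrow> (\<forall>i<k. F i \<subseteq> {e. e \<subseteq> V \<and> card e = t} \<and> matching_le (F i) (m i)) \<longrightarrow>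
     real (card {xs \<in> tuples V r. \<exists>i<k. \<nexists>w. light_cover t (F i) xs w (r * (m i / card V + \<epsilon>))}) \<le> k * ((\<delta> + 8 / (\<epsilon>\<^sup>2 * r)) * real (card V) ^ r)"
proof -
  obtain n0 where n0: "\<And>(V :: 'a set) F M. finite V \<Longrightarrow> n0 \<le> card V \<Longrightarrow> F \<subseteq> {e. e \<subseteq> V \<and> card e = t} \<Longrightarrow> M \<subseteq> F \<Longrightarrow>
     pairwise disjnt M \<Longrightarrow> (\<forall>M'. M' \<subseteq> F \<longrightarrow> pairwise disjnt M' \<longrightarrow> card M' \<le> card M) \<Longrightarrow>
     real (card {xs \<in> tuples V r. \<nexists>w. light_cover t F xs w (r * (card M / card V + \<epsilon>))}) \<le> (\<delta> + 8 / (\<epsilon>\<^sup>2 * r)) * real (card V) ^ r"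
    using few_tuples_without_light_cover[OF t r \<epsilon> \<delta>, where 'a = 'a] by blast
  show ?thesis
  proof (intro exI[of _ n0] allI impI)
    fix V :: "'a set" and F and m :: "nat \<Rightarrow> nat"
    assume V: "finite V" "n0 \<le> card V" and F: "\<forall>i<k. F i \<subseteq> {e. e \<subseteq> V \<and> card e = t} \<and> matching_le (F i) (m i)"
    let ?bad = "\<lambda>i. {xs \<in> tuples V r. \<nexists>w. light_cover t (F i) xs w (r * (m i / card V + \<epsilon>))}"
    have each: "real (card (?bad i)) \<le> (\<delta> + 8 / (\<epsilon>\<^sup>2 * r)) * real (card V) ^ r" if i: "i < k" for i
    proof -
      have Fi: "F i \<subseteq> {e. e \<subseteq> V \<and> card e = t}" "matching_le (F i) (m i)" using F i by auto
      have "finite (F i)" by (rule finite_subset[of _ "Pow V"]) (use Fi V in auto)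
      then obtain M where M: "M \<subseteq> F i" "pairwise disjnt M" "\<And>M'. M' \<subseteq> F i \<Longrightarrow> pairwise disjnt M' \<Longrightarrow> card M' \<le> card M"
        using maximum_matching_exists by blast
      have "card M \<le> m i" using Fi(2) M unfolding matching_le_def by blast
      then have le: "r * (card M / card V + \<epsilon>) \<le> r * (m i / card V + \<epsilon>)"
        by (intro mult_left_mono add_right_mono divide_right_mono) auto
      have mono: "light_cover t (F i) xs w (r * (m i / card V + \<epsilon>))" if "light_cover t (F i) xs w (r * (card M / card V + \<epsilon>))" for xs w
        using that le unfolding light_cover_def by auto
      have "?bad i \<subseteq> {xs \<in> tuples V r. \<nexists>w. light_cover t (F i) xs w (r * (card M / card V + \<epsilon>))}"
        using mono by blast
      then have "card (?bad i) \<le> card {xs \<in> tuples V r. \<nexists>w. light_cover t (F i) xs w (r * (card M / card V + \<epsilon>))}"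
        using finite_tuples[OF V(1)] by (intro card_mono) auto
      then show ?thesis using n0[OF V Fi(1) M(1,2)] M(3) by (meson of_nat_mono order_trans)
    qed
    have "{xs \<in> tuples V r. \<exists>i<k. \<nexists>w. light_cover t (F i) xs w (r * (m i / card V + \<epsilon>))} = (\<Union>i<k. ?bad i)" by auto
    then have "card {xs \<in> tuples V r. \<exists>i<k. \<nexists>w. light_cover t (F i) xs w (r * (m i / card V + \<epsilon>))} \<le> (\<Sum>i<k. card (?bad i))"
      by (simp only:) (rule card_UN_le, simp)
    then have "real (card {xs \<in> tuples V r. \<exists>i<k. \<nexists>w. light_cover t (F i) xs w (r * (m i / card V + \<epsilon>))}) \<le> (\<Sum>i<k. real (card (?bad i)))"
      by (simp only: of_nat_le_iff flip: of_nat_sum)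
    also have "\<dots> \<le> (\<Sum>i<k. (\<delta> + 8 / (\<epsilon>\<^sup>2 * r)) * real (card V) ^ r)" by (intro sum_mono each) simp
    finally show "real (card {xs \<in> tuples V r. \<exists>i<k. \<nexists>w. light_cover t (F i) xs w (r * (m i / card V + \<epsilon>))}) \<le> k * ((\<delta> + 8 / (\<epsilon>\<^sup>2 * r)) * real (card V) ^ r)"
      by simp
  qed
qed

text \<open>As above, a single small number \<open>\<sigma>\<close> controls the proportion of exceptions and the size of
the vertex set.\<close>

definition almost_covered :: "'a set \<Rightarrow> nat \<Rightarrow> nat \<Rightarrow> (nat \<Rightarrow> 'a set set) \<Rightarrow> (nat \<Rightarrow> nat) \<Rightarrow> real \<Rightarrow> bool" where
  "almost_covered V t k F m \<sigma> \<longleftrightarrow> finite V \<and> 1 / \<sigma> \<le> real (card V) \<and>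
     (\<forall>i<k. F i \<subseteq> {e. e \<subseteq> V \<and> card e = t} \<and> matching_le (F i) (m i)) \<and>
     real (card {y \<in> tuples V t. \<not> (\<exists>i<k. set y \<in> F i)}) \<le> \<sigma> * real (card V) ^ t"

lemma almost_coveredD:
  assumes "almost_covered V t k F m \<sigma>"
  shows "finite V" "1 / \<sigma> \<le> real (card V)" "\<forall>i<k. F i \<subseteq> {e. e \<subseteq> V \<and> card e = t} \<and> matching_le (F i) (m i)"
    "real (card {y \<in> tuples V t. \<not> (\<exists>i<k. set y \<in> F i)}) \<le> \<sigma> * real (card V) ^ t"
  using assms unfolding almost_covered_def by simp_all

text \<open>A single sample that has light covers for all colours at once, has no uncoloured subset and
avoids a prescribed rare set \<open>A\<close> of subtuples.\<close>

lemma good_sample_exists: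
  fixes \<epsilon> :: real and k :: nat
  assumes t: "t \<ge> 1" "t \<le> r" and l: "l \<le> r" and \<epsilon>: "\<epsilon> > 0" and r: "real r \<ge> 64 * real k / \<epsilon>\<^sup>2"
  shows "\<exists>\<sigma>>0. \<forall>(V :: 'a set) F m A. almost_covered V t k F m \<sigma> \<longrightarrow>
     A \<subseteq> tuples V l \<longrightarrow> real (card A) \<le> \<sigma> * real (card V) ^ l \<longrightarrow>
     (\<exists>xs\<in>tuples V r. distinct xs \<and> (\<forall>i<k. \<exists>w. light_cover t (F i) xs w (r * (m i / card V + \<epsilon>))) \<and>
        (\<forall>e. e \<subseteq> {..<r} \<longrightarrow> card e = t \<longrightarrow> (\<exists>i<k. (!) xs ` e \<in> F i)) \<and>
        (\<forall>p. distinct p \<longrightarrow> length p = l \<longrightarrow> set p \<subseteq> {..<r} \<longrightarrow> map ((!) xs) p \<notin> A))"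
proof -
  have r1: "r \<ge> 1" using t by simp
  define \<delta> where "\<delta> = 1 / (8 * (real k + 1))"
  have \<delta>: "\<delta> > 0" "k * \<delta> \<le> 1 / 8" by (auto simp: \<delta>_def field_simps)
  have "k * (8 / (\<epsilon>\<^sup>2 * r)) \<le> 1 / 8"
  proof -
    have "64 * real k \<le> real r * \<epsilon>\<^sup>2" using r \<epsilon> by (simp add: pos_divide_le_eq)
    then show ?thesis using \<epsilon> r1 by (simp add: field_simps)
  qed
  then have frac: "k * (\<delta> + 8 / (\<epsilon>\<^sup>2 * r)) \<le> 1 / 4" using \<delta>(2) by (simp add: distrib_left)
  obtain n0 where n0: "\<And>(V :: 'a set) F m. finite V \<Longrightarrow> n0 \<le> card V \<Longrightarrow> (\<forall>i<k. F i \<subseteq> {e. e \<subseteq> V \<and> card e = t} \<and> matching_le (F i) (m i)) \<Longrightarrow>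
     real (card {xs \<in> tuples V r. \<exists>i<k. \<nexists>w. light_cover t (F i) xs w (r * (m i / card V + \<epsilon>))}) \<le> k * ((\<delta> + 8 / (\<epsilon>\<^sup>2 * r)) * real (card V) ^ r)"
    using few_tuples_without_light_covers[OF t(1) r1 \<epsilon> \<delta>(1), of k, where 'a = 'a] by blast
  define R where "R = real r ^ t + real r ^ l + real r ^ 2"
  have R: "real r ^ t \<le> R" "real r ^ l \<le> R" "real r ^ 2 \<le> R" "R > 0" using r1 by (auto simp: R_def add_pos_pos)
  define \<sigma> where "\<sigma> = min (1 / (8 * R)) (1 / (n0 + 1))"
  have \<sigma>: "\<sigma> > 0" "\<sigma> \<le> 1 / (8 * R)" "\<sigma> \<le> 1 / (n0 + 1)" using R by (auto simp: \<sigma>_def)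
  have sR: "x * \<sigma> \<le> 1 / 8" if "x \<le> R" "0 \<le> x" for x
  proof -
    have "x * \<sigma> \<le> R * (1 / (8 * R))" using that \<sigma> R by (intro mult_mono) auto
    then show ?thesis using R by simp
  qed
  show ?thesis
  proof (intro exI[of _ \<sigma>] conjI allI impI \<sigma>(1))
    fix V :: "'a set" and F and m :: "nat \<Rightarrow> nat" and A
    assume ac: "almost_covered V t k F m \<sigma>"
      and A: "A \<subseteq> tuples V l" "real (card A) \<le> \<sigma> * real (card V) ^ l"
    note V = almost_coveredD(1,2)[OF ac] and F = almost_coveredD(3)[OF ac] and U = almost_coveredD(4)[OF ac]
    let ?n = "card V" and ?T = "tuples V r"
    let ?U = "{y \<in> tuples V t. \<not> (\<exists>i<k. set y \<in> F i)}"
    have fT: "finite (tuples V x)" for x by (rule finite_tuples[OF V(1)])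
    have fA: "finite A" using A(1) fT finite_subset by blast
    have "1 / (1 / (n0 + 1)) \<le> 1 / \<sigma>" using \<sigma> by (intro divide_left_mono) auto
    then have nn0: "real n0 + 1 \<le> ?n" using V(2) by simp
    then have n: "?n > 0" "n0 \<le> ?n" by linarith+
    have n\<sigma>: "1 \<le> \<sigma> * ?n" using V(2) \<sigma>(1) by (simp add: pos_divide_le_eq mult.commute)
    define B0 where "B0 = {xs \<in> ?T. \<exists>i<k. \<nexists>w. light_cover t (F i) xs w (r * (m i / ?n + \<epsilon>))}"
    define B1 where "B1 = {xs \<in> ?T. \<exists>p. distinct p \<and> length p = t \<and> set p \<subseteq> {..<r} \<and> map ((!) xs) p \<in> ?U}"
    define B2 where "B2 = {xs \<in> ?T. \<exists>p. distinct p \<and> length p = l \<and> set p \<subseteq> {..<r} \<and> map ((!) xs) p \<in> A}"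
    define B3 where "B3 = {xs \<in> ?T. \<exists>i<r. \<exists>j<r. i \<noteq> j \<and> xs ! i = xs ! j}"
    have b0: "real (card B0) \<le> 1 / 4 * real ?n ^ r"
    proof -
      have "real (card B0) \<le> k * (\<delta> + 8 / (\<epsilon>\<^sup>2 * r)) * real ?n ^ r"
        using n0[OF V(1) n(2) F] by (simp add: B0_def mult.assoc)
      also have "\<dots> \<le> 1 / 4 * real ?n ^ r" using frac by (intro mult_right_mono) auto
      finally show ?thesis .
    qed
    have sub: "real (card {xs \<in> ?T. \<exists>p. distinct p \<and> length p = x \<and> set p \<subseteq> {..<r} \<and> map ((!) xs) p \<in> D}) \<le> 1 / 8 * real ?n ^ r"
      if "finite D" "real (card D) \<le> \<sigma> * real ?n ^ x" "x \<le> r" "real r ^ x \<le> R" for D x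
    proof -
      have "card {xs \<in> ?T. \<exists>p. distinct p \<and> length p = x \<and> set p \<subseteq> {..<r} \<and> map ((!) xs) p \<in> D} \<le> r ^ x * (card D * ?n ^ (r - x))"
        by (rule card_containing_subtuple_le[OF V(1) that(1)])
      then have "real (card {xs \<in> ?T. \<exists>p. distinct p \<and> length p = x \<and> set p \<subseteq> {..<r} \<and> map ((!) xs) p \<in> D}) \<le> real (r ^ x * (card D * ?n ^ (r - x)))"
        by (simp only: of_nat_le_iff)
      also have "\<dots> = real r ^ x * (real (card D) * real ?n ^ (r - x))" by simp
      also have "\<dots> \<le> real r ^ x * ((\<sigma> * real ?n ^ x) * real ?n ^ (r - x))"
        using that(2) by (intro mult_left_mono mult_right_mono) auto
      also have "\<dots> = (real r ^ x * \<sigma>) * (real ?n ^ (x + (r - x)))" by (simp only: power_add mult_ac)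
      also have "\<dots> \<le> 1 / 8 * real ?n ^ (x + (r - x))" using sR[OF that(4)] by (intro mult_right_mono) auto
      finally show ?thesis using that(3) by simp
    qed
    have b1: "real (card B1) \<le> 1 / 8 * real ?n ^ r" unfolding B1_def using fT U t R by (intro sub) auto
    have b2: "real (card B2) \<le> 1 / 8 * real ?n ^ r" unfolding B2_def using fA A l R by (intro sub) auto
    have b3: "real (card B3) \<le> 1 / 8 * real ?n ^ r"
    proof -
      have "{u \<in> V. v = u} = {v}" if "v \<in> V" for v using that by auto
      then have "card B3 \<le> r ^ 2 * 1 * ?n ^ (r - 1)"
        unfolding B3_def by (intro card_colliding_tuples_le[OF V(1)]) simp
      then have "real (card B3) \<le> real (r ^ 2 * 1 * ?n ^ (r - 1))" by (simp only: of_nat_le_iff)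
      also have "\<dots> = real r ^ 2 * 1 * real ?n ^ (r - 1)" by simp
      also have "\<dots> \<le> real r ^ 2 * (\<sigma> * ?n) * real ?n ^ (r - 1)" using n\<sigma> by (intro mult_right_mono mult_left_mono) auto
      also have "\<dots> = (real r ^ 2 * \<sigma>) * real ?n ^ Suc (r - 1)" by (simp only: power_Suc mult_ac)
      also have "\<dots> \<le> 1 / 8 * real ?n ^ Suc (r - 1)" using sR[OF R(3)] by (intro mult_right_mono) auto
      finally show ?thesis using r1 by simp
    qed
    have "real (card (B0 \<union> B1 \<union> B2 \<union> B3)) \<le> real (card B0 + card B1 + card B2 + card B3)"
      using card_Un_le[of B0 B1] card_Un_le[of "B0 \<union> B1" B2] card_Un_le[of "B0 \<union> B1 \<union> B2" B3] by linarith
    also have "\<dots> \<le> (1/4 + 1/8 + 1/8 + 1/8) * real ?n ^ r" using b0 b1 b2 b3 by (simp add: algebra_simps)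
    also have "\<dots> < real ?n ^ r" using n by simp
    also have "\<dots> = real (card ?T)" by (simp add: card_tuples V)
    finally have "card (B0 \<union> B1 \<union> B2 \<union> B3) < card ?T" by linarith
    moreover have "B0 \<union> B1 \<union> B2 \<union> B3 \<subseteq> ?T" by (auto simp: B0_def B1_def B2_def B3_def)
    ultimately have "\<not> ?T \<subseteq> B0 \<union> B1 \<union> B2 \<union> B3"
      using card_mono[of "B0 \<union> B1 \<union> B2 \<union> B3" ?T] fT finite_subset by (metis not_le)
    then obtain xs where xs: "xs \<in> ?T" "xs \<notin> B0" "xs \<notin> B1" "xs \<notin> B2" "xs \<notin> B3" by blast
    have "distinct xs" using xs(1,5) by (auto simp: B3_def tuples_def distinct_conv_nth)
    moreover have "\<forall>i<k. \<exists>w. light_cover t (F i) xs w (r * (m i / ?n + \<epsilon>))" using xs(1,2) by (auto simp: B0_def)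
    moreover have "\<exists>i<k. (!) xs ` e \<in> F i" if e: "e \<subseteq> {..<r}" "card e = t" for e
    proof -
      have "finite e" using e(1) finite_subset by blast
      then obtain p where p: "set p = e" "distinct p" using finite_distinct_list by blast
      then have "length p = t" using e(2) distinct_card by force
      then have "map ((!) xs) p \<notin> ?U" using xs(1,3) p e(1) unfolding B1_def by blast
      moreover have "map ((!) xs) p \<in> tuples V t"
        using tuples_nth[OF xs(1)] p e(1) \<open>length p = t\<close> by (auto simp: tuples_def)
      ultimately show ?thesis using p(1) by auto
    qed
    moreover have "\<forall>p. distinct p \<longrightarrow> length p = l \<longrightarrow> set p \<subseteq> {..<r} \<longrightarrow> map ((!) xs) p \<notin> A"
      using xs(1,4) unfolding B2_def by blast
    ultimately show "\<exists>xs\<in>?T. distinct xs \<and> (\<forall>i<k. \<exists>w. light_cover t (F i) xs w (r * (m i / ?n + \<epsilon>))) \<and>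
        (\<forall>e. e \<subseteq> {..<r} \<longrightarrow> card e = t \<longrightarrow> (\<exists>i<k. (!) xs ` e \<in> F i)) \<and>
        (\<forall>p. distinct p \<longrightarrow> length p = l \<longrightarrow> set p \<subseteq> {..<r} \<longrightarrow> map ((!) xs) p \<notin> A)"
      using xs(1) by blast
  qed
qed


text \<open>If the inequality failed, a good sample would have covers too light to cover all of its
\<open>t\<close>-subsets. The bound allows different matching numbers, which later shows that every single
colour is needed to the full extent.\<close>

lemma points_le_of_matching_bounds:
  fixes \<epsilon> :: real and k :: nat
  assumes t: "t \<ge> 1" and \<epsilon>: "\<epsilon> > 0"
  shows "\<exists>\<sigma>>0. \<forall>(V :: 'a set) F m Q. almost_covered V t k F m \<sigma> \<longrightarrow> (\<forall>i<k. m i \<le> Q) \<longrightarrow>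
     real (card V) \<le> (real t - 1) * real Q + (\<Sum>i<k. real (m i)) + \<epsilon> * real (card V)"
proof -
  \<comment> \<open>the covers of the sample may exceed their expected weight by the proportion \<open>e1\<close>\<close>
  define e1 where "e1 = \<epsilon> / (t + k)"
  have e1: "e1 > 0" "e1 * (real t - 1 + k) \<le> \<epsilon>" using \<epsilon> t by (auto simp: e1_def field_simps)
  obtain r :: nat where "real r \<ge> max (64 * real k / e1\<^sup>2) (max (real t) (1 / e1))"
    using real_arch_simple by blast
  then have r: "real r \<ge> 64 * real k / e1\<^sup>2" "t \<le> r" "real r \<ge> 1 / e1" by auto
  obtain \<sigma> where \<sigma>: "\<sigma> > 0" and good: "\<forall>(V :: 'a set) F m A. almost_covered V t k F m \<sigma> \<longrightarrow>
     A \<subseteq> tuples V 0 \<longrightarrow> real (card A) \<le> \<sigma> * real (card V) ^ 0 \<longrightarrow>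
     (\<exists>xs\<in>tuples V r. distinct xs \<and> (\<forall>i<k. \<exists>w. light_cover t (F i) xs w (r * (m i / card V + e1))) \<and>
        (\<forall>e. e \<subseteq> {..<r} \<longrightarrow> card e = t \<longrightarrow> (\<exists>i<k. (!) xs ` e \<in> F i)) \<and>
        (\<forall>p. distinct p \<longrightarrow> length p = 0 \<longrightarrow> set p \<subseteq> {..<r} \<longrightarrow> map ((!) xs) p \<notin> A))"
    using good_sample_exists[OF t r(2) le0 e1(1) r(1), where 'a = 'a] by (elim exE conjE) (rule that)
  show ?thesis
  proof (intro exI[of _ \<sigma>] conjI allI impI \<sigma>)
    fix V :: "'a set" and F and m :: "nat \<Rightarrow> nat" and Q :: nat
    assume ac: "almost_covered V t k F m \<sigma>" and F: "\<forall>i<k. m i \<le> Q"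
    note V = almost_coveredD(1,2)[OF ac]
    let ?n = "real (card V)"
    have "0 < 1 / \<sigma>" using \<sigma> by simp
    then have n: "?n > 0" using V(2) by linarith
    have "real (card ({} :: 'a list set)) \<le> \<sigma> * ?n ^ 0" using \<sigma> by simp
    from good[THEN spec, THEN spec, THEN spec, THEN spec, THEN mp, OF ac, THEN mp, OF empty_subsetI, THEN mp, OF this] obtain xs where xs: "xs \<in> tuples V r" "distinct xs"
      "\<forall>i<k. \<exists>w. light_cover t (F i) xs w (r * (m i / ?n + e1))"
      "\<forall>e. e \<subseteq> {..<r} \<longrightarrow> card e = t \<longrightarrow> (\<exists>i<k. (!) xs ` e \<in> F i)" by blast
    have len: "length xs = r" using xs(1) by (simp add: tuples_def)
    from xs(3) obtain w where w: "\<forall>i<k. light_cover t (F i) xs (w i) (r * (m i / ?n + e1))"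
      by metis
    note lc = w[unfolded light_cover_def len, rule_format]
    show "?n \<le> (real t - 1) * real Q + (\<Sum>i<k. real (m i)) + \<epsilon> * ?n"
    proof (rule ccontr)
      assume "\<not> ?thesis"
      then have big: "(real t - 1) * real Q + (\<Sum>i<k. real (m i)) < (1 - \<epsilon>) * ?n" by (simp add: algebra_simps)
      have r0: "real r > 0" using r(2) t by simp
      have "\<exists>e. e \<subseteq> {..<r} \<and> card e = t \<and> (\<forall>i<k. (\<Sum>j\<in>e. w i j) < 1)"
      proof (rule uncovered_set_exists[where c = "\<lambda>i. r * (m i / ?n + e1)" and Q = "r * (Q / ?n + e1)"])
        show "r * (m i / ?n + e1) \<le> r * (Q / ?n + e1)" if "i < k" for i
          using F that n by (intro mult_left_mono add_right_mono divide_right_mono) auto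
        have "1 \<le> r * e1" using r(3) e1(1) by (simp add: pos_divide_le_eq)
        also have "\<dots> \<le> r * (Q / ?n + e1)" using n by (intro mult_left_mono) auto
        finally show "1 \<le> r * (Q / ?n + e1)" .
        have "(real t - 1) * (r * (Q / ?n + e1)) + (\<Sum>i<k. r * (m i / ?n + e1))
          = r * (((real t - 1) * Q + (\<Sum>i<k. real (m i))) / ?n + e1 * (real t - 1 + k))"
          by (simp add: sum.distrib sum_distrib_left sum_divide_distrib algebra_simps add_divide_distrib diff_divide_distrib)
        also have "\<dots> < r * ((1 - \<epsilon>) + \<epsilon>)"
          using r0 big n e1(2) by (intro mult_strict_left_mono add_less_le_mono) (auto simp: pos_divide_less_eq)
        finally show "(real t - 1) * (r * (Q / ?n + e1)) + (\<Sum>i<k. r * (m i / ?n + e1)) < real (card {..<r})" by simp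
      qed (use lc t in auto)
      then obtain e where e: "e \<subseteq> {..<r}" "card e = t" "\<forall>i<k. (\<Sum>j\<in>e. w i j) < 1" by blast
      then obtain i where i: "i < k" "(!) xs ` e \<in> F i" using xs(4) by blast
      have "inj_on ((!) xs) e" by (rule inj_on_nth[OF xs(2)]) (use e(1) len in auto)
      then have "1 \<le> (\<Sum>j\<in>e. w i j)" using lc[OF i(1)] e(1,2) i(2) by blast
      then show False using e(3) i(1) by force
    qed
  qed
qed

text \<open>The first \<open>t - 1\<close> entries are the centre of the star, the others its leaves, one for each colour.\<close>

definition rainbow_stars :: "'a set \<Rightarrow> nat \<Rightarrow> nat \<Rightarrow> (nat \<Rightarrow> 'a set set) \<Rightarrow> 'a list set" where
  "rainbow_stars V t k F = {ys \<in> tuples V (t - 1 + k). distinct ys \<and>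
      (\<forall>i<k. insert (ys ! (t - 1 + i)) ((!) ys ` {..<t - 1}) \<in> F i)}"

text \<open>Were the stars rare, some good sample would avoid them; but the light covers of a
good sample force a star.\<close>

lemma rainbow_stars_dense:
  fixes k :: nat
  assumes t: "t \<ge> 1" and k: "k \<ge> 1"
  shows "\<exists>\<sigma>>0. \<forall>(V :: 'a set) F m. almost_covered V t k F (\<lambda>_. m) \<sigma> \<longrightarrow> m * (t - 1 + k) \<le> card V \<longrightarrow>
     real (card (rainbow_stars V t k F)) > \<sigma> * real (card V) ^ (t - 1 + k)"
proof -
  define l where "l = t - 1 + k"
  have l1: "real l \<ge> 1" using k by (simp add: l_def)
  \<comment> \<open>small enough for the slack of a quarter in the rounding of the covers\<close>
  define e1 where "e1 = 1 / (4 * real l ^ 2)"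
  have e1: "e1 > 0" using l1 by (simp add: e1_def)
  obtain r :: nat where "real r \<ge> max (max (64 * real k / e1\<^sup>2) (max (real t) (1 / e1))) (real l)"
    using real_arch_simple by blast
  then have r: "real r \<ge> 64 * real k / e1\<^sup>2" "t \<le> r" "real r \<ge> 1 / e1" "l \<le> r" by auto
  obtain \<sigma> where \<sigma>: "\<sigma> > 0" and good: "\<forall>(V :: 'a set) F m A. almost_covered V t k F m \<sigma> \<longrightarrow>
     A \<subseteq> tuples V l \<longrightarrow> real (card A) \<le> \<sigma> * real (card V) ^ l \<longrightarrow>
     (\<exists>xs\<in>tuples V r. distinct xs \<and> (\<forall>i<k. \<exists>w. light_cover t (F i) xs w (r * (m i / card V + e1))) \<and>
        (\<forall>e. e \<subseteq> {..<r} \<longrightarrow> card e = t \<longrightarrow> (\<exists>i<k. (!) xs ` e \<in> F i)) \<and>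
        (\<forall>p. distinct p \<longrightarrow> length p = l \<longrightarrow> set p \<subseteq> {..<r} \<longrightarrow> map ((!) xs) p \<notin> A))"
    using good_sample_exists[OF t r(2,4) e1(1) r(1), where 'a = 'a] by (elim exE conjE) (rule that)
  show ?thesis
  proof (intro exI[of _ \<sigma>] conjI allI impI \<sigma>)
    fix V :: "'a set" and F and m :: nat
    assume ac: "almost_covered V t k F (\<lambda>_. m) \<sigma>" and m: "m * (t - 1 + k) \<le> card V"
    note V = almost_coveredD(1,2)[OF ac]
    let ?n = "real (card V)"
    have "0 < 1 / \<sigma>" using \<sigma> by simp
    then have n: "?n > 0" using V(2) by linarith
    show "real (card (rainbow_stars V t k F)) > \<sigma> * ?n ^ (t - 1 + k)"
    proof (rule ccontr)
      assume "\<not> ?thesis"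
      then have few: "real (card (rainbow_stars V t k F)) \<le> \<sigma> * ?n ^ l" by (simp add: l_def)
      have "rainbow_stars V t k F \<subseteq> tuples V l" by (auto simp: rainbow_stars_def l_def)
      from good[THEN spec, THEN spec, THEN spec, THEN spec, THEN mp, OF ac, THEN mp, OF this, THEN mp, OF few] obtain xs where xs: "xs \<in> tuples V r" "distinct xs"
        "\<forall>i<k. \<exists>w. light_cover t (F i) xs w (r * (m / ?n + e1))"
        "\<forall>e. e \<subseteq> {..<r} \<longrightarrow> card e = t \<longrightarrow> (\<exists>i<k. (!) xs ` e \<in> F i)"
        "\<forall>p. distinct p \<longrightarrow> length p = l \<longrightarrow> set p \<subseteq> {..<r} \<longrightarrow> map ((!) xs) p \<notin> rainbow_stars V t k F" by blast
      have len: "length xs = r" using xs(1) by (simp add: tuples_def)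
      from xs(3) obtain w where w: "\<forall>i<k. light_cover t (F i) xs (w i) (r * (m / ?n + e1))"
        by metis
      note lc = w[unfolded light_cover_def len, rule_format]
      have inj: "inj_on ((!) xs) e" if "e \<subseteq> {..<r}" for e
        by (rule inj_on_nth[OF xs(2)]) (use that len in auto)
      define c where "c = r * (1 / real l + e1)"
      have mc: "r * (m / ?n + e1) \<le> c"
      proof -
        have "real (m * l) \<le> ?n" using m by (simp only: l_def of_nat_le_iff)
        then have "m / ?n \<le> 1 / real l" using n l1 by (simp add: field_simps)
        then show ?thesis unfolding c_def by (intro mult_left_mono) auto
      qed
      have "\<exists>Q v. Q \<subseteq> {..<r} \<and> card Q = t - 1 \<and> inj_on v {..<k} \<and> (\<forall>i<k. v i \<in> {..<r} - Q \<and> insert (v i) Q \<in> {e. (!) xs ` e \<in> F i})"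
      proof (rule rainbow_star_exists[where w = w and c = c])
        show "(\<Sum>j\<in>{..<r}. w i j) \<le> c" if "i < k" for i using lc[OF that] mc by auto
        have "1 \<le> r * e1" using r(3) e1(1) by (simp add: pos_divide_le_eq)
        also have "\<dots> \<le> c" using l1 unfolding c_def by (intro mult_left_mono) auto
        finally show "1 \<le> c" .
        have "(real l - 1/4) * (1 / real l + e1) \<le> 1" using l1 by (simp add: e1_def field_simps power2_eq_square)
        then have "r * ((real l - 1/4) * (1 / real l + e1)) \<le> real r * 1" by (intro mult_left_mono) auto
        then show "(real (t - 1 + k) - 1/4) * c \<le> real (card {..<r})" unfolding l_def[symmetric] c_def by (simp add: mult_ac)
        show "1 \<le> (\<Sum>j\<in>e. w i j)" if "i < k" "e \<subseteq> {..<r}" "card e = t" "e \<in> {e. (!) xs ` e \<in> F i}" for i e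
          using lc[OF that(1)] inj[OF that(2)] that by auto
        show "\<exists>i<k. e \<in> {e. (!) xs ` e \<in> F i}" if "e \<subseteq> {..<r}" "card e = t" for e using xs(4) that by simp
      qed (use lc t k in auto)
      then obtain Q v where Q: "Q \<subseteq> {..<r}" "card Q = t - 1" and v: "inj_on v {..<k}" "\<And>i. i < k \<Longrightarrow> v i \<in> {..<r} - Q"
        "\<And>i. i < k \<Longrightarrow> (!) xs ` insert (v i) Q \<in> F i" by blast
      have "finite Q" using Q(1) finite_subset by blast
      then obtain qs where qs: "set qs = Q" "distinct qs" using finite_distinct_list by blast
      have lq: "length qs = t - 1" using qs Q(2) distinct_card by force
      define p where "p = qs @ map v [0..<k]"
      have p: "distinct p" "length p = l" "set p \<subseteq> {..<r}"
        using qs lq v(1,2) Q(1) by (auto simp: p_def l_def distinct_map atLeast0LessThan)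
      have "map ((!) xs) p \<in> rainbow_stars V t k F"
      proof -
        have "map ((!) xs) p \<in> tuples V l"
          using p(2,3) tuples_nth[OF xs(1)] by (auto simp: tuples_def)
        moreover have "distinct (map ((!) xs) p)" using p(1) inj[OF p(3)] by (simp add: distinct_map)
        moreover have "insert (map ((!) xs) p ! (t - 1 + i)) ((!) (map ((!) xs) p) ` {..<t - 1}) \<in> F i" if i: "i < k" for i
        proof -
          have "map ((!) xs) p ! (t - 1 + i) = xs ! v i" using i lq by (simp add: p_def nth_append)
          moreover have "(!) (map ((!) xs) p) ` {..<t - 1} = (!) xs ` Q"
          proof -
            have "(!) (map ((!) xs) p) ` {..<t - 1} = (\<lambda>j. xs ! (qs ! j)) ` {..<length qs}"
              using lq by (intro image_cong) (auto simp: p_def nth_append)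
            also have "\<dots> = (!) xs ` ((!) qs ` {..<length qs})" by (simp add: image_image)
            also have "(!) qs ` {..<length qs} = Q" using qs(1) by (auto simp: set_conv_nth)
            finally show ?thesis .
          qed
          ultimately show ?thesis using v(3)[OF i] by simp
        qed
        ultimately show ?thesis by (simp add: rainbow_stars_def l_def)
      qed
      then show False using xs(5) p by blast
    qed
  qed
qed

section \<open>Gainful patterns are rare\<close>

text \<open>Colours from \<open>k\<close> on mean that a set is uncoloured.\<close>

definition colour_class :: "'a set \<Rightarrow> nat \<Rightarrow> ('a set \<Rightarrow> nat) \<Rightarrow> nat \<Rightarrow> 'a set set" where
  "colour_class V t col i = {e. e \<subseteq> V \<and> card e = t \<and> col e = i}"

definition uncoloured :: "'a set \<Rightarrow> nat \<Rightarrow> nat \<Rightarrow> ('a set \<Rightarrow> nat) \<Rightarrow> 'a list set" where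
  "uncoloured V t k col = {y \<in> tuples V t. \<not> (\<exists>i<k. set y \<in> colour_class V t col i)}"

text \<open>The elements are the choices of one set of each colour among the sampled points, a choice being
encoded by the pairs of a point and a colour whose set contains it.\<close>

definition choice_pattern :: "nat \<Rightarrow> nat \<Rightarrow> ('a set \<Rightarrow> nat) \<Rightarrow> 'a list \<Rightarrow> (nat \<times> nat) set set" where
  "choice_pattern t k col xs = {g. g \<subseteq> {..<length xs} \<times> {..<k} \<and>
     (\<forall>i<k. card {v. (v, i) \<in> g} = t \<and> col ((!) xs ` {v. (v, i) \<in> g}) = i)}"

text \<open>A list of choices has as many sets of each colour as it has entries. The sum counts the copies of points
that are needed to make the sets of each single colour disjoint; sets of different colours
may share points.\<close>

definition gainful_by :: "nat \<Rightarrow> nat \<Rightarrow> nat \<Rightarrow> (nat \<times> nat) set list \<Rightarrow> bool" where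
  "gainful_by t k r gs \<longleftrightarrow> (\<Sum>v<r. MAX i\<in>{..<k}. card {a. a < length gs \<and> (v, i) \<in> gs ! a}) < (t - 1 + k) * length gs"

lemma gain_of_blowup:
  assumes gs: "set gs \<subseteq> \<pi>" "gainful_by t k r gs"
    and uV: "\<And>v l. v < r \<Longrightarrow> l < length gs \<Longrightarrow> u v l \<in> V"
    and u: "\<And>j l j' l'. \<lbrakk>j < r; l < length gs; j' < r; l' < length gs; (j, l) \<noteq> (j', l')\<rbrakk> \<Longrightarrow> u j l \<noteq> u j' l'"
    and pat: "\<And>f. (\<And>j. j < r \<Longrightarrow> f j < length gs) \<Longrightarrow> choice_pattern t k col (map (\<lambda>j. u j (f j)) [0..<r]) = \<pi>"
    and t: "t \<ge> 1" and k: "k > 0"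
  shows "\<exists>S. S \<subseteq> V \<and> finite S \<and> card S < (t - 1 + k) * length gs \<and>
    (\<forall>i<k. \<exists>N. N \<subseteq> colour_class S t col i \<and> finite N \<and> pairwise disjnt N \<and> card N = length gs)"
proof -
  let ?m = "length gs"
  let ?X = "\<lambda>v. MAX i\<in>{..<k}. card {a. a < ?m \<and> (v, i) \<in> gs ! a}"
  have X_le: "?X v \<le> ?m" if "k > 0" for v
  proof -
    have "card {a. a < ?m \<and> (v, i) \<in> gs ! a} \<le> ?m" for i
      using card_mono[of "{..<?m}" "{a. a < ?m \<and> (v, i) \<in> gs ! a}"] by auto
    then show ?thesis using that by (subst Max_le_iff) auto
  qed
  define S where "S = (\<Union>v<r. u v ` {..<?X v})"
  have S_fin: "finite S" by (auto simp: S_def)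
  have S_card: "card S < (t - 1 + k) * ?m"
  proof -
    have "card S \<le> (\<Sum>v<r. card (u v ` {..<?X v}))" unfolding S_def by (rule card_UN_le) simp
    also have "\<dots> \<le> (\<Sum>v<r. ?X v)"
    proof (rule sum_mono)
      fix v show "card (u v ` {..<?X v}) \<le> ?X v"
        using card_image_le[OF finite_lessThan, of "u v" "?X v"] by (simp only: card_lessThan)
    qed
    finally show ?thesis using gs(2) by (simp add: gainful_by_def)
  qed
  have lX: "label gs a (v, i) < ?X v" "label gs a (v, i) < ?m" if "a < ?m" "(v, i) \<in> gs ! a" "i < k" for a v i
  proof -
    have "card {b. b < ?m \<and> (v, i) \<in> gs ! b} \<le> ?X v" using that(3) by (intro Max_ge) auto
    then show "label gs a (v, i) < ?X v" using label_less_length[OF that(1,2)] by simp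
    show "label gs a (v, i) < ?m" using label_le[of gs a "(v, i)"] that(1) by simp
  qed
  have sub: "gs ! a \<subseteq> {..<r} \<times> {..<k}" if "a < ?m" for a
  proof -
    have "choice_pattern t k col (map (\<lambda>j. u j ((\<lambda>_. 0) j)) [0..<r]) = \<pi>"
      by (rule pat, rule le_less_trans[OF le0 that])
    then have "\<pi> = choice_pattern t k col (map (\<lambda>j. u j 0) [0..<r])" by simp
    moreover have "gs ! a \<in> \<pi>" using gs(1) that nth_mem by blast
    ultimately show ?thesis by (simp add: choice_pattern_def)
  qed
  have "\<exists>N. N \<subseteq> colour_class S t col i \<and> finite N \<and> pairwise disjnt N \<and> card N = ?m" if i: "i < k" for i
  proof -
    define new where "new a = (\<lambda>v. u v (label gs a (v, i))) ` {v. (v, i) \<in> gs ! a}" for a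
    have new: "new a \<in> colour_class S t col i" if a: "a < ?m" for a
    proof -
      define f where "f v = (if (v, i) \<in> gs ! a then label gs a (v, i) else 0)" for v
      have "f v < ?m" for v using lX(2)[OF a _ i] a by (auto simp: f_def intro: le_less_trans)
      then have "\<pi> = choice_pattern t k col (map (\<lambda>j. u j (f j)) [0..<r])" using pat[of f] by simp
      moreover have "gs ! a \<in> \<pi>" using gs(1) a nth_mem by blast
      ultimately have c: "card {v. (v, i) \<in> gs ! a} = t" "col ((!) (map (\<lambda>j. u j (f j)) [0..<r]) ` {v. (v, i) \<in> gs ! a}) = i"
        using i by (auto simp: choice_pattern_def)
      have vr: "v < r" if "(v, i) \<in> gs ! a" for v using sub[OF a] that by auto
      have "(!) (map (\<lambda>j. u j (f j)) [0..<r]) ` {v. (v, i) \<in> gs ! a} = new a"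
        unfolding new_def by (intro image_cong) (use vr in \<open>auto simp: f_def\<close>)
      moreover have "card (new a) = t"
        unfolding new_def using c(1)
      proof (subst card_image)
        show "inj_on (\<lambda>v. u v (label gs a (v, i))) {v. (v, i) \<in> gs ! a}"
        proof (rule inj_onI, rule ccontr)
          fix v v' assume v: "v \<in> {v. (v, i) \<in> gs ! a}" "v' \<in> {v. (v, i) \<in> gs ! a}" "v \<noteq> v'"
            and eq: "u v (label gs a (v, i)) = u v' (label gs a (v', i))"
          have "u v (label gs a (v, i)) \<noteq> u v' (label gs a (v', i))"
            using v vr lX(2)[OF a _ i] by (intro u) auto
          then show False using eq by simp
        qed
      qed
      moreover have "new a \<subseteq> S"
        unfolding new_def S_def using vr lX(1)[OF a _ i] by blast
      ultimately show ?thesis using c(2) by (simp add: colour_class_def)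
    qed
    have disj: "disjnt (new a) (new b)" if ab: "a < b" "b < ?m" for a b
    proof (rule ccontr)
      assume "\<not> ?thesis"
      then obtain v v' where v: "(v, i) \<in> gs ! a" "(v', i) \<in> gs ! b" "u v (label gs a (v, i)) = u v' (label gs b (v', i))"
        by (auto simp: new_def disjnt_def)
      have a: "a < ?m" using ab by simp
      have r: "v < r" "v' < r" using sub[OF a] sub[OF ab(2)] v by auto
      have "v = v' \<and> label gs a (v, i) = label gs b (v', i)"
        using u[OF r(1) lX(2)[OF a v(1) i] r(2) lX(2)[OF ab(2) v(2) i]] v(3) by auto
      then show False using label_less[OF ab(1) v(1)] by auto
    qed
    have disj': "disjnt (new a) (new b)" if "a < ?m" "b < ?m" "a \<noteq> b" for a b
      using disj[of a b] disj[of b a] that disjnt_sym by (metis linorder_neqE_nat)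
    have ne: "new a \<noteq> {}" if "a < ?m" for a using new[OF that] t by (auto simp: colour_class_def)
    have inj: "inj_on new {..<?m}"
    proof (rule inj_onI, rule ccontr)
      fix a b assume ab: "a \<in> {..<?m}" "b \<in> {..<?m}" "new a = new b" "a \<noteq> b"
      then show False using disj'[of a b] ne[of a] by (auto simp: disjnt_def)
    qed
    have "new ` {..<?m} \<subseteq> colour_class S t col i" using new by auto
    moreover have "pairwise disjnt (new ` {..<?m})" using disj' by (auto simp: pairwise_def)
    moreover have "card (new ` {..<?m}) = ?m" using inj by (simp add: card_image)
    ultimately show ?thesis by (intro exI[of _ "new ` {..<?m}"]) auto
  qed
  moreover have "S \<subseteq> V"
  proof
    fix x assume "x \<in> S"
    then obtain v l where vl: "v < r" "l < ?X v" "x = u v l" by (auto simp: S_def)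
    have "l < ?m" using vl(2) X_le[OF k, of v] by simp
    then show "x \<in> V" using vl uV by simp
  qed
  ultimately show ?thesis using S_fin S_card by blast
qed


lemma colour_class_mono: "S \<subseteq> V \<Longrightarrow> colour_class S t col i \<subseteq> colour_class V t col i"
  by (auto simp: colour_class_def)

lemma pairwise_disjnt_Un:
  assumes "pairwise disjnt A" "pairwise disjnt B" "\<And>x y. x \<in> A \<Longrightarrow> y \<in> B \<Longrightarrow> disjnt x y"
  shows "pairwise disjnt (A \<union> B)"
  using assms by (auto simp: pairwise_def disjnt_sym)

lemma colour_class_Un_disjoint:
  assumes "M \<subseteq> colour_class X t col i" "N \<subseteq> colour_class Y t col i" "X \<inter> Y = {}" "t \<ge> 1"
    and "finite M" "finite N" "pairwise disjnt M" "pairwise disjnt N"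
  shows "M \<union> N \<subseteq> colour_class (X \<union> Y) t col i" "pairwise disjnt (M \<union> N)" "card (M \<union> N) = card M + card N"
proof -
  show "M \<union> N \<subseteq> colour_class (X \<union> Y) t col i"
    using assms(1,2) by (auto simp: colour_class_def)
  have d: "disjnt x y" if "x \<in> M" "y \<in> N" for x y
  proof -
    have "x \<subseteq> X" "y \<subseteq> Y" using that assms(1,2) by (auto simp: colour_class_def)
    then show ?thesis using assms(3) by (auto simp: disjnt_def)
  qed
  show "pairwise disjnt (M \<union> N)" using assms(7,8) d by (rule pairwise_disjnt_Un)
  have "M \<inter> N = {}"
  proof (rule ccontr)
    assume "M \<inter> N \<noteq> {}"
    then obtain x where x: "x \<in> M" "x \<in> N" by blast
    then have "x = {}" using d[OF x] by (auto simp: disjnt_def)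
    then show False using x assms(1,4) by (auto simp: colour_class_def)
  qed
  then show "card (M \<union> N) = card M + card N" using assms(5,6) by (rule card_Un_disjoint[rotated 2])
qed

text \<open>The number \<open>\<sigma>\<close> serves at once as a bound for the density of uncoloured tuples and, through its
inverse, as a lower bound for the number of vertices, so that both can be strengthened by decreasing \<open>\<sigma>\<close>.\<close>

definition counterexample :: "'a set \<Rightarrow> nat \<Rightarrow> nat \<Rightarrow> ('a set \<Rightarrow> nat) \<Rightarrow> nat \<Rightarrow> real \<Rightarrow> bool" where
  "counterexample V t k col q \<sigma> \<longleftrightarrow> finite V \<and> 1 / \<sigma> \<le> real (card V) \<and> q \<ge> 1 \<and>
     (\<forall>i<k. matching_le (colour_class V t col i) (q - 1)) \<and> q * (t - 1 + k) < card V + k \<and>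
     real (card (uncoloured V t k col)) \<le> \<sigma> * real (card V) ^ t"

lemma counterexampleD:
  assumes "counterexample V t k col q \<sigma>"
  shows "finite V" "1 / \<sigma> \<le> real (card V)" "q \<ge> 1" "\<forall>i<k. matching_le (colour_class V t col i) (q - 1)"
    "q * (t - 1 + k) < card V + k" "real (card (uncoloured V t k col)) \<le> \<sigma> * real (card V) ^ t"
  using assms unfolding counterexample_def by simp_all

lemma counterexample_mono:
  assumes c: "counterexample V t k col q \<sigma>" and \<sigma>: "0 < \<sigma>" "\<sigma> \<le> \<sigma>'"
  shows "counterexample V t k col q \<sigma>'"
proof -
  have "1 / \<sigma>' \<le> 1 / \<sigma>" using \<sigma> by (intro divide_left_mono) auto
  moreover have "\<sigma> * real (card V) ^ t \<le> \<sigma>' * real (card V) ^ t" using \<sigma> by (intro mult_right_mono) auto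
  ultimately have "1 / \<sigma>' \<le> real (card V)"
      "real (card (uncoloured V t k col)) \<le> \<sigma>' * real (card V) ^ t"
    using counterexampleD[OF c] by linarith+
  then show ?thesis using counterexampleD[OF c] unfolding counterexample_def by blast
qed

text \<open>Each copy of a gainful pattern that is removed together with its points lowers the number of
sets still required in every colour by \<open>m\<close>, but the number of points by less than
\<open>m * (t - 1 + k)\<close>. After linearly many removals the remaining points outnumber the
asymptotic bound.\<close>

lemma gainful_pattern_rare:
  assumes t: "t \<ge> 1" and k: "k \<ge> 1" and r: "r \<ge> 1" and \<delta>: "0 < \<delta>" "\<delta> \<le> 1"
    and gs: "set gs \<subseteq> \<pi>" "gainful_by t k r gs"
  shows "\<exists>\<sigma>>0. \<forall>(V :: 'a set) col q. counterexample V t k col q \<sigma> \<longrightarrow>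
     real (card {xs \<in> tuples V r. distinct xs \<and> choice_pattern t k col xs = \<pi>}) \<le> \<delta> * real (card V) ^ r"
proof -
  define m where "m = length gs"
  define L where "L = t - 1 + k"
  have m: "m \<ge> 1" using gs(2) by (cases gs) (auto simp: m_def gainful_by_def)
  have L: "L \<ge> 1" using k by (simp add: L_def)
  define \<rho> where "\<rho> = \<delta> ^ (m ^ r)"
  have \<rho>: "0 < \<rho>" "\<rho> \<le> 1" using \<delta> by (auto simp: \<rho>_def power_le_one)
  define c where "c = 2 * real r * real m * (real L * real m)"
  have c: "c \<ge> 2" 
  proof -
    have "1 * 1 * (1 * 1) \<le> real r * real m * (real L * real m)" using r m L by (intro mult_mono) auto
    then show ?thesis by (simp add: c_def)
  qed
  define \<eta> where "\<eta> = \<rho> / (2 * c)"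
  have \<eta>: "\<eta> > 0" using \<rho> c by (simp add: \<eta>_def)
  obtain \<sigma>1 where \<sigma>1: "\<sigma>1 > 0" and AT: "\<forall>(V :: 'a set) F m Q. almost_covered V t k F m \<sigma>1 \<longrightarrow> (\<forall>i<k. m i \<le> Q) \<longrightarrow>
     real (card V) \<le> (real t - 1) * real Q + (\<Sum>i<k. real (m i)) + \<eta> * real (card V)"
    using points_le_of_matching_bounds[OF t \<eta>, of k, where 'a = 'a] by (elim exE conjE) (rule that)
  define K where "K = real ((r * m) ^ 2) + c"
  have K: "K > 0" using c by (simp add: K_def add_nonneg_pos)
  define \<sigma> where "\<sigma> = min (\<sigma>1 / 2 ^ t) (min (\<sigma>1 / 2) (\<rho> / (8 * K)))"
  have \<sigma>: "\<sigma> > 0" "\<sigma> \<le> \<sigma>1 / 2 ^ t" "\<sigma> \<le> \<sigma>1 / 2" "\<sigma> \<le> \<rho> / (8 * K)"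
  proof -
    show "\<sigma> > 0" using \<sigma>1 \<rho> K by (simp add: \<sigma>_def)
    show "\<sigma> \<le> \<sigma>1 / 2 ^ t" unfolding \<sigma>_def by (rule min.cobounded1)
    have le: "\<sigma> \<le> min (\<sigma>1 / 2) (\<rho> / (8 * K))" unfolding \<sigma>_def by (rule min.cobounded2)
    show "\<sigma> \<le> \<sigma>1 / 2" by (rule order_trans[OF le min.cobounded1])
    show "\<sigma> \<le> \<rho> / (8 * K)" by (rule order_trans[OF le min.cobounded2])
  qed
  show ?thesis
  proof (intro exI[of _ \<sigma>] conjI allI impI \<sigma>(1))
    fix V :: "'a set" and col and q :: nat
    assume ce: "counterexample V t k col q \<sigma>"
    note V = counterexampleD(1,2)[OF ce] and q = counterexampleD(3)[OF ce] and small = counterexampleD(4)[OF ce]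
      and qn = counterexampleD(5)[OF ce] and U = counterexampleD(6)[OF ce]
    let ?n = "real (card V)"
    have inv: "1 / x \<le> ?n" if "\<sigma> \<le> x" for x
    proof -
      have "1 / x \<le> 1 / \<sigma>" using that \<sigma>(1) by (intro divide_left_mono) auto
      then show ?thesis using V(2) by linarith
    qed
    have n: "?n > 0" using V(2) \<sigma>(1) by (smt (verit) divide_pos_pos)
    have Kn: "8 * K \<le> \<rho> * ?n" using inv[OF \<sigma>(4)] \<rho> K by (simp add: pos_divide_le_eq mult.commute)
    show "real (card {xs \<in> tuples V r. distinct xs \<and> choice_pattern t k col xs = \<pi>}) \<le> \<delta> * ?n ^ r"
    proof (rule ccontr)
      assume "\<not> ?thesis"
      then have dens: "\<delta> * ?n ^ r \<le> real (card {xs \<in> tuples V r. distinct xs \<and> choice_pattern t k col xs = \<pi>})" by simp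
      \<comment> \<open>disjoint gains can be collected as long as they leave the density of the pattern intact\<close>
      have collect: "\<exists>X. X \<subseteq> V \<and> card X \<le> j * (L * m - 1) \<and>
          (\<forall>i<k. \<exists>N. N \<subseteq> colour_class X t col i \<and> finite N \<and> pairwise disjnt N \<and> card N = j * m)"
        if "K + c * real j < \<rho> * ?n" for j
        using that
      proof (induction j)
        case 0
        show ?case
          by (intro exI[of _ "{}"]) (auto intro: exI[of _ "{}"])
      next
        case (Suc j)
        have "c * real j \<le> c * real (Suc j)" using c by (intro mult_left_mono) auto
        then have "K + c * real j < \<rho> * ?n" using Suc.prems by linarith
        from Suc.IH[OF this] obtain X where X: "X \<subseteq> V" "card X \<le> j * (L * m - 1)"
          "\<forall>i<k. \<exists>N. N \<subseteq> colour_class X t col i \<and> finite N \<and> pairwise disjnt N \<and> card N = j * m" by blast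
        have fX: "finite X" using X(1) V(1) finite_subset by blast
        have "card X \<le> j * (L * m)" using X(2) by (rule order_trans) (intro mult_le_mono2, simp)
        then have "r * m * card X \<le> r * m * (j * (L * m))" by (rule mult_le_mono2)
        then have "real (r * m * card X) \<le> real (r * m * (j * (L * m)))" by (simp only: of_nat_le_iff)
        also have "\<dots> = c * real j / 2" by (simp add: c_def)
        also have "\<dots> \<le> c * real j" using c by simp
        finally have "real ((r * m) ^ 2 * 1 + r * m * card X) \<le> K + c * real j" using c by (simp add: K_def)
        also have "\<dots> < \<delta> ^ (m ^ r) * real (card V)" using \<open>K + c * real j < \<rho> * ?n\<close> by (simp add: \<rho>_def)
        finally have large: "\<delta> ^ (m ^ r) * real (card V) > real ((r * m) ^ 2 * 1 + r * m * card X)" .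
        have deg: "card {u \<in> V. v = u} \<le> 1" if "v \<in> V" for v
        proof -
          have "{u \<in> V. v = u} = {v}" using that by auto
          then show ?thesis by simp
        qed
        obtain u where u: "\<And>j l. j < r \<Longrightarrow> l < m \<Longrightarrow> u j l \<in> V - X"
          "\<And>j l j' l'. \<lbrakk>j < r; l < m; j' < r; l' < m; (j, l) \<noteq> (j', l')\<rbrakk> \<Longrightarrow> \<not> u j l = u j' l'"
          "\<And>f. (\<And>j. j < r \<Longrightarrow> f j < m) \<Longrightarrow> map (\<lambda>j. u j (f j)) [0..<r] \<in> {xs \<in> tuples V r. distinct xs \<and> choice_pattern t k col xs = \<pi>}"
        proof (rule blowup_exists[where R = "(=)", OF V(1) _ _ dens deg X(1) large])
          show "0 \<le> \<delta>" using \<delta> by simp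
          show "{xs \<in> tuples V r. distinct xs \<and> choice_pattern t k col xs = \<pi>} \<subseteq> tuples V r" by blast
        qed (blast+)
        have pat: "choice_pattern t k col (map (\<lambda>j. u j (f j)) [0..<r]) = \<pi>" if "\<And>j. j < r \<Longrightarrow> f j < length gs" for f
          using u(3)[of f] that by (simp add: m_def)
        have "\<exists>S. S \<subseteq> V - X \<and> finite S \<and> card S < (t - 1 + k) * length gs \<and>
           (\<forall>i<k. \<exists>N. N \<subseteq> colour_class S t col i \<and> finite N \<and> pairwise disjnt N \<and> card N = length gs)"
          by (rule gain_of_blowup[OF gs _ _ pat t]) (use u(1,2) k in \<open>auto simp: m_def\<close>)
        then obtain S where S: "S \<subseteq> V - X" "finite S" "card S < L * m"
          "\<forall>i<k. \<exists>N. N \<subseteq> colour_class S t col i \<and> finite N \<and> pairwise disjnt N \<and> card N = m" unfolding L_def m_def by blast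
        show ?case
        proof (intro exI[of _ "X \<union> S"] conjI allI impI)
          show "X \<union> S \<subseteq> V" using X S by blast
          have "card (X \<union> S) \<le> card X + card S" by (rule card_Un_le)
          also have "\<dots> \<le> j * (L * m - 1) + (L * m - 1)" using X(2) S(3) by linarith
          finally show "card (X \<union> S) \<le> Suc j * (L * m - 1)" by simp
        next
          fix i assume i: "i < k"
          obtain M N where M: "M \<subseteq> colour_class X t col i" "finite M" "pairwise disjnt M" "card M = j * m"
            and N: "N \<subseteq> colour_class S t col i" "finite N" "pairwise disjnt N" "card N = m"
            using X(3) S(4) i by meson
          have XS: "X \<inter> S = {}" using S(1) by blast
          note un = colour_class_Un_disjoint[OF M(1) N(1) XS t M(2) N(2) M(3) N(3)]
          show "\<exists>N. N \<subseteq> colour_class (X \<union> S) t col i \<and> finite N \<and> pairwise disjnt N \<and> card N = Suc j * m"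
            using un M N by (intro exI[of _ "M \<union> N"]) auto
        qed
      qed
      define j where "j = nat \<lceil>\<eta> * ?n\<rceil>"
      have j: "\<eta> * ?n \<le> real j" "real j \<le> \<eta> * ?n + 1"
        unfolding j_def using \<eta> n by (auto simp: of_nat_ceiling)
      have cj: "c * real j \<le> \<rho> * ?n / 2 + c"
      proof -
        have "c * real j \<le> c * (\<eta> * ?n + 1)" using j(2) c by (intro mult_left_mono) auto
        also have "\<dots> = \<rho> * ?n / 2 + c" using c by (simp add: \<eta>_def field_simps)
        finally show ?thesis .
      qed
      have cK: "c \<le> K" by (simp add: K_def)
      have "K + c * real j < \<rho> * ?n" using cj cK Kn K by linarith
      from collect[OF this] obtain X where X: "X \<subseteq> V" "card X \<le> j * (L * m - 1)"
          "\<forall>i<k. \<exists>N. N \<subseteq> colour_class X t col i \<and> finite N \<and> pairwise disjnt N \<and> card N = j * m" by blast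
      have fX: "finite X" using X(1) V(1) finite_subset by blast
      let ?W = "V - X"
      have W: "finite ?W" using V by simp
      have cW: "real (card ?W) = ?n - real (card X)"
        using X(1) fX V(1) card_mono[OF V(1) X(1)] by (simp add: card_Diff_subset of_nat_diff)
      have Xj: "real (card X) + real j \<le> real j * (real L * real m)"
      proof -
        have "card X + j \<le> j * (L * m)" using X(2) m L by (cases "L * m") auto
        then have "real (card X + j) \<le> real (j * (L * m))" by (simp only: of_nat_le_iff)
        then show ?thesis by simp
      qed
      have half: "?n / 2 \<le> real (card ?W)"
      proof -
        have rm: "1 \<le> real r * real m" using r m by (metis mult_mono' of_nat_1 of_nat_le_iff mult_1 zero_le_one)
        have "real j * (real L * real m) * 2 \<le> c * real j"
          using mult_right_mono[OF rm, of "real j * (real L * real m) * 2"] by (simp add: c_def mult_ac)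
        also have "\<dots> < \<rho> * ?n" using \<open>K + c * real j < \<rho> * ?n\<close> K by linarith
        also have "\<dots> \<le> 1 * ?n" using \<rho> n by (intro mult_right_mono) auto
        finally have "real (card X) * 2 \<le> ?n" using Xj by linarith
        then show ?thesis using cW by linarith
      qed
      have jm: "j * m \<le> q - 1" and sm: "\<forall>i<k. matching_le (colour_class ?W t col i) (q - 1 - j * m)"
      proof -
        have *: "card M + j * m \<le> q - 1" if i: "i < k" and M: "M \<subseteq> colour_class ?W t col i" "pairwise disjnt M" for M i
        proof -
          obtain N where N: "N \<subseteq> colour_class X t col i" "finite N" "pairwise disjnt N" "card N = j * m" using X(3) i by blast
          have fM: "finite M" by (rule finite_subset[of _ "Pow V"]) (use M V in \<open>auto simp: colour_class_def\<close>)
          have "?W \<inter> X = {}" by blast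
          note un = colour_class_Un_disjoint[OF M(1) N(1) this t fM N(2) M(2) N(3)]
          have "M \<union> N \<subseteq> colour_class V t col i" using un(1) X(1) colour_class_mono[of "?W \<union> X" V] by blast
          then have "card (M \<union> N) \<le> q - 1" using small i un(2) unfolding matching_le_def by blast
          then show ?thesis using un(3) N(4) by simp
        qed
        show "j * m \<le> q - 1" using *[of 0 "{}"] k by simp
        show "\<forall>i<k. matching_le (colour_class ?W t col i) (q - 1 - j * m)"
          unfolding matching_le_def using * by (metis le_diff_conv2 add.commute le_diff_conv add_leD2)
      qed
      have "uncoloured ?W t k col \<subseteq> uncoloured V t k col"
        by (auto simp: uncoloured_def tuples_def colour_class_def)
      moreover have "finite (uncoloured V t k col)" by (simp add: uncoloured_def finite_tuples V(1))
      ultimately have "real (card (uncoloured ?W t k col)) \<le> real (card (uncoloured V t k col))"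
        by (intro of_nat_mono card_mono)
      also have "\<dots> \<le> \<sigma> * ?n ^ t" by (rule U)
      also have "\<dots> \<le> \<sigma>1 / 2 ^ t * ?n ^ t" using \<sigma>(2) by (intro mult_right_mono) auto
      also have "\<dots> = \<sigma>1 * (?n / 2) ^ t" by (simp add: power_divide)
      also have "\<dots> \<le> \<sigma>1 * real (card ?W) ^ t" using half n \<sigma>1 by (intro mult_left_mono power_mono) auto
      finally have U': "real (card {y \<in> tuples ?W t. \<not> (\<exists>i<k. set y \<in> colour_class ?W t col i)}) \<le> \<sigma>1 * real (card ?W) ^ t"
        by (simp add: uncoloured_def)
      have big: "1 / \<sigma>1 \<le> real (card ?W)"
      proof -
        have "1 / (\<sigma>1 / 2) \<le> ?n" by (rule inv[OF \<sigma>(3)])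
        then show ?thesis using half by simp
      qed
      have ac: "almost_covered ?W t k (colour_class ?W t col) (\<lambda>_. q - 1 - j * m) \<sigma>1"
        unfolding almost_covered_def using W big sm U' by (simp add: colour_class_def, blast?)
      have trivial: "\<forall>i<k. (\<lambda>_. q - 1 - j * m) i \<le> q - 1 - j * m" by simp
      have "real (card ?W) \<le> (real t - 1) * real (q - 1 - j * m) + (\<Sum>i<k. real (q - 1 - j * m)) + \<eta> * real (card ?W)"
        using AT[THEN spec, THEN spec, THEN spec, THEN spec, THEN mp, OF ac, THEN mp, OF trivial] .
      also have "(real t - 1) * real (q - 1 - j * m) + (\<Sum>i<k. real (q - 1 - j * m)) = real L * (real q - 1 - real j * real m)"
        using jm q t by (simp add: L_def of_nat_diff algebra_simps)
      finally have fin: "?n - real (card X) \<le> real L * (real q - 1 - real j * real m) + \<eta> * real (card ?W)"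
        by (simp add: cW)
      have "\<eta> * real (card ?W) \<le> \<eta> * ?n" using \<eta> cW by (intro mult_left_mono) auto
      moreover have "real L * real q < ?n + real k"
      proof -
        have "real (q * L) < real (card V + k)" using qn unfolding L_def by (simp only: of_nat_less_iff)
        then show ?thesis by (simp add: mult.commute)
      qed
      moreover have "real k \<le> real L" by (simp add: L_def)
      moreover have "real L * (real q - 1 - real j * real m) = real L * real q - real L - real j * (real L * real m)"
        by (simp add: algebra_simps)
      ultimately show False using fin Xj j(1) by linarith
    qed
  qed
qed

lemma few_gainful_tuples:
  assumes t: "t \<ge> 1" and k: "k \<ge> 1" and r: "r \<ge> 1" and \<delta>: "0 < \<delta>" "\<delta> \<le> 1"
  shows "\<exists>\<sigma>>0. \<forall>(V :: 'a set) col q. counterexample V t k col q \<sigma> \<longrightarrow>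
     real (card {xs \<in> tuples V r. distinct xs \<and> (\<exists>gs. set gs \<subseteq> choice_pattern t k col xs \<and> gainful_by t k r gs)}) \<le> \<delta> * real (card V) ^ r"
proof -
  define P where "P = {\<pi> \<in> Pow (Pow ({..<r} \<times> {..<k})). \<exists>gs. set gs \<subseteq> \<pi> \<and> gainful_by t k r gs}"
  have finP: "finite P" by (simp add: P_def)
  define N where "N = real (card P) + 1"
  have N: "N \<ge> 1" "real (card P) \<le> N" by (auto simp: N_def)
  have \<delta>N: "0 < \<delta> / N" "\<delta> / N \<le> 1" using \<delta> N by (auto simp: divide_le_eq)
  define rare where "rare \<pi> \<sigma> \<longleftrightarrow> (\<forall>(V :: 'a set) col q. counterexample V t k col q \<sigma> \<longrightarrow>
     real (card {xs \<in> tuples V r. distinct xs \<and> choice_pattern t k col xs = \<pi>}) \<le> \<delta> / N * real (card V) ^ r)" for \<pi> and \<sigma> :: real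
  have "\<forall>\<pi>\<in>P. \<exists>\<sigma>. \<sigma> > 0 \<and> rare \<pi> \<sigma>"
  proof
    fix \<pi> assume "\<pi> \<in> P"
    then obtain gs where "set gs \<subseteq> \<pi>" "gainful_by t k r gs" by (auto simp: P_def)
    from gainful_pattern_rare[OF t k r \<delta>N this, where 'a = 'a] show "\<exists>\<sigma>. \<sigma> > 0 \<and> rare \<pi> \<sigma>" unfolding rare_def .
  qed
  from bchoice[OF this] obtain s where s: "\<forall>\<pi>\<in>P. s \<pi> > 0 \<and> rare \<pi> (s \<pi>)" ..
  define \<sigma> where "\<sigma> = Min (insert 1 (s ` P))"
  have \<sigma>: "\<sigma> > 0" unfolding \<sigma>_def using finP s by (subst Min_gr_iff) auto
  have \<sigma>s: "\<sigma> \<le> s \<pi>" if "\<pi> \<in> P" for \<pi> unfolding \<sigma>_def using finP that by (intro Min_le) auto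
  show ?thesis
  proof (intro exI[of _ \<sigma>] conjI allI impI \<sigma>)
    fix V :: "'a set" and col and q :: nat
    assume ce: "counterexample V t k col q \<sigma>"
    note V = counterexampleD(1,2)[OF ce]
    let ?n = "real (card V)"
    let ?A = "\<lambda>\<pi>. {xs \<in> tuples V r. distinct xs \<and> choice_pattern t k col xs = \<pi>}"
    have each: "real (card (?A \<pi>)) \<le> \<delta> / N * ?n ^ r" if "\<pi> \<in> P" for \<pi>
    proof -
      have s1: "rare \<pi> (s \<pi>)" using s that by blast
      from s1[unfolded rare_def, THEN spec, THEN spec, THEN spec, THEN mp, OF counterexample_mono[OF ce \<sigma> \<sigma>s[OF that]]]
      show ?thesis .
    qed
    let ?G = "{xs \<in> tuples V r. distinct xs \<and> (\<exists>gs. set gs \<subseteq> choice_pattern t k col xs \<and> gainful_by t k r gs)}"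
    have "?G \<subseteq> (\<Union>\<pi>\<in>P. ?A \<pi>)"
    proof
      fix xs assume xs: "xs \<in> ?G"
      then have "choice_pattern t k col xs \<in> P" by (auto simp: P_def choice_pattern_def tuples_def)
      then show "xs \<in> (\<Union>\<pi>\<in>P. ?A \<pi>)" using xs by blast
    qed
    then have "card ?G \<le> card (\<Union>\<pi>\<in>P. ?A \<pi>)"
      using finite_tuples[OF V(1)] finP by (intro card_mono) auto
    also have "\<dots> \<le> (\<Sum>\<pi>\<in>P. card (?A \<pi>))" by (rule card_UN_le[OF finP])
    finally have "real (card ?G) \<le> (\<Sum>\<pi>\<in>P. real (card (?A \<pi>)))" by (simp only: of_nat_le_iff flip: of_nat_sum)
    also have "\<dots> \<le> (\<Sum>\<pi>\<in>P. \<delta> / N * ?n ^ r)" by (intro sum_mono each)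
    also have "\<dots> = (card P / N) * (\<delta> * ?n ^ r)" by simp
    also have "\<dots> \<le> 1 * (\<delta> * ?n ^ r)" using N \<delta> by (intro mult_right_mono) auto
    finally show "real (card ?G) \<le> \<delta> * ?n ^ r" by simp
  qed
qed

section \<open>Block structure\<close>

text \<open>The covering inequality over all choices of one set per colour is attained by each star, since the total
weight of its \<open>t - 1 + k\<close> points is \<open>t - 1 + k\<close>. Exchanging the set of one colour in the star thus
shows that every set of colour \<open>i\<close> has at least the weight in \<open>W _ i\<close> of the corresponding set of the star.
Applied to the sets that consist of the centre and one further point, this makes the weighting integral outside
the centre; the second star, with a disjoint centre, does the same for the points of the first centre.\<close>

lemma stars_force_blocks:
  fixes W :: "nat \<Rightarrow> nat \<Rightarrow> real" and c :: "nat set \<Rightarrow> nat"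
  assumes W: "\<And>v i. v < r \<Longrightarrow> i < k \<Longrightarrow> 0 \<le> W v i" "\<And>v. v < r \<Longrightarrow> (\<Sum>i<k. W v i) = 1"
    and choice: "\<And>f. (\<And>i. i < k \<Longrightarrow> f i \<subseteq> {..<r} \<and> card (f i) = t \<and> c (f i) = i) \<Longrightarrow> real (t - 1 + k) \<le> (\<Sum>i<k. \<Sum>v\<in>f i. W v i)"
    and col: "\<And>g. g \<subseteq> {..<r} \<Longrightarrow> card g = t \<Longrightarrow> c g < k"
    and t: "t \<ge> 1"
    and Q: "Q1 \<subseteq> {..<r}" "card Q1 = t - 1" "Q2 \<subseteq> {..<r}" "card Q2 = t - 1" "Q1 \<inter> Q2 = {}"
    and v: "\<And>i. i < k \<Longrightarrow> v i < r \<and> v i \<notin> Q1 \<union> Q2"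
      "\<And>i. i < k \<Longrightarrow> c (insert (v i) Q1) = i" "\<And>i. i < k \<Longrightarrow> c (insert (v i) Q2) = i"
    and e: "e \<subseteq> {..<r}" "card e = t" "e \<inter> Q1 = {}"
  shows "card {u \<in> Q1. c (insert u Q2) = c e} < card {y \<in> e. c (insert y Q1) = c e}"
proof -
  have fin: "finite Q1" "finite Q2" "finite e" using Q e finite_subset by blast+
  have W1: "W u i \<le> 1" if "u < r" "i < k" for u i
  proof -
    have "W u i \<le> (\<Sum>i<k. W u i)" using that W(1) by (intro member_le_sum) auto
    then show ?thesis using W(2)[OF that(1)] by simp
  qed
  \<comment> \<open>each star attains the minimum in the covering inequality\<close>
  have star: "W (v i) i = 1" "real (t - 1 + k) = (\<Sum>i<k. \<Sum>u\<in>insert (v i) Q. W u i)"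
    if i: "i < k" and Q: "Q \<subseteq> {..<r}" "card Q = t - 1" "\<forall>i<k. v i \<notin> Q" "\<forall>i<k. c (insert (v i) Q) = i" for Q i
  proof -
    have fQ: "finite Q" using Q(1) finite_subset by blast
    have "real (t - 1 + k) \<le> (\<Sum>i<k. \<Sum>u\<in>insert (v i) Q. W u i)"
      by (rule choice) (use Q v(1) fQ t in auto)
    also have eq: "(\<Sum>i<k. \<Sum>u\<in>insert (v i) Q. W u i) = (\<Sum>i<k. W (v i) i) + real (t - 1)"
    proof -
      have "(\<Sum>i<k. \<Sum>u\<in>insert (v i) Q. W u i) = (\<Sum>i<k. W (v i) i + (\<Sum>u\<in>Q. W u i))"
        using Q(3) fQ by (intro sum.cong) auto
      also have "\<dots> = (\<Sum>i<k. W (v i) i) + (\<Sum>u\<in>Q. \<Sum>i<k. W u i)"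
        by (simp add: sum.distrib sum.swap[of _ Q])
      also have "(\<Sum>u\<in>Q. \<Sum>i<k. W u i) = (\<Sum>u\<in>Q. 1)" using W(2) Q(1) by (intro sum.cong) auto
      finally show ?thesis using Q(2) by simp
    qed
    finally have ge: "(\<Sum>i<k. 1 - W (v i) i) \<le> 0" by (simp add: sum_subtractf)
    have nn: "\<And>i. i < k \<Longrightarrow> 0 \<le> 1 - W (v i) i" using W1 v(1) by simp
    have "(\<Sum>i<k. 1 - W (v i) i) = 0" using ge sum_nonneg[of "{..<k}" "\<lambda>i. 1 - W (v i) i"] nn by auto
    then have all: "\<forall>i\<in>{..<k}. 1 - W (v i) i = 0" using nn by (subst (asm) sum_nonneg_eq_0_iff) auto
    then show "W (v i) i = 1" using i by simp
    have "(\<Sum>i<k. W (v i) i) = (\<Sum>i<k. 1)" using all by (intro sum.cong) auto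
    then show "real (t - 1 + k) = (\<Sum>i<k. \<Sum>u\<in>insert (v i) Q. W u i)" using eq by simp
  qed
  have ge: "1 + (\<Sum>u\<in>Q. W u (c g)) \<le> (\<Sum>u\<in>g. W u (c g))"
    if g: "g \<subseteq> {..<r}" "card g = t" and Q: "Q \<subseteq> {..<r}" "card Q = t - 1" "\<forall>i<k. v i \<notin> Q" "\<forall>i<k. c (insert (v i) Q) = i" for g Q
  proof -
    have fQ: "finite Q" using Q(1) finite_subset by blast
    define i where "i = c g"
    have i: "i < k" using col[OF g] by (simp add: i_def)
    let ?f0 = "\<lambda>i. insert (v i) Q"
    have "real (t - 1 + k) \<le> (\<Sum>j<k. \<Sum>u\<in>(if j = i then g else ?f0 j). W u j)"
    proof (rule choice)
      fix j assume j: "j < k"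
      show "(if j = i then g else ?f0 j) \<subseteq> {..<r} \<and> card (if j = i then g else ?f0 j) = t \<and> c (if j = i then g else ?f0 j) = j"
        using g Q v(1)[OF j] j fQ t by (auto simp: i_def)
    qed
    also have "\<dots> = (\<Sum>u\<in>g. W u i) + (\<Sum>j\<in>{..<k} - {i}. \<Sum>u\<in>?f0 j. W u j)"
    proof -
      have "(\<Sum>j<k. \<Sum>u\<in>(if j = i then g else ?f0 j). W u j) = (\<Sum>u\<in>g. W u i) + (\<Sum>j\<in>{..<k} - {i}. \<Sum>u\<in>(if j = i then g else ?f0 j). W u j)"
        using i by (subst sum.remove[of _ i]) auto
      also have "(\<Sum>j\<in>{..<k} - {i}. \<Sum>u\<in>(if j = i then g else ?f0 j). W u j) = (\<Sum>j\<in>{..<k} - {i}. \<Sum>u\<in>?f0 j. W u j)"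
        by (intro sum.cong) auto
      finally show ?thesis .
    qed
    finally have 1: "real (t - 1 + k) \<le> (\<Sum>u\<in>g. W u i) + (\<Sum>j\<in>{..<k} - {i}. \<Sum>u\<in>?f0 j. W u j)" .
    have "real (t - 1 + k) = (\<Sum>u\<in>?f0 i. W u i) + (\<Sum>j\<in>{..<k} - {i}. \<Sum>u\<in>?f0 j. W u j)"
      using star(2)[OF i Q] i by (subst (asm) sum.remove[of _ i]) auto
    then have "(\<Sum>u\<in>?f0 i. W u i) \<le> (\<Sum>u\<in>g. W u i)" using 1 by linarith
    moreover have "(\<Sum>u\<in>?f0 i. W u i) = 1 + (\<Sum>u\<in>Q. W u i)" using Q(3) i fQ star(1)[OF i Q] by simp
    ultimately show ?thesis by (simp add: i_def)
  qed
  have Q1: "\<forall>i<k. v i \<notin> Q1" "\<forall>i<k. c (insert (v i) Q1) = i" and Q2: "\<forall>i<k. v i \<notin> Q2" "\<forall>i<k. c (insert (v i) Q2) = i"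
    using v by auto
  have pure: "W u i = (if c (insert u Q) = i then 1 else 0)"
    if u: "u < r" "u \<notin> Q" and i: "i < k" and Q: "Q \<subseteq> {..<r}" "card Q = t - 1" "\<forall>i<k. v i \<notin> Q" "\<forall>i<k. c (insert (v i) Q) = i" for u i Q
  proof -
    have fQ: "finite Q" using Q(1) finite_subset by blast
    let ?g = "insert u Q"
    have g: "?g \<subseteq> {..<r}" "card ?g = t" using u Q fQ t by auto
    let ?j = "c ?g"
    have j: "?j < k" by (rule col[OF g])
    have "W u ?j \<ge> 1" using ge[OF g Q] u fQ by simp
    then have Wj: "W u ?j = 1" using W1[OF u(1) j] by simp
    have "(\<Sum>i<k. W u i) = W u ?j + (\<Sum>i\<in>{..<k} - {?j}. W u i)" using j by (subst sum.remove[of _ ?j]) auto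
    then have "(\<Sum>i\<in>{..<k} - {?j}. W u i) = 0" using W(2)[OF u(1)] Wj by simp
    then have "\<forall>i\<in>{..<k} - {?j}. W u i = 0" using W(1) u by (subst (asm) sum_nonneg_eq_0_iff) auto
    then show ?thesis using Wj i by auto
  qed
  have i: "c e < k" by (rule col[OF e(1,2)])
  have "(\<Sum>u\<in>Q1. W u (c e)) = (\<Sum>u\<in>Q1. if c (insert u Q2) = c e then 1 else 0)"
    using Q(1,5) i by (intro sum.cong refl pure[OF _ _ _ Q(3,4) Q2]) auto
  also have "\<dots> = card {u \<in> Q1. c (insert u Q2) = c e}" using fin by (simp flip: sum.inter_filter)
  finally have 1: "(\<Sum>u\<in>Q1. W u (c e)) = card {u \<in> Q1. c (insert u Q2) = c e}" .
  have "(\<Sum>u\<in>e. W u (c e)) = (\<Sum>u\<in>e. if c (insert u Q1) = c e then 1 else 0)"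
    using e i by (intro sum.cong refl pure[OF _ _ _ Q(1,2) Q1]) auto
  also have "\<dots> = card {u \<in> e. c (insert u Q1) = c e}" using fin by (simp flip: sum.inter_filter)
  finally have 2: "(\<Sum>u\<in>e. W u (c e)) = card {u \<in> e. c (insert u Q1) = c e}" .
  show ?thesis using ge[OF e(1,2) Q(1,2) Q1] 1 2 by linarith
qed

text \<open>The dual of a gain: every point distributes one unit among the colours, and every choice of
one set per colour receives at least \<open>t - 1 + k\<close>.\<close>

lemma cover_if_not_gainful:
  assumes k: "k \<ge> 1" and ng: "\<nexists>gs. set gs \<subseteq> choice_pattern t k col xs \<and> gainful_by t k (length xs) gs"
  obtains W :: "nat \<Rightarrow> nat \<Rightarrow> real" where "\<And>v i. v < length xs \<Longrightarrow> i < k \<Longrightarrow> 0 \<le> W v i"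
    "\<And>v. v < length xs \<Longrightarrow> (\<Sum>i<k. W v i) = 1"
    "\<And>f. (\<And>i. i < k \<Longrightarrow> f i \<subseteq> {..<length xs} \<and> card (f i) = t \<and> col ((!) xs ` f i) = i) \<Longrightarrow> real (t - 1 + k) \<le> (\<Sum>i<k. \<Sum>v\<in>f i. W v i)"
proof -
  let ?r = "length xs"
  let ?E = "choice_pattern t k col xs"
  have finE: "finite ?E" by (rule finite_subset[of _ "Pow ({..<?r} \<times> {..<k})"]) (auto simp: choice_pattern_def)
  have P: "finite {..<?r}" "finite {..<k}" "{..<k} \<noteq> {}" using k by (auto simp: lessThan_empty_iff)
  have "0 \<le> real (t - 1 + k)" by simp
  note cp = cover_or_packing[OF P finE this]
  have nogs: "\<not> (\<exists>gs. set gs \<subseteq> ?E \<and> real (\<Sum>j\<in>{..<?r}. MAX p\<in>{..<k}. card {a. a < length gs \<and> (j, p) \<in> gs ! a}) < real (t - 1 + k) * real (length gs))"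
  proof
    assume "\<exists>gs. set gs \<subseteq> ?E \<and> real (\<Sum>j\<in>{..<?r}. MAX p\<in>{..<k}. card {a. a < length gs \<and> (j, p) \<in> gs ! a}) < real (t - 1 + k) * real (length gs)"
    then obtain gs where gs: "set gs \<subseteq> ?E" "real (\<Sum>j\<in>{..<?r}. MAX p\<in>{..<k}. card {a. a < length gs \<and> (j, p) \<in> gs ! a}) < real (t - 1 + k) * real (length gs)" by blast
    have "gainful_by t k ?r gs" unfolding gainful_by_def
      using gs(2) by (simp only: of_nat_less_iff flip: of_nat_mult)
    then show False using ng gs(1) by blast
  qed
  have "\<exists>w. (\<forall>j\<in>{..<?r}. \<forall>p\<in>{..<k}. 0 \<le> w j p) \<and> (\<forall>j\<in>{..<?r}. (\<Sum>p<k. w j p) = 1)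
         \<and> (\<forall>g\<in>?E. real (t - 1 + k) \<le> (\<Sum>j\<in>{..<?r}. \<Sum>p<k. if (j, p) \<in> g then w j p else (0::real)))"
  proof (rule disjE[OF cp])
    assume "\<exists>gs. set gs \<subseteq> ?E \<and> real (\<Sum>j\<in>{..<?r}. MAX p\<in>{..<k}. card {a. a < length gs \<and> (j, p) \<in> gs ! a}) < real (t - 1 + k) * real (length gs)"
    with nogs show ?thesis by (rule notE)
  qed
  then obtain W where W: "\<forall>j\<in>{..<?r}. \<forall>p\<in>{..<k}. 0 \<le> W j p" "\<forall>j\<in>{..<?r}. (\<Sum>p<k. W j p) = 1"
    "\<forall>g\<in>?E. real (t - 1 + k) \<le> (\<Sum>j\<in>{..<?r}. \<Sum>p<k. if (j, p) \<in> g then W j p else (0::real))" by blast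
  show thesis
  proof (rule that[of W])
    fix f assume f: "\<And>i. i < k \<Longrightarrow> f i \<subseteq> {..<?r} \<and> card (f i) = t \<and> col ((!) xs ` f i) = i"
    define g where "g = {(v, i). i < k \<and> v \<in> f i}"
    have gi: "{v. (v, i) \<in> g} = f i" if "i < k" for i using that by (auto simp: g_def)
    have "g \<in> ?E" using f by (auto simp: choice_pattern_def gi) (auto simp: g_def)
    then have "real (t - 1 + k) \<le> (\<Sum>j<?r. \<Sum>p<k. if (j, p) \<in> g then W j p else 0)" using W(3) by blast
    also have "\<dots> = (\<Sum>p<k. \<Sum>j<?r. if (j, p) \<in> g then W j p else 0)" by (rule sum.swap)
    also have "\<dots> = (\<Sum>i<k. \<Sum>v\<in>f i. W v i)"
    proof (rule sum.cong[OF refl])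
      fix i assume "i \<in> {..<k}"
      then have i: "i < k" by simp
      have "(\<Sum>j<?r. if (j, i) \<in> g then W j i else 0) = (\<Sum>j\<in>{..<?r} \<inter> f i. W j i)"
        using i by (subst sum.inter_restrict) (auto simp: g_def intro!: sum.cong)
      also have "{..<?r} \<inter> f i = f i" using f[OF i] by blast
      finally show "(\<Sum>j<?r. if (j, i) \<in> g then W j i else 0) = (\<Sum>v\<in>f i. W v i)" .
    qed
    finally show "real (t - 1 + k) \<le> (\<Sum>i<k. \<Sum>v\<in>f i. W v i)" .
  qed (use W in auto)
qed

text \<open>Rainbow stars are dense, so stars with all points doubled are dense as well. One of
them extends to a sample without gain by almost every \<open>t\<close>-tuple. Its first copy defines the blocks,
by the colour in which a vertex completes the centre. Its second copy assigns a colour to each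
point of the first centre; these colours form the list \<open>\<tau>\<close>, so the threshold of
colour \<open>i\<close> is one more than the number of occurrences of \<open>i\<close> in \<open>\<tau>\<close>.\<close>

lemma block_structure:
  assumes t: "t \<ge> 1" and k: "k \<ge> 1" and \<delta>: "0 < \<delta>" "\<delta> < 1"
  shows "\<exists>\<sigma>>0. \<forall>(V :: 'a set) col q. counterexample V t k col q \<sigma> \<longrightarrow>
     (\<exists>\<tau> B. length \<tau> = t - 1 \<and> set \<tau> \<subseteq> {..<k} \<and> (\<forall>i. B i \<subseteq> V) \<and> (\<forall>i j. i \<noteq> j \<longrightarrow> B i \<inter> B j = {}) \<and>
        real (card {y \<in> tuples V t. \<not> (distinct y \<and> (\<exists>i<k. set y \<in> colour_class V t col i \<and> count_list \<tau> i < card (set y \<inter> B i)))}) \<le> \<delta> * real (card V) ^ t)"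
proof -
  define L where "L = t - 1 + k"
  define r where "r = L * 2 + t"
  have r: "r \<ge> 1" "t \<le> r" using t by (auto simp: r_def)
  obtain s where s: "s > 0" and star: "\<forall>(V :: 'a set) F m. almost_covered V t k F (\<lambda>_. m) s \<longrightarrow> m * (t - 1 + k) \<le> card V \<longrightarrow>
     real (card (rainbow_stars V t k F)) > s * real (card V) ^ (t - 1 + k)"
    using rainbow_stars_dense[OF t k, where 'a = 'a] by (elim exE conjE) (rule that)
  define s' where "s' = min s 1"
  have s': "s' > 0" "s' \<le> s" "s' \<le> 1" using s by (auto simp: s'_def)
  define s2 where "s2 = s' ^ (2 ^ L)"
  have s2: "s2 > 0" "s2 \<le> 1" using s' by (auto simp: s2_def power_le_one)
  define d where "d = \<delta> * s2 / 4"
  have d: "d > 0" using \<delta> s2 by (simp add: d_def)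
  have d1: "d \<le> 1"
  proof -
    have "\<delta> * s2 \<le> 1 * 1" using \<delta> s2 by (intro mult_mono) auto
    then show ?thesis by (simp add: d_def)
  qed
  obtain g where g: "g > 0" and few: "\<forall>(V :: 'a set) col q. counterexample V t k col q g \<longrightarrow>
     real (card {xs \<in> tuples V r. distinct xs \<and> (\<exists>gs. set gs \<subseteq> choice_pattern t k col xs \<and> gainful_by t k r gs)}) \<le> d * real (card V) ^ r"
    using few_gainful_tuples[OF t k r(1) d d1, where 'a = 'a] by (elim exE conjE) (rule that)
  define R where "R = real r ^ t + real r ^ 2"
  have R: "real r ^ t \<le> R" "real r ^ 2 \<le> R" "R > 0" using r by (auto simp: R_def add_pos_pos)
  define \<sigma> where "\<sigma> = Min {s, g, d / R}"
  have \<sigma>: "\<sigma> > 0" "\<sigma> \<le> s" "\<sigma> \<le> g" "\<sigma> \<le> d / R" using s g d R by (auto simp: \<sigma>_def)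
  show ?thesis
  proof (intro exI[of _ \<sigma>] conjI allI impI \<sigma>(1))
    fix V :: "'a set" and col and q :: nat
    assume ce: "counterexample V t k col q \<sigma>"
    note V = counterexampleD(1,2)[OF ce] and q = counterexampleD(3)[OF ce] and small = counterexampleD(4)[OF ce]
      and qn = counterexampleD(5)[OF ce] and U = counterexampleD(6)[OF ce]
    let ?n = "real (card V)"
    let ?F = "colour_class V t col"
    have n: "?n > 0" using V(2) \<sigma>(1) by (smt (verit) divide_pos_pos)
    have fT: "finite (tuples V x)" for x by (rule finite_tuples[OF V(1)])
    define A where "A = rainbow_stars V t k ?F"
    have A: "A \<subseteq> tuples V L" by (auto simp: A_def rainbow_stars_def L_def)
    have "s * ?n ^ L < real (card A)"
    proof -
      note ce' = counterexampleD[OF counterexample_mono[OF ce \<sigma>(1,2)]]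
      have ac: "almost_covered V t k ?F (\<lambda>_. q - 1) s"
        unfolding almost_covered_def using ce' by (simp add: colour_class_def uncoloured_def, blast?)
      have m: "(q - 1) * (t - 1 + k) \<le> card V"
      proof -
        have "q * (t - 1 + k) = (q - 1) * (t - 1 + k) + (t - 1 + k)" using q by (cases q) auto
        then show ?thesis using qn by linarith
      qed
      show ?thesis unfolding A_def L_def
        using star[THEN spec, THEN spec, THEN spec, THEN mp, OF ac, THEN mp, OF m] .
    qed
    moreover have "s' * ?n ^ L \<le> s * ?n ^ L" using s' by (intro mult_right_mono) auto
    ultimately have "s' * ?n ^ L \<le> card A" by linarith
    then have Adens: "s' \<le> card A / ?n ^ L" using n by (simp add: pos_le_divide_eq)
    define D where "D = {us \<in> tuples (tuples V 2) L. listset (map set us) \<subseteq> A}"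
    have cD: "s2 * ?n ^ (L * 2) \<le> real (card D)"
    proof -
      have "s2 * ?n ^ (L * 2) \<le> (card A / ?n ^ L) ^ (2 ^ L) * ?n ^ (L * 2)"
        unfolding s2_def using Adens s' by (intro mult_right_mono power_mono) auto
      also have "\<dots> \<le> real (card D)"
        using card_blowups_ge[OF V(1) _ A, of 2] n unfolding D_def by force
      finally show ?thesis .
    qed
    have fD: "finite D" unfolding D_def using finite_tuples[OF fT] by simp
    have Dne: "D \<noteq> {}"
    proof
      assume "D = {}"
      then have "s2 * ?n ^ (L * 2) \<le> 0" using cD by simp
      moreover have "0 < s2 * ?n ^ (L * 2)" by (intro mult_pos_pos zero_less_power s2 n)
      ultimately show False by linarith
    qed
    define G0 where "G0 = {xs \<in> tuples V r. \<exists>i<r. \<exists>j<r. i \<noteq> j \<and> xs ! i = xs ! j}"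
    define G1 where "G1 = {xs \<in> tuples V r. \<exists>p. distinct p \<and> length p = t \<and> set p \<subseteq> {..<r} \<and> map ((!) xs) p \<in> uncoloured V t k col}"
    define G2 where "G2 = {xs \<in> tuples V r. distinct xs \<and> (\<exists>gs. set gs \<subseteq> choice_pattern t k col xs \<and> gainful_by t k r gs)}"
    define G where "G = G0 \<union> G1 \<union> G2"
    have Rd: "x * \<sigma> \<le> d" if "x \<le> R" "0 \<le> x" for x
    proof -
      have "x * \<sigma> \<le> R * (d / R)" using that \<sigma> R by (intro mult_mono) auto
      then show ?thesis using R by simp
    qed
    have c0: "real (card G0) \<le> d * ?n ^ r"
    proof -
      have "{u \<in> V. v = u} = {v}" if "v \<in> V" for v using that by auto
      then have "card G0 \<le> r ^ 2 * 1 * card V ^ (r - 1)"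
        unfolding G0_def by (intro card_colliding_tuples_le[OF V(1)]) simp
      then have "real (card G0) \<le> real (r ^ 2 * 1 * card V ^ (r - 1))" by (simp only: of_nat_le_iff)
      also have "\<dots> = real r ^ 2 * 1 * ?n ^ (r - 1)" by simp
      also have "\<dots> \<le> real r ^ 2 * (\<sigma> * ?n) * ?n ^ (r - 1)"
      proof -
        have "1 \<le> \<sigma> * ?n" using V(2) \<sigma>(1) by (simp add: pos_divide_le_eq mult.commute)
        then show ?thesis by (intro mult_right_mono mult_left_mono) auto
      qed
      also have "\<dots> = (real r ^ 2 * \<sigma>) * ?n ^ Suc (r - 1)" by (simp only: power_Suc mult_ac)
      also have "\<dots> \<le> d * ?n ^ Suc (r - 1)" using Rd[OF R(2)] by (intro mult_right_mono) auto
      finally show ?thesis using r by simp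
    qed
    have c1: "real (card G1) \<le> d * ?n ^ r"
    proof -
      have "card G1 \<le> r ^ t * (card (uncoloured V t k col) * card V ^ (r - t))"
        unfolding G1_def by (rule card_containing_subtuple_le[OF V(1)]) (simp add: uncoloured_def fT)
      then have "real (card G1) \<le> real (r ^ t * (card (uncoloured V t k col) * card V ^ (r - t)))" by (simp only: of_nat_le_iff)
      also have "\<dots> = real r ^ t * (real (card (uncoloured V t k col)) * ?n ^ (r - t))" by simp
      also have "\<dots> \<le> real r ^ t * ((\<sigma> * ?n ^ t) * ?n ^ (r - t))"
        using U by (intro mult_left_mono mult_right_mono) auto
      also have "\<dots> = (real r ^ t * \<sigma>) * ?n ^ (t + (r - t))" by (simp only: power_add mult_ac)
      also have "\<dots> \<le> d * ?n ^ (t + (r - t))" using Rd[OF R(1)] by (intro mult_right_mono) auto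
      finally show ?thesis using r by simp
    qed
    have c2: "real (card G2) \<le> d * ?n ^ r" unfolding G2_def
      using few[THEN spec, THEN spec, THEN spec, THEN mp, OF counterexample_mono[OF ce \<sigma>(1,3)]] .
    have cG: "real (card G) < \<delta> * s2 * ?n ^ r"
    proof -
      have "card G \<le> card G0 + card G1 + card G2" unfolding G_def
        using card_Un_le[of G0 G1] card_Un_le[of "G0 \<union> G1" G2] by linarith
      then have "real (card G) \<le> 3 * (d * ?n ^ r)" using c0 c1 c2 by linarith
      also have "\<dots> < 4 * (d * ?n ^ r)" using d n by simp
      finally show ?thesis by (simp add: d_def)
    qed
    have fG: "finite G" by (auto simp: G_def G0_def G1_def G2_def fT)
    define bad where "bad us = {y \<in> tuples V t. flat_tuple 2 us @ y \<in> G}" for us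
    have fbad: "finite (bad us)" for us unfolding bad_def using fT by simp
    have "\<exists>us\<in>D. real (card (bad us)) \<le> \<delta> * ?n ^ t"
    proof (rule ccontr)
      assume "\<not> ?thesis"
      then have gt: "\<And>us. us \<in> D \<Longrightarrow> \<delta> * ?n ^ t \<le> real (card (bad us))" by force
      have inj: "inj_on (\<lambda>(us, y). flat_tuple 2 us @ y) (SIGMA us:D. bad us)"
      proof (rule inj_onI, clarify)
        fix us y vs z assume *: "us \<in> D" "y \<in> bad us" "vs \<in> D" "z \<in> bad vs" "flat_tuple 2 us @ y = flat_tuple 2 vs @ z"
        have uv: "us \<in> tuples (tuples V 2) L" "vs \<in> tuples (tuples V 2) L" using * by (auto simp: D_def)
        have "length (flat_tuple 2 us) = length (flat_tuple 2 vs)"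
          using flat_tuple_in_tuples[OF uv(1)] flat_tuple_in_tuples[OF uv(2)] by (simp add: tuples_def)
        then have "flat_tuple 2 us = flat_tuple 2 vs" "y = z" using *(5) by auto
        then show "us = vs \<and> y = z" using inj_on_flat_tuple[of 2 V L] uv by (auto dest: inj_onD)
      qed
      have "\<delta> * s2 * ?n ^ r = (s2 * ?n ^ (L * 2)) * (\<delta> * ?n ^ t)" by (simp add: r_def power_add)
      also have "\<dots> \<le> real (card D) * (\<delta> * ?n ^ t)" using cD \<delta> by (intro mult_right_mono) auto
      also have "\<dots> = (\<Sum>us\<in>D. \<delta> * ?n ^ t)" by simp
      also have "\<dots> \<le> (\<Sum>us\<in>D. real (card (bad us)))" by (intro sum_mono gt)
      also have "\<dots> = real (card (SIGMA us:D. bad us))" using fD fbad by (simp add: card_SigmaI)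
      also have "\<dots> = real (card ((\<lambda>(us, y). flat_tuple 2 us @ y) ` (SIGMA us:D. bad us)))" using inj by (simp add: card_image)
      also have "\<dots> \<le> real (card G)" by (intro of_nat_mono card_mono fG) (auto simp: bad_def)
      finally show False using cG by linarith
    qed
    then obtain us where us: "us \<in> tuples (tuples V 2) L" "listset (map set us) \<subseteq> A" "real (card (bad us)) \<le> \<delta> * ?n ^ t"
      by (auto simp: D_def)
    have len: "length us = L" using us(1) by (simp add: tuples_def)
    have us2: "us ! j \<in> tuples V 2" if "j < L" for j using tuples_nth[OF us(1) that] .
    define q1 where "q1 j = us ! j ! 0" for j
    define q2 where "q2 j = us ! j ! 1" for j
    define vv where "vv i = us ! (t - 1 + i) ! 0" for i
    have st: "map (\<lambda>j. us ! j ! f j) [0..<L] \<in> A" if "\<And>j. f j < 2" for f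
    proof -
      have "map (\<lambda>j. us ! j ! f j) [0..<L] \<in> listset (map set us)"
        using that len us2 by (intro map_in_listset) (auto simp: tuples_def)
      then show ?thesis using us(2) by blast
    qed
    have star1: "insert (vv i) (q1 ` {..<t - 1}) \<in> ?F i" if i: "i < k" for i
    proof -
      have "map (\<lambda>j. us ! j ! 0) [0..<L] \<in> A" using st[of "\<lambda>_. 0"] by simp
      then have "insert (map (\<lambda>j. us ! j ! 0) [0..<L] ! (t - 1 + i)) ((!) (map (\<lambda>j. us ! j ! 0) [0..<L]) ` {..<t - 1}) \<in> ?F i"
        using i by (simp add: A_def rainbow_stars_def)
      moreover have "map (\<lambda>j. us ! j ! 0) [0..<L] ! (t - 1 + i) = vv i" using i by (simp add: vv_def L_def)
      moreover have "(!) (map (\<lambda>j. us ! j ! 0) [0..<L]) ` {..<t - 1} = q1 ` {..<t - 1}"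
        by (intro image_cong) (auto simp: q1_def L_def)
      ultimately show ?thesis by simp
    qed
    have star2: "insert (vv i) (q2 ` {..<t - 1}) \<in> ?F i" if i: "i < k" for i
    proof -
      let ?f = "\<lambda>j. if j < t - 1 then 1 else 0 :: nat"
      have "map (\<lambda>j. us ! j ! ?f j) [0..<L] \<in> A" by (rule st) simp
      then have "insert (map (\<lambda>j. us ! j ! ?f j) [0..<L] ! (t - 1 + i)) ((!) (map (\<lambda>j. us ! j ! ?f j) [0..<L]) ` {..<t - 1}) \<in> ?F i"
        using i by (simp add: A_def rainbow_stars_def)
      moreover have "map (\<lambda>j. us ! j ! ?f j) [0..<L] ! (t - 1 + i) = vv i" using i by (simp add: vv_def L_def)
      moreover have "(!) (map (\<lambda>j. us ! j ! ?f j) [0..<L]) ` {..<t - 1} = q2 ` {..<t - 1}"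
        by (intro image_cong) (auto simp: q2_def L_def)
      ultimately show ?thesis by simp
    qed
    define \<tau> where "\<tau> = map (\<lambda>j. col (insert (q1 j) (q2 ` {..<t - 1}))) [0..<t - 1]"
    define B where "B i = {x \<in> V. col (insert x (q1 ` {..<t - 1})) = i}" for i
    have good: "set \<tau> \<subseteq> {..<k} \<and> distinct y \<and> (\<exists>i<k. set y \<in> ?F i \<and> count_list \<tau> i < card (set y \<inter> B i))"
      if y: "y \<in> tuples V t" "y \<notin> bad us" for y
    proof -
      define xs where "xs = flat_tuple 2 us @ y"
      have lf: "length (flat_tuple 2 us) = L * 2" by (simp add: flat_tuple_def len)
      have ly: "length y = t" using y by (simp add: tuples_def)
      have xT: "xs \<in> tuples V r" using flat_tuple_in_tuples[OF us(1)] y(1) by (auto simp: xs_def tuples_def r_def)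
      have lx: "length xs = r" using xT by (simp add: tuples_def)
      have xG: "xs \<notin> G" using y by (simp add: bad_def xs_def)
      have dx: "distinct xs" using xG xT by (auto simp: G_def G0_def tuples_def distinct_conv_nth)
      have nthf: "xs ! (j * 2 + h) = us ! j ! h" if "j < L" "h < 2" for j h
        using nth_flat_tuple[of j us h 2] that len lf flat_tuple_index[of j L h 2] by (simp add: xs_def nth_append)
      have nthy: "xs ! (L * 2 + l) = y ! l" for l using lf by (simp add: xs_def nth_append)
      let ?c = "\<lambda>g. col ((!) xs ` g)"
      have colx: "(!) xs ` p \<in> ?F (?c p) \<and> ?c p < k" if p: "p \<subseteq> {..<r}" "card p = t" for p
      proof -
        have "finite p" using p(1) finite_subset by blast
        then obtain ps where ps: "set ps = p" "distinct ps" using finite_distinct_list by blast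
        then have lps: "length ps = t" using p(2) distinct_card by force
        have "map ((!) xs) ps \<notin> uncoloured V t k col" using xG xT ps p(1) lps unfolding G_def G1_def by blast
        moreover have "map ((!) xs) ps \<in> tuples V t" using tuples_nth[OF xT] ps p(1) lps by (auto simp: tuples_def)
        ultimately show ?thesis using ps(1) by (auto simp: uncoloured_def colour_class_def)
      qed
      have "\<nexists>gs. set gs \<subseteq> choice_pattern t k col xs \<and> gainful_by t k (length xs) gs"
        using xG xT dx unfolding G_def G2_def lx by blast
      then obtain W :: "nat \<Rightarrow> nat \<Rightarrow> real" where W: "\<And>v i. v < r \<Longrightarrow> i < k \<Longrightarrow> 0 \<le> W v i"
        "\<And>v. v < r \<Longrightarrow> (\<Sum>i<k. W v i) = 1"
        "\<And>f. (\<And>i. i < k \<Longrightarrow> f i \<subseteq> {..<r} \<and> card (f i) = t \<and> ?c (f i) = i) \<Longrightarrow> real (t - 1 + k) \<le> (\<Sum>i<k. \<Sum>v\<in>f i. W v i)"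
        using cover_if_not_gainful[OF k, of t col xs] unfolding lx by blast
      define Q1 where "Q1 = (\<lambda>j. j * 2 + 0) ` {..<t - 1}"
      define Q2 where "Q2 = (\<lambda>j. j * 2 + 1) ` {..<t - 1}"
      define v where "v i = (t - 1 + i) * 2 + 0" for i
      define e where "e = (\<lambda>l. L * 2 + l) ` {..<t}"
      have tL: "j < L" if "j < t - 1" for j using that by (simp add: L_def)
      have pos: "j * 2 + h < r" if "j < L" "h < 2" for j h using flat_tuple_index[OF that] by (simp add: r_def)
      have Q1: "Q1 \<subseteq> {..<r}" "card Q1 = t - 1" "(!) xs ` Q1 = q1 ` {..<t - 1}"
      proof -
        show "Q1 \<subseteq> {..<r}" using pos tL by (force simp: Q1_def)
        show "card Q1 = t - 1" by (simp add: Q1_def card_image inj_on_def)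
        show "(!) xs ` Q1 = q1 ` {..<t - 1}" unfolding Q1_def image_image
          by (intro image_cong refl) (use nthf[of _ 0] tL in \<open>auto simp: q1_def\<close>)
      qed
      have Q2: "Q2 \<subseteq> {..<r}" "card Q2 = t - 1" "(!) xs ` Q2 = q2 ` {..<t - 1}"
      proof -
        show "Q2 \<subseteq> {..<r}" using pos[of _ 1] tL by (force simp: Q2_def)
        show "card Q2 = t - 1" by (simp add: Q2_def card_image inj_on_def)
        show "(!) xs ` Q2 = q2 ` {..<t - 1}" unfolding Q2_def image_image
          by (intro image_cong refl) (use nthf[of _ 1] tL in \<open>auto simp: q2_def\<close>)
      qed
      have Q12: "Q1 \<inter> Q2 = {}"
      proof -
        have "even x" if "x \<in> Q1" for x using that by (auto simp: Q1_def)
        moreover have "odd x" if "x \<in> Q2" for x using that by (auto simp: Q2_def)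
        ultimately show ?thesis by blast
      qed
      have xv: "xs ! v i = vv i" "v i < r" if "i < k" for i
        using nthf[of "t - 1 + i" 0] pos[of "t - 1 + i" 0] that by (auto simp: v_def vv_def L_def)
      have vQ: "v i \<notin> Q1 \<union> Q2" if "i < k" for i
      proof -
        have "v i \<notin> Q1" by (auto simp: v_def Q1_def)
        moreover have "odd x" if "x \<in> Q2" for x using that by (auto simp: Q2_def)
        then have "v i \<notin> Q2" by (force simp: v_def)
        ultimately show ?thesis by blast
      qed
      have e: "e \<subseteq> {..<r}" "card e = t" "(!) xs ` e = set y"
      proof -
        show "e \<subseteq> {..<r}" by (auto simp: e_def r_def)
        show "card e = t" by (simp add: e_def card_image inj_on_def)
        show "(!) xs ` e = set y" unfolding e_def image_image nthy using ly by (auto simp: set_conv_nth)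
      qed
      have Q1_lt: "x < L * 2" if "x \<in> Q1" for x using that flat_tuple_index[OF tL, of _ 0 2] by (auto simp: Q1_def)
      then have eQ: "e \<inter> Q1 = {}" by (force simp: e_def)
      have "card {u \<in> Q1. ?c (insert u Q2) = ?c e} < card {y \<in> e. ?c (insert y Q1) = ?c e}"
      proof (rule stars_force_blocks[where W = W and v = v, OF W _ t Q1(1,2) Q2(1,2) Q12 _ _ _ e(1,2) eQ])
        show "?c (insert (v i) Q1) = i" "?c (insert (v i) Q2) = i" if "i < k" for i
          using star1[OF that] star2[OF that] Q1(3) Q2(3) xv[OF that] by (auto simp: colour_class_def)
      qed (use colx xv vQ in auto)
      moreover have "card {u \<in> Q1. ?c (insert u Q2) = ?c e} = count_list \<tau> (col (set y))"
      proof -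
        have "{u \<in> Q1. ?c (insert u Q2) = ?c e} = (\<lambda>j. j * 2 + 0) ` {j. j < t - 1 \<and> \<tau> ! j = col (set y)}"
          using nthf[of _ 0] tL by (auto simp: Q1_def \<tau>_def q1_def e(3) Q2(3))
        then have "card {u \<in> Q1. ?c (insert u Q2) = ?c e} = card {j. j < t - 1 \<and> \<tau> ! j = col (set y)}"
          by (simp add: card_image inj_on_def)
        also have "\<dots> = length (filter (\<lambda>x. x = col (set y)) \<tau>)" by (simp add: length_filter_conv_card \<tau>_def)
        also have "\<dots> = count_list \<tau> (col (set y))" 
          unfolding count_list_eq_length_filter by (intro arg_cong[where f = length] filter_cong) auto
        finally show ?thesis .
      qed
      moreover have "card {y \<in> e. ?c (insert y Q1) = ?c e} \<le> card (set y \<inter> B (col (set y)))"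
      proof (rule card_inj_on_le)
        show "inj_on ((!) xs) {y \<in> e. ?c (insert y Q1) = ?c e}"
          by (rule inj_on_nth[OF dx]) (use e(1) lx in auto)
        show "(!) xs ` {y \<in> e. ?c (insert y Q1) = ?c e} \<subseteq> set y \<inter> B (col (set y))"
          using e tuples_nth[OF xT] by (auto simp: B_def Q1(3))
      qed simp
      ultimately have cnt: "count_list \<tau> (col (set y)) < card (set y \<inter> B (col (set y)))" by linarith
      have "set \<tau> \<subseteq> {..<k}"
      proof
        fix x assume "x \<in> set \<tau>"
        then obtain j where j: "j < t - 1" "x = col (insert (q1 j) (q2 ` {..<t - 1}))" by (auto simp: \<tau>_def)
        have jQ: "j * 2 \<notin> Q2"
        proof -
          have "odd x" if "x \<in> Q2" for x using that by (auto simp: Q2_def)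
          then show ?thesis by force
        qed
        have "finite Q2" by (simp add: Q2_def)
        then have "?c (insert (j * 2) Q2) < k"
          using colx[of "insert (j * 2) Q2"] Q2(1,2) jQ pos[OF tL[OF j(1)], of 0] t by simp
        moreover have "?c (insert (j * 2) Q2) = x" using j nthf[OF tL[OF j(1)], of 0] by (simp add: Q2(3) q1_def)
        ultimately show "x \<in> {..<k}" by simp
      qed
      moreover have "distinct y" using dx by (simp add: xs_def)
      moreover have "set y \<in> ?F (col (set y)) \<and> col (set y) < k" using colx[OF e(1,2)] by (simp add: e(3))
      ultimately show ?thesis using cnt by blast
    qed
    show "\<exists>\<tau> B. length \<tau> = t - 1 \<and> set \<tau> \<subseteq> {..<k} \<and> (\<forall>i. B i \<subseteq> V) \<and> (\<forall>i j. i \<noteq> j \<longrightarrow> B i \<inter> B j = {}) \<and>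
        real (card {y \<in> tuples V t. \<not> (distinct y \<and> (\<exists>i<k. set y \<in> colour_class V t col i \<and> count_list \<tau> i < card (set y \<inter> B i)))}) \<le> \<delta> * ?n ^ t"
    proof (intro exI[of _ \<tau>] exI[of _ B] conjI)
      show "length \<tau> = t - 1" by (simp add: \<tau>_def)
      show "\<forall>i. B i \<subseteq> V" "\<forall>i j. i \<noteq> j \<longrightarrow> B i \<inter> B j = {}" by (auto simp: B_def)
      have "{y \<in> tuples V t. \<not> (distinct y \<and> (\<exists>i<k. set y \<in> colour_class V t col i \<and> count_list \<tau> i < card (set y \<inter> B i)))} \<subseteq> bad us"
        using good by blast
      then show "real (card {y \<in> tuples V t. \<not> (distinct y \<and> (\<exists>i<k. set y \<in> colour_class V t col i \<and> count_list \<tau> i < card (set y \<inter> B i)))}) \<le> \<delta> * ?n ^ t"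
        using us(3) card_mono[OF fbad] by (meson of_nat_mono order_trans)
      have "bad us \<noteq> tuples V t"
      proof
        assume "bad us = tuples V t"
        then have "real (card (bad us)) = ?n ^ t" by (simp add: card_tuples V)
        moreover have "\<delta> * ?n ^ t < 1 * ?n ^ t" using \<delta> n by (intro mult_strict_right_mono) auto
        ultimately show False using us(3) by simp
      qed
      then obtain y where "y \<in> tuples V t" "y \<notin> bad us" by (auto simp: bad_def)
      then show "set \<tau> \<subseteq> {..<k}" using good by blast
    qed
  qed
qed

section \<open>Completing a matching\<close>

lemma greedy_disjoint_tuples:
  assumes V: "finite V" and Z: "finite Z" "card Z \<le> N"
    and Y: "\<And>v. v \<in> Z \<Longrightarrow> Y v \<subseteq> tuples V s" "\<And>v. v \<in> Z \<Longrightarrow> s * (N * s) * card V ^ (s - 1) < card (Y v)"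
  shows "\<exists>f. (\<forall>v\<in>Z. f v \<in> Y v) \<and> (\<forall>u\<in>Z. \<forall>v\<in>Z. u \<noteq> v \<longrightarrow> set (f u) \<inter> set (f v) = {})"
  using Z Y
proof (induction Z rule: finite_induct)
  case empty then show ?case by simp
next
  case (insert x Z)
  have "card Z \<le> N" using insert.hyps insert.prems(1) by simp
  then have "\<exists>f. (\<forall>v\<in>Z. f v \<in> Y v) \<and> (\<forall>u\<in>Z. \<forall>v\<in>Z. u \<noteq> v \<longrightarrow> set (f u) \<inter> set (f v) = {})"
    by (rule insert.IH) (use insert.prems(2,3) in auto)
  then obtain f where f: "\<And>v. v \<in> Z \<Longrightarrow> f v \<in> Y v"
    "\<And>u v. u \<in> Z \<Longrightarrow> v \<in> Z \<Longrightarrow> u \<noteq> v \<Longrightarrow> set (f u) \<inter> set (f v) = {}" by blast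
  define X where "X = (\<Union>v\<in>Z. set (f v))"
  have fX: "finite X" using insert.hyps by (simp add: X_def)
  have "card X \<le> (\<Sum>v\<in>Z. card (set (f v)))" unfolding X_def using insert.hyps by (intro card_UN_le)
  also have "\<dots> \<le> (\<Sum>v\<in>Z. s)"
  proof (rule sum_mono)
    fix v assume "v \<in> Z"
    then have "f v \<in> tuples V s" using f(1) insert.prems(2) by blast
    then show "card (set (f v)) \<le> s" using card_length[of "f v"] by (simp add: tuples_def)
  qed
  also have "\<dots> \<le> N * s" using \<open>card Z \<le> N\<close> by simp
  finally have cX: "card X \<le> N * s" .
  have "\<not> Y x \<subseteq> {xs \<in> tuples V s. set xs \<inter> X \<noteq> {}}"
  proof
    assume "Y x \<subseteq> {xs \<in> tuples V s. set xs \<inter> X \<noteq> {}}"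
    then have "card (Y x) \<le> card {xs \<in> tuples V s. set xs \<inter> X \<noteq> {}}"
      using finite_tuples[OF V, of s] by (intro card_mono) auto
    also have "\<dots> \<le> s * card X * card V ^ (s - 1)" by (rule card_hitting_tuples_le[OF V fX])
    also have "\<dots> \<le> s * (N * s) * card V ^ (s - 1)" using cX by (intro mult_le_mono) auto
    finally show False using insert.prems(3)[of x] by simp
  qed
  then obtain y where y: "y \<in> Y x" "set y \<inter> X = {}" using insert.prems(2)[of x] by blast
  show ?case
  proof (intro exI[of _ "f(x := y)"] conjI ballI impI)
    fix v assume "v \<in> insert x Z"
    then show "(f(x := y)) v \<in> Y v" using f(1) y(1) by auto
  next
    fix u v assume uv: "u \<in> insert x Z" "v \<in> insert x Z" "u \<noteq> v"
    then show "set ((f(x := y)) u) \<inter> set ((f(x := y)) v) = {}"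
      using f(2)[of u v] y(2) by (auto simp: X_def)
  qed
qed

lemma disjoint_parts:
  assumes "\<And>j. finite (S j)" "\<And>i j. i \<noteq> j \<Longrightarrow> S i \<inter> S j = {}"
    and "\<And>j. count_list \<sigma> j * m \<le> card (S j)"
  shows "\<exists>Us. length Us = length \<sigma> \<and> (\<forall>c<length \<sigma>. Us ! c \<subseteq> S (\<sigma> ! c) \<and> card (Us ! c) = m) \<and>
     (\<forall>c<length \<sigma>. \<forall>c'<length \<sigma>. c \<noteq> c' \<longrightarrow> Us ! c \<inter> Us ! c' = {})"
  using assms
proof (induction \<sigma> arbitrary: S)
  case Nil then show ?case by simp
next
  case (Cons j \<sigma>)
  have "m \<le> card (S j)" using Cons.prems(3)[of j] by simp
  then obtain U where U: "U \<subseteq> S j" "card U = m" "finite U" using obtain_subset_with_card_n by metis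
  define S' where "S' = S(j := S j - U)"
  have sub: "S' i \<subseteq> S i" "S' i \<inter> U = {}" for i
    using Cons.prems(2)[of i j] U(1) by (auto simp: S'_def)
  have "\<exists>Us. length Us = length \<sigma> \<and> (\<forall>c<length \<sigma>. Us ! c \<subseteq> S' (\<sigma> ! c) \<and> card (Us ! c) = m) \<and>
     (\<forall>c<length \<sigma>. \<forall>c'<length \<sigma>. c \<noteq> c' \<longrightarrow> Us ! c \<inter> Us ! c' = {})"
  proof (rule Cons.IH)
    fix i show "finite (S' i)" using Cons.prems(1) sub(1) finite_subset by blast
  next
    fix i i' :: 'a assume "i \<noteq> i'"
    then show "S' i \<inter> S' i' = {}" using Cons.prems(2) sub(1) by blast
  next
    fix i
    show "count_list \<sigma> i * m \<le> card (S' i)"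
      using Cons.prems(3)[of i] U Cons.prems(1) by (auto simp: S'_def card_Diff_subset split: if_splits)
  qed
  then obtain Us where Us: "length Us = length \<sigma>" "\<And>c. c < length \<sigma> \<Longrightarrow> Us ! c \<subseteq> S' (\<sigma> ! c) \<and> card (Us ! c) = m"
     "\<And>c c'. c < length \<sigma> \<Longrightarrow> c' < length \<sigma> \<Longrightarrow> c \<noteq> c' \<Longrightarrow> Us ! c \<inter> Us ! c' = {}" by blast
  have UU: "U \<inter> Us ! c = {}" if "c < length \<sigma>" for c using Us(2)[OF that] sub(2) by blast
  show ?case
  proof (intro exI[of _ "U # Us"] conjI allI impI)
    show "length (U # Us) = length (j # \<sigma>)" using Us(1) by simp
  next
    fix c assume "c < length (j # \<sigma>)"
    then show "(U # Us) ! c \<subseteq> S ((j # \<sigma>) ! c)" "card ((U # Us) ! c) = m"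
      using U Us(2) sub(1) by (cases c; fastforce)+
  next
    fix c c' assume "c < length (j # \<sigma>)" "c' < length (j # \<sigma>)" "c \<noteq> c'"
    then show "(U # Us) ! c \<inter> (U # Us) ! c' = {}"
      using Us(3) UU by (cases c; cases c') (auto simp: Int_commute)
  qed
qed

lemma card_Int_typed_tuple:
  assumes "length y = length \<sigma>" "distinct y" "\<And>c. c < length \<sigma> \<Longrightarrow> y ! c \<in> B (\<sigma> ! c)"
    and "\<And>i j. i \<noteq> j \<Longrightarrow> B i \<inter> B j = {}"
  shows "card (set y \<inter> B j) = count_list \<sigma> j"
proof -
  have "set y \<inter> B j = (!) y ` {c. c < length \<sigma> \<and> \<sigma> ! c = j}"
  proof (intro set_eqI iffI)
    fix x assume x: "x \<in> set y \<inter> B j"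
    then obtain c where c: "c < length y" "y ! c = x" by (auto simp: in_set_conv_nth)
    then have "x \<in> B (\<sigma> ! c)" using assms(1,3) by auto
    then have "\<sigma> ! c = j" using assms(4)[of "\<sigma> ! c" j] x by blast
    then show "x \<in> (!) y ` {c. c < length \<sigma> \<and> \<sigma> ! c = j}" using c assms(1) by auto
  qed (use assms(1,3) in auto)
  also have "card \<dots> = card {c. c < length \<sigma> \<and> \<sigma> ! c = j}"
    by (rule card_image, rule inj_on_nth[OF assms(2)]) (use assms(1) in auto)
  also have "\<dots> = length (filter (\<lambda>x. x = j) \<sigma>)" by (simp add: length_filter_conv_card)
  also have "\<dots> = count_list \<sigma> j"
    unfolding count_list_eq_length_filter by (intro arg_cong[where f = length] filter_cong) auto
  finally show ?thesis .
qed

text \<open>Rows are transversals. A bad row is repaired by choosing \<open>t - 1\<close> further rows and shifting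
the columns of these \<open>t\<close> rows cyclically against each other. Each new row contains exactly one entry of the
bad row, and few transversals through that entry are bad; so some choice makes all new rows good.\<close>

lemma perfect_matching_by_swaps:
  fixes Us :: "'a set list" and Bad :: "'a list set"
  assumes len: "length Us = t" and t: "t \<ge> 1"
    and Us: "\<And>c. c < t \<Longrightarrow> finite (Us ! c) \<and> card (Us ! c) = m"
    and bad: "\<And>c u. c < t \<Longrightarrow> u \<in> Us ! c \<Longrightarrow> real (card {y \<in> listset Us. y \<in> Bad \<and> y ! c = u}) \<le> \<theta>"
    and small: "real t * \<theta> + real (t * (t - 1) * m ^ (t - 1 - 1)) < real (m ^ (t - 1))"
  shows "\<exists>A. (\<forall>c<t. bij_betw (A c) {..<m} (Us ! c)) \<and> (\<forall>\<rho><m. map (\<lambda>c. A c \<rho>) [0..<t] \<notin> Bad)"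
proof -
  let ?row = "\<lambda>A \<rho>. map (\<lambda>c. A c \<rho>) [0..<t]"
  have improve: "\<exists>A. (\<forall>c<t. bij_betw (A c) {..<m} (Us ! c)) \<and> (\<forall>\<rho><m. ?row A \<rho> \<notin> Bad)"
    if "\<forall>c<t. bij_betw (A c) {..<m} (Us ! c)" for A :: "nat \<Rightarrow> nat \<Rightarrow> 'a"
    using that
  proof (induction "card {\<rho>. \<rho> < m \<and> ?row A \<rho> \<in> Bad}" arbitrary: A rule: less_induct)
    case less
    note A = less.prems[rule_format]
    show ?case
    proof (cases "\<exists>R<m. ?row A R \<in> Bad")
      case False then show ?thesis using less.prems by blast
    next
      case True
      then obtain R where R: "R < m" "?row A R \<in> Bad" by blast
      define P where "P \<rho>s = R # \<rho>s" for \<rho>s :: "nat list"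
      define new where "new \<rho>s s = map (\<lambda>c. A c (P \<rho>s ! ((s + c) mod t))) [0..<t]" for \<rho>s s
      let ?T = "tuples {..<m} (t - 1)"
      have lP: "length (P \<rho>s) = t" "\<And>x. x < t \<Longrightarrow> P \<rho>s ! x < m" if "\<rho>s \<in> ?T" for \<rho>s
      proof -
        show l: "length (P \<rho>s) = t" using that t by (simp add: P_def tuples_def)
        fix x assume x: "x < t"
        have "set (P \<rho>s) \<subseteq> {..<m}" using that R by (auto simp: P_def tuples_def)
        moreover have "P \<rho>s ! x \<in> set (P \<rho>s)" using x l by (intro nth_mem) simp
        ultimately have "P \<rho>s ! x \<in> {..<m}" by (rule subsetD)
        then show "P \<rho>s ! x < m" by (simp only: lessThan_iff)
      qed
      have fT: "finite ?T" by (simp add: finite_tuples)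
      have cT: "card ?T = m ^ (t - 1)" by (simp add: card_tuples)
      define C1 where "C1 = {\<rho>s \<in> ?T. set \<rho>s \<inter> {R} \<noteq> {}}"
      define C2 where "C2 = {\<rho>s \<in> ?T. \<exists>i<t - 1. \<exists>j<t - 1. i \<noteq> j \<and> \<rho>s ! i = \<rho>s ! j}"
      define C3 where "C3 s = {\<rho>s \<in> ?T. new \<rho>s s \<in> Bad}" for s
      have c1: "card C1 \<le> (t - 1) * card {R} * card {..<m} ^ (t - 1 - 1)"
        unfolding C1_def by (rule card_hitting_tuples_le) auto
      have c2: "card C2 \<le> (t - 1)\<^sup>2 * 1 * card {..<m} ^ (t - 1 - 1)"
        unfolding C2_def
      proof (rule card_colliding_tuples_le)
        fix v assume "v \<in> {..<m}"
        have "{u \<in> {..<m}. v = u} \<subseteq> {v}" by auto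
        then show "card {u \<in> {..<m}. v = u} \<le> 1" using card_mono[of "{v}"] by fastforce
      qed simp
      have c12: "card C1 + card C2 \<le> t * (t - 1) * m ^ (t - 1 - 1)"
      proof -
        have "(t - 1) + (t - 1)\<^sup>2 = t * (t - 1)" using t by (cases t) (auto simp: power2_eq_square)
        then have "t * (t - 1) * m ^ (t - 1 - 1) = (t - 1) * m ^ (t - 1 - 1) + (t - 1)\<^sup>2 * m ^ (t - 1 - 1)"
          by (metis add_mult_distrib)
        then show ?thesis using c1 c2 by simp
      qed
      have c3: "real (card (C3 s)) \<le> \<theta>" if s: "s < t" for s
      proof -
        \<comment> \<open>the column in which the new row \<open>s\<close> retains its entry of the bad row\<close>
        define c0 where "c0 = (t - s) mod t"
        have c0: "c0 < t" "(s + c0) mod t = 0"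
          using t s by (auto simp: c0_def mod_simps)
        have img: "(\<lambda>\<rho>s. new \<rho>s s) ` C3 s \<subseteq> {y \<in> listset Us. y \<in> Bad \<and> y ! c0 = A c0 R}"
        proof
          fix y assume "y \<in> (\<lambda>\<rho>s. new \<rho>s s) ` C3 s"
          then obtain \<rho>s where \<rho>: "\<rho>s \<in> ?T" "y = new \<rho>s s" "y \<in> Bad" by (auto simp: C3_def)
          have "A c (P \<rho>s ! ((s + c) mod t)) \<in> Us ! c" if "c < t" for c
            using A[OF that] lP(2)[OF \<rho>(1)] t by (auto simp: bij_betw_def)
          then have "y \<in> listset Us" unfolding \<rho>(2) new_def by (intro map_in_listset len) auto
          moreover have "y ! c0 = A c0 R" using c0 by (simp add: \<rho>(2) new_def P_def)
          ultimately show "y \<in> {y \<in> listset Us. y \<in> Bad \<and> y ! c0 = A c0 R}" using \<rho>(3) by blast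
        qed
        have inj: "inj_on (\<lambda>\<rho>s. new \<rho>s s) (C3 s)"
        proof (rule inj_onI)
          fix x y assume x: "x \<in> C3 s" and y: "y \<in> C3 s" and eq: "new x s = new y s"
          have xT: "x \<in> ?T" and yT: "y \<in> ?T" using x y by (auto simp: C3_def)
          have "P x = P y"
          proof (rule nth_equalityI)
            show "length (P x) = length (P y)" using lP(1)[OF xT] lP(1)[OF yT] by simp
            fix l assume "l < length (P x)"
            then have l: "l < t" using lP(1)[OF xT] by simp
            define c where "c = (l + (t - s)) mod t"
            have c: "c < t" using t by (simp add: c_def)
            have "(s + c) mod t = (s + (l + (t - s))) mod t" by (simp add: c_def mod_simps)
            also have "s + (l + (t - s)) = l + t" using s by simp
            finally have sc: "(s + c) mod t = l" using l by simp
            have "new x s ! c = new y s ! c" using eq by simp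
            then have "A c (P x ! l) = A c (P y ! l)" using c sc by (simp add: new_def)
            then show "P x ! l = P y ! l"
              using A[OF c] lP(2)[OF xT l] lP(2)[OF yT l] by (auto simp: bij_betw_def inj_on_def)
          qed
          then show "x = y" by (simp add: P_def)
        qed
        have finL: "finite (listset Us)"
        proof -
          have "\<forall>X\<in>set Us. finite X" using Us len by (auto simp: in_set_conv_nth)
          then show ?thesis by (induction Us) (auto simp: listset_Cons_image simp del: listset.simps(2))
        qed
        have "card (C3 s) = card ((\<lambda>\<rho>s. new \<rho>s s) ` C3 s)" using inj by (simp add: card_image)
        also have "\<dots> \<le> card {y \<in> listset Us. y \<in> Bad \<and> y ! c0 = A c0 R}" using finL by (intro card_mono img) auto
        finally have "real (card (C3 s)) \<le> real (card {y \<in> listset Us. y \<in> Bad \<and> y ! c0 = A c0 R})" by simp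
        also have "\<dots> \<le> \<theta>" using A[OF c0(1)] R(1) by (intro bad[OF c0(1)]) (auto simp: bij_betw_def)
        finally show ?thesis .
      qed
      have "real (card (C1 \<union> C2 \<union> (\<Union>s<t. C3 s))) \<le> real (card C1 + card C2) + (\<Sum>s<t. real (card (C3 s)))"
      proof -
        have "card (C1 \<union> C2 \<union> (\<Union>s<t. C3 s)) \<le> card C1 + card C2 + card (\<Union>s<t. C3 s)"
          using card_Un_le[of C1 C2] card_Un_le[of "C1 \<union> C2" "\<Union>s<t. C3 s"] by linarith
        also have "card (\<Union>s<t. C3 s) \<le> (\<Sum>s<t. card (C3 s))" by (rule card_UN_le) simp
        finally have "real (card (C1 \<union> C2 \<union> (\<Union>s<t. C3 s))) \<le> real (card C1 + card C2 + (\<Sum>s<t. card (C3 s)))"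
          by (simp only: of_nat_le_iff)
        then show ?thesis by simp
      qed
      also have "\<dots> \<le> real (t * (t - 1) * m ^ (t - 1 - 1)) + (\<Sum>s<t. \<theta>)"
        by (intro add_mono of_nat_mono c12 sum_mono c3) auto
      also have "\<dots> < real (card ?T)" using small unfolding cT by simp
      finally have "\<not> ?T \<subseteq> C1 \<union> C2 \<union> (\<Union>s<t. C3 s)"
        using card_mono[of "C1 \<union> C2 \<union> (\<Union>s<t. C3 s)" ?T] fT by (auto simp: C1_def C2_def C3_def)
      then obtain \<rho>s where \<rho>: "\<rho>s \<in> ?T" "\<rho>s \<notin> C1" "\<rho>s \<notin> C2" "\<And>s. s < t \<Longrightarrow> \<rho>s \<notin> C3 s" by blast
      let ?P = "P \<rho>s"
      have "distinct \<rho>s" using \<rho>(1,3) by (auto simp: C2_def tuples_def distinct_conv_nth)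
      moreover have "R \<notin> set \<rho>s" using \<rho>(1,2) by (auto simp: C1_def)
      ultimately have dP: "distinct ?P" by (simp add: P_def)
      note lP' = lP[OF \<rho>(1)]
      \<comment> \<open>row \<open>?P ! s\<close> takes its entry in column \<open>c\<close> from row \<open>?P ! (s + c)\<close>, cyclically\<close>
      define idx where "idx x = (THE s. s < t \<and> ?P ! s = x)" for x
      have idx: "idx (?P ! s) = s" if "s < t" for s
        unfolding idx_def using that dP lP'(1) by (intro the_equality) (auto simp: nth_eq_iff_index_eq)
      define \<pi> where "\<pi> c x = (if x \<in> set ?P then ?P ! ((idx x + c) mod t) else x)" for c x
      have \<pi>P: "\<pi> c (?P ! s) = ?P ! ((s + c) mod t)" if "s < t" for c s
        using that idx lP'(1) by (auto simp: \<pi>_def)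
      have setP: "set ?P = (!) ?P ` {..<t}" using lP'(1) by (auto simp: set_conv_nth)
      have \<pi>_bij: "bij_betw (\<pi> c) {..<m} {..<m}" if c: "c < t" for c
      proof -
        have Pm: "set ?P \<subseteq> {..<m}" using setP lP'(2) by auto
        have inj: "inj_on (\<pi> c) {..<m}"
        proof (rule inj_onI)
          fix x y assume xy: "x \<in> {..<m}" "y \<in> {..<m}" "\<pi> c x = \<pi> c y"
          have mem: "\<pi> c z \<in> set ?P \<longleftrightarrow> z \<in> set ?P" for z
            using t lP'(1) by (auto simp: \<pi>_def)
          show "x = y"
          proof (cases "x \<in> set ?P")
            case False
            then have "y \<notin> set ?P" using mem[of x] mem[of y] xy(3) by simp
            then show ?thesis using xy(3) False by (simp add: \<pi>_def)
          next
            case True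
            then have "y \<in> set ?P" using mem[of x] mem[of y] xy(3) by simp
            then obtain a b where ab: "a < t" "b < t" "x = ?P ! a" "y = ?P ! b" using True setP by auto
            then have "?P ! ((a + c) mod t) = ?P ! ((b + c) mod t)" using xy(3) \<pi>P by simp
            then have "(a + c) mod t = (b + c) mod t" using dP lP'(1) t by (simp add: nth_eq_iff_index_eq)
            then have "((a + c) + (t - c)) mod t = ((b + c) + (t - c)) mod t" by (metis mod_add_left_eq)
            then have "a mod t = b mod t" using c by simp
            then show ?thesis using ab by simp
          qed
        qed
        moreover have "\<pi> c x < m" if "x < m" for x
        proof (cases "x \<in> set ?P")
          case True
          have "?P ! ((idx x + c) mod t) < m" by (rule lP'(2)) (use t in simp)
          then show ?thesis using True by (simp add: \<pi>_def)
        qed (use that in \<open>simp add: \<pi>_def\<close>)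
        then have "\<pi> c ` {..<m} \<subseteq> {..<m}" by blast
        ultimately show ?thesis by (simp add: bij_betw_def endo_inj_surj)
      qed
      define A' where "A' c = A c \<circ> \<pi> c" for c
      have A': "\<forall>c<t. bij_betw (A' c) {..<m} (Us ! c)"
        unfolding A'_def using A \<pi>_bij bij_betw_trans by blast
      have rowP: "?row A' (?P ! s) = new \<rho>s s" if "s < t" for s
        using that by (simp add: A'_def new_def \<pi>P)
      have row_other: "?row A' x = ?row A x" if "x \<notin> set ?P" for x
        using that by (simp add: A'_def \<pi>_def)
      have goodP: "?row A' x \<notin> Bad" if x: "x \<in> set ?P" for x
      proof -
        obtain s where s: "s < t" "x = ?P ! s" using x setP by auto
        show ?thesis using \<rho>(1) \<rho>(4)[OF s(1)] by (simp add: s(2) rowP[OF s(1)] C3_def)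
      qed
      have "{\<rho>. \<rho> < m \<and> ?row A' \<rho> \<in> Bad} \<subset> {\<rho>. \<rho> < m \<and> ?row A \<rho> \<in> Bad}"
      proof -
        have "{\<rho>. \<rho> < m \<and> ?row A' \<rho> \<in> Bad} \<subseteq> {\<rho>. \<rho> < m \<and> ?row A \<rho> \<in> Bad}"
          using goodP row_other by (smt (verit, best) Collect_mono)
        moreover have "R \<in> set ?P" by (simp add: P_def)
        then have "R \<notin> {\<rho>. \<rho> < m \<and> ?row A' \<rho> \<in> Bad}" using goodP by blast
        moreover have "R \<in> {\<rho>. \<rho> < m \<and> ?row A \<rho> \<in> Bad}" using R by blast
        ultimately show ?thesis by blast
      qed
      then have "card {\<rho>. \<rho> < m \<and> ?row A' \<rho> \<in> Bad} < card {\<rho>. \<rho> < m \<and> ?row A \<rho> \<in> Bad}"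
        by (intro psubset_card_mono) auto
      from less.hyps[OF this A'] show ?thesis .
    qed
  qed
  have "\<forall>c\<in>{..<t}. \<exists>h. bij_betw h {..<m} (Us ! c)"
  proof
    fix c assume "c \<in> {..<t}"
    then show "\<exists>h. bij_betw h {..<m} (Us ! c)"
      using Us[of c] ex_bij_betw_nat_finite[of "Us ! c"] by (auto simp: atLeast0LessThan)
  qed
  from bchoice[OF this] obtain A where "\<forall>c\<in>{..<t}. bij_betw (A c) {..<m} (Us ! c)" ..
  then show ?thesis by (intro improve[of A]) auto
qed


lemma disjoint_family_image:
  assumes "finite I" "\<And>x. x \<in> I \<Longrightarrow> h x \<noteq> {}" "\<And>x y. x \<in> I \<Longrightarrow> y \<in> I \<Longrightarrow> x \<noteq> y \<Longrightarrow> h x \<inter> h y = {}"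
  shows "pairwise disjnt (h ` I)" "card (h ` I) = card I"
proof -
  show "pairwise disjnt (h ` I)"
    using assms(3) unfolding pairwise_def disjnt_def by blast
  have "inj_on h I"
    using assms(2,3) by (intro inj_onI) (metis inf.idem)
  then show "card (h ` I) = card I" by (rule card_image)
qed

text \<open>The prescribed size is reached exactly because each vertex is counted for some colour, the atypical vertices in
\<open>X\<close> for a colour in which they have many completions. After the atypical vertices of the chosen
colour \<open>i\<close> have been matched, the typical vertices of its block still number at least
\<open>count_list \<tau> i + 1\<close> times the number of missing sets.\<close>

lemma matching_completion:
  fixes \<theta> :: real
  assumes V: "finite V" and t: "t \<ge> 1" and \<tau>: "length \<tau> = t - 1" "set \<tau> \<subseteq> {..<k}"
    and B: "\<And>i j. i \<noteq> j \<Longrightarrow> B i \<inter> B j = {}" and T: "\<And>j. T j \<subseteq> B j" "\<And>j. T j \<subseteq> V"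
    and Bad: "Bad = {y \<in> tuples V t. \<not> (distinct y \<and> (\<exists>i<k. set y \<in> colour_class V t col i \<and> count_list \<tau> i < card (set y \<inter> B i)))}"
    and typical: "\<And>j c u. j < k \<Longrightarrow> u \<in> T j \<Longrightarrow> c < t \<Longrightarrow> real (card {y \<in> Bad. y ! c = u}) \<le> \<theta>"
    and X: "X = V - (\<Union>j<k. T j)" "card X \<le> p0" "p0 < q"
    and \<kappa>: "\<And>v. v \<in> X \<Longrightarrow> \<exists>i<k. (t - 1) * (p0 * (t - 1)) * card V ^ (t - 1 - 1)
        < card {y \<in> tuples V (t - 1). (\<forall>l<t - 1. y ! l \<in> T (\<tau> ! l)) \<and> set (v # y) \<in> colour_class V t col i}"
    and sizes: "\<And>j. j < k \<Longrightarrow> count_list \<tau> j * q \<le> card (T j)"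
    and small: "\<And>m. q - p0 \<le> m \<Longrightarrow> real t * \<theta> + real (t * (t - 1) * m ^ (t - 1 - 1)) < real (m ^ (t - 1))"
    and qn: "q * (t - 1 + k) < card V + k"
  shows "\<exists>i<k. \<exists>N. N \<subseteq> colour_class V t col i \<and> pairwise disjnt N \<and> card N = q"
proof -
  let ?Y = "\<lambda>i v. {y \<in> tuples V (t - 1). (\<forall>l<t - 1. y ! l \<in> T (\<tau> ! l)) \<and> set (v # y) \<in> colour_class V t col i}"
  have fT: "finite (T j)" for j using T(2) V finite_subset by blast
  have fX: "finite X" using X(1) V by simp
  have TT: "T i \<inter> T j = {}" if "i \<noteq> j" for i j using B[OF that] T(1)[of i] T(1)[of j] by blast
  have TX: "T j \<inter> X = {}" if "j < k" for j using X(1) that by blast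
  have "\<forall>v\<in>X. \<exists>i. i < k \<and> (t - 1) * (p0 * (t - 1)) * card V ^ (t - 1 - 1) < card (?Y i v)" using \<kappa> by blast
  from bchoice[OF this] obtain \<kappa>' where \<kappa>': "\<forall>v\<in>X. \<kappa>' v < k \<and> (t - 1) * (p0 * (t - 1)) * card V ^ (t - 1 - 1) < card (?Y (\<kappa>' v) v)" ..
  define K where "K i = {v \<in> X. \<kappa>' v = i}" for i
  have fK: "finite (K i)" for i using fX by (simp add: K_def)
  have KT: "card (T i \<union> K i) = card (T i) + card (K i)" if "i < k" for i
    using TX[OF that] fT fK by (intro card_Un_disjoint) (auto simp: K_def)
  \<comment> \<open>every vertex acts for one colour, so some colour receives its full share\<close>
  have "\<exists>i<k. (count_list \<tau> i + 1) * q \<le> card (T i) + card (K i)"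
  proof (rule ccontr)
    assume "\<not> ?thesis"
    then have less: "card (T i \<union> K i) + 1 \<le> (count_list \<tau> i + 1) * q" if "i < k" for i
      using that KT by (force simp: not_le)
    have "V = (\<Union>i<k. T i \<union> K i)"
    proof (intro set_eqI iffI)
      fix x assume x: "x \<in> V"
      show "x \<in> (\<Union>i<k. T i \<union> K i)"
      proof (cases "x \<in> X")
        case True
        then have "\<kappa>' x < k" "x \<in> K (\<kappa>' x)" using \<kappa>' by (auto simp: K_def)
        then show ?thesis by blast
      qed (use x X(1) in blast)
    next
      fix x assume "x \<in> (\<Union>i<k. T i \<union> K i)"
      then show "x \<in> V" using T(2) X(1) unfolding K_def by blast
    qed
    then have "card V \<le> (\<Sum>i<k. card (T i \<union> K i))" by (metis card_UN_le finite_lessThan)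
    then have "card V + k \<le> (\<Sum>i<k. card (T i \<union> K i) + 1)" by (simp only: sum.distrib) simp
    also have "\<dots> \<le> (\<Sum>i<k. (count_list \<tau> i + 1) * q)" using less by (intro sum_mono) simp
    also have "\<dots> = (\<Sum>i<k. count_list \<tau> i + 1) * q" by (rule sum_distrib_right[symmetric])
    also have "(\<Sum>i<k. count_list \<tau> i + 1) = t - 1 + k"
      using sum_count_set[OF \<tau>(2)] \<tau>(1) by (simp only: sum.distrib) simp
    finally show False using qn by (simp add: mult.commute)
  qed
  then obtain i where i: "i < k" "(count_list \<tau> i + 1) * q \<le> card (T i) + card (K i)" by blast
  define p where "p = card (K i)"
  have p: "p \<le> p0" unfolding p_def using X(2) card_mono[OF fX, of "K i"] by (auto simp: K_def)
  have "\<exists>f. (\<forall>v\<in>K i. f v \<in> ?Y i v) \<and> (\<forall>u\<in>K i. \<forall>v\<in>K i. u \<noteq> v \<longrightarrow> set (f u) \<inter> set (f v) = {})"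
  proof (rule greedy_disjoint_tuples[OF V fK, where N = p0 and s = "t - 1"])
    show "card (K i) \<le> p0" using p by (simp add: p_def)
    show "?Y i v \<subseteq> tuples V (t - 1)" for v by blast
    show "(t - 1) * (p0 * (t - 1)) * card V ^ (t - 1 - 1) < card (?Y i v)" if "v \<in> K i" for v
      using \<kappa>' that by (auto simp: K_def)
  qed
  then obtain f where f: "\<And>v. v \<in> K i \<Longrightarrow> f v \<in> ?Y i v" "\<And>u v. u \<in> K i \<Longrightarrow> v \<in> K i \<Longrightarrow> u \<noteq> v \<Longrightarrow> set (f u) \<inter> set (f v) = {}"
    by blast
  have f_len: "length (f v) = t - 1" if "v \<in> K i" for v using f(1)[OF that] by (simp add: tuples_def)
  have f_col: "set (v # f v) \<in> colour_class V t col i" if "v \<in> K i" for v using f(1)[OF that] by blast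
  have f_nth: "f v ! l \<in> T (\<tau> ! l)" if "v \<in> K i" "l < t - 1" for v l using f(1)[OF that(1)] that(2) by blast
  have f_dist: "distinct (f v)" if "v \<in> K i" for v
  proof -
    have "card (set (v # f v)) = length (v # f v)" using f_col[OF that] f_len[OF that] t by (simp add: colour_class_def)
    then have "distinct (v # f v)" by (rule card_distinct)
    then show ?thesis by simp
  qed
  have f_T: "set (f v) \<subseteq> (\<Union>j<k. T j)" if v: "v \<in> K i" for v
  proof
    fix x assume "x \<in> set (f v)"
    then obtain l where l: "l < t - 1" "x = f v ! l" using f_len[OF v] by (auto simp: in_set_conv_nth)
    have "\<tau> ! l \<in> set \<tau>" using \<tau>(1) l(1) by (intro nth_mem) simp
    then have "\<tau> ! l \<in> {..<k}" using \<tau>(2) by blast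
    then show "x \<in> (\<Union>j<k. T j)" using f_nth[OF v l(1)] l(2) by auto
  qed
  define used where "used = (\<Union>v\<in>K i. set (f v))"
  have f_used: "finite used" using fK by (simp add: used_def)
  have cused: "card (used \<inter> T j) \<le> p * count_list \<tau> j" for j
  proof -
    have "used \<inter> T j = (\<Union>v\<in>K i. set (f v) \<inter> T j)" by (auto simp: used_def)
    then have "card (used \<inter> T j) \<le> (\<Sum>v\<in>K i. card (set (f v) \<inter> T j))" by (metis card_UN_le fK)
    also have "\<dots> = (\<Sum>v\<in>K i. count_list \<tau> j)"
    proof (rule sum.cong[OF refl])
      fix v assume v: "v \<in> K i"
      show "card (set (f v) \<inter> T j) = count_list \<tau> j"
        by (rule card_Int_typed_tuple) (use f_len[OF v] \<tau>(1) f_dist[OF v] f_nth[OF v] TT in auto)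
    qed
    finally show ?thesis by (simp add: p_def)
  qed
  define S where "S j = (if j < k then T j - used else {})" for j
  have ST: "S j \<subseteq> T j" for j by (auto simp: S_def)
  let ?\<sigma> = "i # \<tau>"
  have ls: "length ?\<sigma> = t" using \<tau>(1) t by simp
  have "\<exists>Us. length Us = length ?\<sigma> \<and> (\<forall>c<length ?\<sigma>. Us ! c \<subseteq> S (?\<sigma> ! c) \<and> card (Us ! c) = q - p) \<and>
     (\<forall>c<length ?\<sigma>. \<forall>c'<length ?\<sigma>. c \<noteq> c' \<longrightarrow> Us ! c \<inter> Us ! c' = {})"
  proof (rule disjoint_parts)
    show "finite (S j)" for j using ST fT finite_subset by blast
    show "S j \<inter> S j' = {}" if "j \<noteq> j'" for j j' using TT[OF that] ST by blast
    fix j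
    show "count_list ?\<sigma> j * (q - p) \<le> card (S j)"
    proof (cases "j < k")
      case False
      then have "count_list ?\<sigma> j = 0" using \<tau>(2) i(1) by (auto simp: count_list_0_iff)
      then show ?thesis by simp
    next
      case True
      have "card (S j) = card (T j) - card (used \<inter> T j)"
        using True fT by (simp add: S_def card_Diff_subset_Int Int_commute)
      then have ge: "card (T j) - p * count_list \<tau> j \<le> card (S j)" using cused[of j] by linarith
      show ?thesis
      proof (cases "j = i")
        case True
        have "(count_list \<tau> i + 1) * (q - p) = (count_list \<tau> i + 1) * q - p - p * count_list \<tau> i"
        proof -
          have "(count_list \<tau> i + 1) * p = p + p * count_list \<tau> i" by simp
          then show ?thesis by (simp only: diff_mult_distrib2 diff_diff_left)
        qed
        also have "\<dots> \<le> card (T i) - p * count_list \<tau> i" using i(2) by (simp add: p_def)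
        finally show ?thesis using ge True by simp
      next
        case False
        have "count_list \<tau> j * (q - p) = count_list \<tau> j * q - p * count_list \<tau> j"
          by (simp only: diff_mult_distrib2 mult.commute[of p])
        also have "\<dots> \<le> card (T j) - p * count_list \<tau> j" using sizes[OF True] by simp
        finally show ?thesis using ge False by simp
      qed
    qed
  qed
  then obtain Us where Us0: "length Us = t \<and> (\<forall>c<t. Us ! c \<subseteq> S (?\<sigma> ! c) \<and> card (Us ! c) = q - p) \<and>
     (\<forall>c<t. \<forall>c'<t. c \<noteq> c' \<longrightarrow> Us ! c \<inter> Us ! c' = {})" unfolding ls ..
  then have Us: "length Us = t" "\<And>c. c < t \<Longrightarrow> Us ! c \<subseteq> S (?\<sigma> ! c)" "\<And>c. c < t \<Longrightarrow> card (Us ! c) = q - p"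
    "\<And>c c'. c < t \<Longrightarrow> c' < t \<Longrightarrow> c \<noteq> c' \<Longrightarrow> Us ! c \<inter> Us ! c' = {}" by simp_all
  have \<sigma>k: "?\<sigma> ! c < k" if "c < t" for c
  proof -
    have "?\<sigma> ! c \<in> set ?\<sigma>" using that ls by (metis nth_mem)
    then show ?thesis using \<tau>(2) i(1) by auto
  qed
  have finBad: "finite Bad" unfolding Bad by (simp add: finite_tuples V)
  have "\<exists>A. (\<forall>c<t. bij_betw (A c) {..<q - p} (Us ! c)) \<and> (\<forall>\<rho><q - p. map (\<lambda>c. A c \<rho>) [0..<t] \<notin> Bad)"
  proof (rule perfect_matching_by_swaps[OF Us(1) t])
    fix c assume c: "c < t"
    have "Us ! c \<subseteq> T (?\<sigma> ! c)" by (rule subset_trans[OF Us(2)[OF c] ST])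
    then have "finite (Us ! c)" by (rule finite_subset[OF _ fT])
    then show "finite (Us ! c) \<and> card (Us ! c) = q - p" using Us(3)[OF c] by (rule conjI)
  next
    fix c u assume c: "c < t" and u: "u \<in> Us ! c"
    have "u \<in> T (?\<sigma> ! c)" using subsetD[OF ST subsetD[OF Us(2)[OF c] u]] .
    then have "real (card {y \<in> Bad. y ! c = u}) \<le> \<theta>" by (rule typical[OF \<sigma>k[OF c] _ c])
    moreover have "card {y \<in> listset Us. y \<in> Bad \<and> y ! c = u} \<le> card {y \<in> Bad. y ! c = u}"
      using finBad by (intro card_mono) auto
    ultimately show "real (card {y \<in> listset Us. y \<in> Bad \<and> y ! c = u}) \<le> \<theta>" by linarith
  next
    show "real t * \<theta> + real (t * (t - 1) * (q - p) ^ (t - 1 - 1)) < real ((q - p) ^ (t - 1))"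
      by (rule small) (use p in simp)
  qed
  then obtain A where A: "\<And>c. c < t \<Longrightarrow> bij_betw (A c) {..<q - p} (Us ! c)"
    "\<And>\<rho>. \<rho> < q - p \<Longrightarrow> map (\<lambda>c. A c \<rho>) [0..<t] \<notin> Bad" by blast
  define row where "row \<rho> = set (map (\<lambda>c. A c \<rho>) [0..<t])" for \<rho>
  have AS: "A c \<rho> \<in> Us ! c" "A c \<rho> \<in> S (?\<sigma> ! c)" if "c < t" "\<rho> < q - p" for c \<rho>
  proof -
    show "A c \<rho> \<in> Us ! c" using A(1)[OF that(1)] that(2) by (auto simp: bij_betw_def)
    then show "A c \<rho> \<in> S (?\<sigma> ! c)" using Us(2)[OF that(1)] by blast
  qed
  define SS where "SS = (\<Union>j<k. S j)"
  have row_SS: "row \<rho> \<subseteq> SS" if "\<rho> < q - p" for \<rho>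
  proof
    fix x assume "x \<in> row \<rho>"
    then obtain c where c: "c < t" "x = A c \<rho>" by (auto simp: row_def)
    have "?\<sigma> ! c \<in> {..<k}" using \<sigma>k[OF c(1)] by (simp only: lessThan_iff)
    then show "x \<in> SS" unfolding SS_def c(2) using AS(2)[OF c(1) that] by (rule UN_I)
  qed
  have row_col: "row \<rho> \<in> colour_class SS t col i" if \<rho>: "\<rho> < q - p" for \<rho>
  proof -
    let ?y = "map (\<lambda>c. A c \<rho>) [0..<t]"
    have yB: "?y ! c \<in> B (?\<sigma> ! c)" "?y ! c \<in> V" if "c < t" for c
    proof -
      have "A c \<rho> \<in> T (?\<sigma> ! c)" using AS(2)[OF that \<rho>] ST by blast
      then show "?y ! c \<in> B (?\<sigma> ! c)" "?y ! c \<in> V" using T that by auto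
    qed
    have "?y \<in> tuples V t"
      using yB(2) by (auto simp: tuples_def)
    then have good: "distinct ?y" "\<exists>j<k. set ?y \<in> colour_class V t col j \<and> count_list \<tau> j < card (set ?y \<inter> B j)"
      using A(2)[OF \<rho>] unfolding Bad by blast+
    then obtain j where j: "j < k" "set ?y \<in> colour_class V t col j" "count_list \<tau> j < card (set ?y \<inter> B j)" by blast
    have "card (set ?y \<inter> B j) = count_list ?\<sigma> j"
    proof (rule card_Int_typed_tuple)
      show "length ?y = length ?\<sigma>" using ls by simp
      show "?y ! c \<in> B (?\<sigma> ! c)" if "c < length ?\<sigma>" for c using yB(1)[of c] that ls by simp
    qed (use good(1) B in auto)
    then have "j = i" using j(3) by (auto split: if_splits)
    then have "row \<rho> \<in> colour_class V t col i" using j(2) by (simp add: row_def)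
    then show ?thesis using row_SS[OF \<rho>] by (simp add: colour_class_def)
  qed
  have rows_disj: "row \<rho> \<inter> row \<rho>' = {}" if \<rho>: "\<rho> < q - p" "\<rho>' < q - p" "\<rho> \<noteq> \<rho>'" for \<rho> \<rho>'
  proof (rule ccontr)
    assume "row \<rho> \<inter> row \<rho>' \<noteq> {}"
    then obtain c c' where c: "c < t" "c' < t" "A c \<rho> = A c' \<rho>'" by (auto simp: row_def)
    have "c = c'" using Us(4)[OF c(1,2)] AS(1)[OF c(1) \<rho>(1)] AS(1)[OF c(2) \<rho>(2)] c(3) by auto
    then show False using A(1)[OF c(1)] c(3) \<rho> by (auto simp: bij_betw_def inj_on_def)
  qed
  let ?M1 = "(\<lambda>v. set (v # f v)) ` K i" and ?M2 = "row ` {..<q - p}"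
  have KX: "v \<notin> (\<Union>j<k. T j)" if "v \<in> K i" for v using that X(1) by (auto simp: K_def)
  have M1: "pairwise disjnt ?M1" "card ?M1 = card (K i)"
  proof -
    have "set (u # f u) \<inter> set (v # f v) = {}" if "u \<in> K i" "v \<in> K i" "u \<noteq> v" for u v
      using f(2)[OF that] KX[OF that(1)] KX[OF that(2)] f_T[OF that(1)] f_T[OF that(2)] that(3) by auto
    then show "pairwise disjnt ?M1" "card ?M1 = card (K i)"
      by (intro disjoint_family_image[OF fK]; simp)+
  qed
  have M2: "pairwise disjnt ?M2" "card ?M2 = card {..<q - p}"
  proof -
    have "row \<rho> \<noteq> {}" if "\<rho> \<in> {..<q - p}" for \<rho> using t by (auto simp: row_def)
    then show "pairwise disjnt ?M2" "card ?M2 = card {..<q - p}"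
      using rows_disj by (intro disjoint_family_image; simp)+
  qed
  have U1: "?M1 \<subseteq> colour_class (K i \<union> used) t col i"
  proof
    fix e assume "e \<in> ?M1"
    then obtain v where v: "v \<in> K i" "e = set (v # f v)" by blast
    then have "e \<subseteq> K i \<union> used" by (auto simp: used_def)
    then show "e \<in> colour_class (K i \<union> used) t col i" using f_col[OF v(1)] v(2) by (simp add: colour_class_def)
  qed
  have U2: "?M2 \<subseteq> colour_class SS t col i" using row_col by blast
  have "(K i \<union> used) \<inter> SS = {}" using KX ST by (fastforce simp: SS_def S_def)
  note un = colour_class_Un_disjoint[OF U1 U2 this t _ _ M1(1) M2(1)]
  have fM: "finite ?M1" "finite ?M2" using fK by auto
  have sub: "(K i \<union> used) \<union> SS \<subseteq> V"
  proof -
    have "K i \<subseteq> V" using X(1) by (auto simp: K_def)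
    moreover have "used \<subseteq> V" using f_T T(2) unfolding used_def by fastforce
    moreover have "SS \<subseteq> V" using ST T(2) unfolding SS_def by fastforce
    ultimately show ?thesis by blast
  qed
  have "?M1 \<union> ?M2 \<subseteq> colour_class V t col i" using un(1)[OF fM] colour_class_mono[OF sub] by blast
  moreover have "pairwise disjnt (?M1 \<union> ?M2)" by (rule un(2)[OF fM])
  moreover have "card (?M1 \<union> ?M2) = q"
    using un(3)[OF fM] M1(2) M2(2) p X(3) by (simp add: p_def)
  ultimately show ?thesis using i(1) by blast
qed

section \<open>Monochromatic matchings\<close>

lemma power_le_card_listset:
  fixes x :: real
  assumes "\<And>A. A \<in> set As \<Longrightarrow> finite A \<and> x \<le> card A" "0 \<le> x"
  shows "x ^ length As \<le> card (listset As)"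
  using assms(1)
proof (induction As)
  case Nil then show ?case by simp
next
  case (Cons A As)
  have "card (listset (A # As)) = card A * card (listset As)"
    by (simp only: listset_Cons_image) (subst card_image, auto simp: inj_on_def card_cartesian_product)
  moreover have "x * x ^ length As \<le> real (card A) * real (card (listset As))"
    using Cons assms(2) by (intro mult_mono) auto
  ultimately show ?case by simp
qed

lemma card_uncoloured_le:
  fixes d :: real
  assumes V: "finite V" and t: "t \<ge> 1"
    and d: "\<And>v. v \<in> V \<Longrightarrow> real (card {y \<in> tuples V (t - 1). v # y \<in> uncoloured V t k col}) \<le> d * real (card V) ^ (t - 1)"
  shows "real (card (uncoloured V t k col)) \<le> d * real (card V) ^ t"
proof -
  let ?U = "uncoloured V t k col"
  have T: "tuples V t = tuples V (Suc (t - 1))" using t by simp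
  have fin: "finite (tuples V s)" for s by (rule finite_tuples[OF V])
  have "?U = {xs \<in> tuples V t. xs \<in> ?U}" by (auto simp: uncoloured_def)
  then have "card ?U = (\<Sum>xs\<in>tuples V t. if xs \<in> ?U then 1 else 0)"
    using fin by (simp flip: sum.inter_filter)
  also have "\<dots> = (\<Sum>v\<in>V. \<Sum>y\<in>tuples V (t - 1). if v # y \<in> ?U then 1 else 0)"
    unfolding T by (rule sum_tuples_Suc)
  also have "\<dots> = (\<Sum>v\<in>V. card {y \<in> tuples V (t - 1). v # y \<in> ?U})"
    using fin by (simp flip: sum.inter_filter)
  finally have "real (card ?U) = (\<Sum>v\<in>V. real (card {y \<in> tuples V (t - 1). v # y \<in> ?U}))" by simp
  also have "\<dots> \<le> (\<Sum>v\<in>V. d * real (card V) ^ (t - 1))" by (intro sum_mono d)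
  also have "\<dots> = d * real (card V) ^ Suc (t - 1)" by simp
  finally show ?thesis using t by simp
qed

text \<open>Markov's inequality, for the number of bad tuples through a vertex.\<close>

lemma few_atypical_vertices:
  fixes \<beta> :: real
  assumes V: "finite V" and t: "t \<ge> 1" and \<beta>: "\<beta> > 0" and Bad: "Bad \<subseteq> tuples V t" "real (card Bad) \<le> \<beta>\<^sup>2 * real (card V) ^ t"
  shows "real (card {u \<in> V. \<exists>c<t. \<beta> * real (card V) ^ (t - 1) < real (card {y \<in> Bad. y ! c = u})}) \<le> t * \<beta> * real (card V)"
proof (cases "card V = 0")
  case True
  then show ?thesis using V by simp
next
  case False
  then have n: "real (card V) > 0" by simp
  let ?n = "real (card V)"
  have fB: "finite Bad" using Bad(1) finite_tuples[OF V] finite_subset by blast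
  let ?N = "\<lambda>c. {u \<in> V. \<beta> * ?n ^ (t - 1) < real (card {y \<in> Bad. y ! c = u})}"
  have each: "real (card (?N c)) \<le> \<beta> * ?n" for c
  proof -
    have "real (card (?N c)) * (\<beta> * ?n ^ (t - 1)) = (\<Sum>u\<in>?N c. \<beta> * ?n ^ (t - 1))" by simp
    also have "\<dots> \<le> (\<Sum>u\<in>?N c. real (card {y \<in> Bad. y ! c = u}))" by (intro sum_mono) auto
    also have "\<dots> = real (card (\<Union>u\<in>?N c. {y \<in> Bad. y ! c = u}))"
      using V fB by (subst card_UN_disjoint) auto
    also have "\<dots> \<le> real (card Bad)" using fB by (intro of_nat_mono card_mono) auto
    also have "\<dots> \<le> \<beta>\<^sup>2 * ?n ^ t" by (rule Bad(2))
    also have "\<dots> = \<beta> * ?n * (\<beta> * ?n ^ (t - 1))"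
      using t by (cases t) (auto simp: power2_eq_square)
    finally show ?thesis by (rule mult_right_le_imp_le) (use \<beta> n in simp)
  qed
  have "{u \<in> V. \<exists>c<t. \<beta> * ?n ^ (t - 1) < real (card {y \<in> Bad. y ! c = u})} = (\<Union>c<t. ?N c)" by auto
  then have "card {u \<in> V. \<exists>c<t. \<beta> * ?n ^ (t - 1) < real (card {y \<in> Bad. y ! c = u})} \<le> (\<Sum>c<t. card (?N c))"
    by (simp only:) (rule card_UN_le, simp)
  then have "real (card {u \<in> V. \<exists>c<t. \<beta> * ?n ^ (t - 1) < real (card {y \<in> Bad. y ! c = u})}) \<le> (\<Sum>c<t. real (card (?N c)))"
    by (simp only: of_nat_le_iff flip: of_nat_sum)
  also have "\<dots> \<le> (\<Sum>c<t. \<beta> * ?n)" by (intro sum_mono each)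
  finally show ?thesis by simp
qed

text \<open>Suppose that there is no such matching. The asymptotic bound, applied with the sets of colour \<open>j\<close> restricted to those that respect
the threshold, shows that the block of colour \<open>j\<close> has almost
\<open>(count_list \<tau> j + 1) * q\<close> vertices. Hence few vertices lie outside the blocks or are atypical, and each of them
completes a positive proportion of the tuples of type \<open>\<tau>\<close> to a coloured set, hence many of them in one and the
same colour.\<close>

lemma monochromatic_matching:
  fixes \<gamma> :: real
  assumes t: "t \<ge> 1" and k: "k \<ge> 1" and \<gamma>: "\<gamma> > 0"
  shows "\<exists>d>0. \<forall>(V :: 'a set) col q. finite V \<longrightarrow> 1 / d \<le> real (card V) \<longrightarrow> \<gamma> * real (card V) \<le> real q \<longrightarrow>
     q * (t - 1 + k) < card V + k \<longrightarrow>
     (\<forall>v\<in>V. real (card {y \<in> tuples V (t - 1). v # y \<in> uncoloured V t k col}) \<le> d * real (card V) ^ (t - 1)) \<longrightarrow>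
     (\<exists>i<k. \<exists>N. N \<subseteq> colour_class V t col i \<and> pairwise disjnt N \<and> card N = q)"
proof -
  have t1: "real t \<ge> 1" and k1: "real k \<ge> 1" using t k by auto
  define s where "s = t - 1"
  \<comment> \<open>\<open>g0\<close> is a lower bound for the proportion of the tuples of type \<open>\<tau>\<close>, \<open>\<alpha>\<close> for
    the proportion of completions of an atypical vertex in its best colour, \<open>\<xi>\<close> an upper bound for the
    proportion of atypical vertices and \<open>\<beta>\<close> for that of bad tuples through a typical vertex\<close>
  define g0 where "g0 = (\<gamma> / 2) ^ s"
  have g0: "g0 > 0" using \<gamma> by (simp add: g0_def)
  define \<alpha> where "\<alpha> = g0 / (2 * k)"
  have \<alpha>: "\<alpha> > 0" using g0 k1 by (simp add: \<alpha>_def)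
  define \<mu> where "\<mu> = Min {\<gamma>, \<alpha>, g0, 1}"
  have \<mu>: "\<mu> > 0" "\<mu> \<le> \<gamma>" "\<mu> \<le> \<alpha>" "\<mu> \<le> g0" "\<mu> \<le> 1" using \<gamma> \<alpha> g0 by (auto simp: \<mu>_def)
  define D where "D = 1 + 2 * real k * real t + real t"
  have D: "D \<ge> 1" using t1 k1 by (simp add: D_def)
  have t3: "real t ^ 3 \<ge> real t ^ 2" "real t ^ 2 \<ge> real t" "real t ^ 3 \<ge> 1"
    using t1 by (auto intro!: power_increasing self_le_power one_le_power)
  define \<xi> where "\<xi> = \<mu> / (16 * real t ^ 3)"
  define \<beta> where "\<beta> = \<xi> / D"
  have \<xi>: "\<xi> > 0" "\<xi> * (16 * real t ^ 3) = \<mu>"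
  proof -
    have "16 * real t ^ 3 > 0" using t3(3) by linarith
    then show "\<xi> > 0" "\<xi> * (16 * real t ^ 3) = \<mu>" using \<mu>(1) by (simp_all add: \<xi>_def)
  qed
  have \<beta>: "\<beta> > 0" "\<beta> * D = \<xi>" using \<xi> D by (auto simp: \<beta>_def)
  have \<beta>\<xi>: "\<beta> \<le> \<xi>" using \<beta> D mult_left_mono[of 1 D \<beta>] by simp
  have t\<xi>: "16 * (real t ^ 2 * \<xi>) \<le> \<mu>"
  proof -
    have "\<xi> * (16 * real t ^ 2) \<le> \<xi> * (16 * real t ^ 3)" using \<xi> t3 by (intro mult_left_mono) auto
    then show ?thesis using \<xi>(2) by (simp add: mult_ac)
  qed
  have t\<xi>1: "16 * (real t * \<xi>) \<le> \<mu>"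
  proof -
    have "\<xi> * (16 * real t) \<le> \<xi> * (16 * real t ^ 2)" using \<xi> t3 by (intro mult_left_mono) auto
    then show ?thesis using t\<xi> by (simp add: mult_ac)
  qed
  have t\<beta>: "16 * (real t * \<beta>) \<le> \<mu>"
    using t\<xi>1 mult_left_mono[OF \<beta>\<xi>, of "real t"] by simp
  have \<xi>1: "16 * \<xi> \<le> \<mu>" using t\<xi>1 mult_right_mono[OF t1 less_imp_le[OF \<xi>(1)]] by linarith
  obtain \<sigma>A where \<sigma>A: "\<sigma>A > 0" and AT: "\<forall>(V :: 'a set) F m Q. almost_covered V t k F m \<sigma>A \<longrightarrow> (\<forall>i<k. m i \<le> Q) \<longrightarrow>
     real (card V) \<le> (real t - 1) * real Q + (\<Sum>i<k. real (m i)) + \<beta> * real (card V)"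
    using points_le_of_matching_bounds[OF t \<beta>(1), of k, where 'a = 'a] by (elim exE conjE) (rule that)
  define \<delta> where "\<delta> = Min {\<beta>\<^sup>2, 1 / 2, \<sigma>A}"
  have \<delta>: "\<delta> > 0" "\<delta> \<le> \<beta>\<^sup>2" "\<delta> \<le> \<sigma>A" "\<delta> < 1" using \<beta> \<sigma>A by (auto simp: \<delta>_def min_less_iff_disj)
  obtain \<sigma>B where \<sigma>B: "\<sigma>B > 0" and block: "\<forall>(V :: 'a set) col q. counterexample V t k col q \<sigma>B \<longrightarrow>
     (\<exists>\<tau> B. length \<tau> = t - 1 \<and> set \<tau> \<subseteq> {..<k} \<and> (\<forall>i. B i \<subseteq> V) \<and> (\<forall>i j. i \<noteq> j \<longrightarrow> B i \<inter> B j = {}) \<and>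
        real (card {y \<in> tuples V t. \<not> (distinct y \<and> (\<exists>i<k. set y \<in> colour_class V t col i \<and> count_list \<tau> i < card (set y \<inter> B i)))}) \<le> \<delta> * real (card V) ^ t)"
    using block_structure[OF t k \<delta>(1,4), where 'a = 'a] by (elim exE conjE) (rule that)
  define d where "d = Min {\<sigma>A, \<sigma>B, \<beta> / k, g0 / 2, \<gamma> / (8 * real t ^ 2)}"
  have d: "d > 0" "d \<le> \<sigma>A" "d \<le> \<sigma>B" "d \<le> \<beta> / k" "d \<le> g0 / 2" "d \<le> \<gamma> / (8 * real t ^ 2)"
  proof -
    show "d > 0" unfolding d_def using \<sigma>A \<sigma>B \<beta> k1 g0 \<gamma> t1 by (subst Min_gr_iff) auto
  qed (unfold d_def, (intro Min_le; simp)+)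
  show ?thesis
  proof (intro exI[of _ d] conjI allI impI d(1))
    fix V :: "'a set" and col and q :: nat
    assume V: "finite V" "1 / d \<le> real (card V)" and q: "\<gamma> * real (card V) \<le> real q"
      and qn: "q * (t - 1 + k) < card V + k"
      and deg: "\<forall>v\<in>V. real (card {y \<in> tuples V (t - 1). v # y \<in> uncoloured V t k col}) \<le> d * real (card V) ^ (t - 1)"
    let ?n = "real (card V)"
    let ?F = "colour_class V t col"
    show "\<exists>i<k. \<exists>N. N \<subseteq> ?F i \<and> pairwise disjnt N \<and> card N = q"
    proof (rule ccontr)
      assume contra: "\<not> ?thesis"
      have inv: "1 / x \<le> ?n" if "d \<le> x" for x
      proof -
        have "1 / x \<le> 1 / d" using that d(1) by (intro divide_left_mono) auto
        then show ?thesis using V(2) by linarith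
      qed
      have n: "?n > 0"
      proof -
        have "0 < 1 / d" using d(1) by simp
        then show ?thesis using V(2) by linarith
      qed
      have kn: "real k \<le> \<beta> * ?n" using inv[OF d(4)] \<beta> by (simp add: pos_divide_le_eq mult.commute)
      have tn: "8 * real t ^ 2 \<le> \<gamma> * ?n" using inv[OF d(6)] \<gamma> by (simp add: pos_divide_le_eq mult.commute)
      have q1: "q \<ge> 1"
      proof -
        have "0 < \<gamma> * ?n" using \<gamma> n by simp
        then show ?thesis using q by (cases q) auto
      qed
      have small: "\<forall>i<k. matching_le (?F i) (q - 1)"
      proof (intro allI impI)
        fix i assume i: "i < k"
        show "matching_le (?F i) (q - 1)" unfolding matching_le_def
        proof (intro allI impI, rule ccontr)
          fix M assume M: "M \<subseteq> ?F i" "pairwise disjnt M" "\<not> card M \<le> q - 1"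
          then have "q \<le> card M" by simp
          then obtain N where N: "N \<subseteq> M" "card N = q" by (rule obtain_subset_with_card_n)
          have "pairwise disjnt N" using M(2) N(1) by (rule pairwise_subset)
          then show False using contra i N M(1) by blast
        qed
      qed
      have U0: "real (card (uncoloured V t k col)) \<le> d * ?n ^ t"
        by (rule card_uncoloured_le[OF V(1) t]) (use deg in blast)
      have U: "real (card (uncoloured V t k col)) \<le> x * ?n ^ t" if "d \<le> x" for x
      proof -
        have "d * ?n ^ t \<le> x * ?n ^ t" using that by (intro mult_right_mono) auto
        then show ?thesis using U0 by linarith
      qed
      have ce: "counterexample V t k col q d"
        unfolding counterexample_def using V q1 small qn U0 by blast
      obtain \<tau> B where \<tau>: "length \<tau> = t - 1" "set \<tau> \<subseteq> {..<k}" and B0: "\<forall>i. B i \<subseteq> V" "\<forall>i j. i \<noteq> j \<longrightarrow> B i \<inter> B j = {}"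
        and Bad0: "real (card {y \<in> tuples V t. \<not> (distinct y \<and> (\<exists>i<k. set y \<in> ?F i \<and> count_list \<tau> i < card (set y \<inter> B i)))}) \<le> \<delta> * ?n ^ t"
        using block[THEN spec, THEN spec, THEN spec, THEN mp, OF counterexample_mono[OF ce d(1,3)]]
        by (elim exE conjE) (rule that)
      have BV: "B i \<subseteq> V" for i using B0(1) by blast
      have BB: "B i \<inter> B j = {}" if "i \<noteq> j" for i j using B0(2) that by blast
      define Bad where "Bad = {y \<in> tuples V t. \<not> (distinct y \<and> (\<exists>i<k. set y \<in> ?F i \<and> count_list \<tau> i < card (set y \<inter> B i)))}"
      have Bad: "Bad \<subseteq> tuples V t" "real (card Bad) \<le> \<delta> * ?n ^ t" using Bad0 by (auto simp: Bad_def)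
      have fBad: "finite Bad" using Bad(1) finite_tuples[OF V(1)] finite_subset by blast
      have fB: "finite (B j)" for j using BV V(1) finite_subset by blast
      have L: "real q * (real t - 1 + real k) < ?n + real k"
      proof -
        have "real (q * (t - 1 + k)) < real (card V + k)" using qn by (simp only: of_nat_less_iff)
        moreover have "real (t - 1) = real t - 1" using t by (simp add: of_nat_diff)
        ultimately show ?thesis by (simp only: of_nat_mult of_nat_add)
      qed
      have ct: "count_list \<tau> j + 1 \<le> t" for j using count_le_length[of \<tau> j] \<tau>(1) t by simp
      have n_le: "?n \<le> real q * (real t - 1 + real k) + \<beta> * ?n"
      proof -
        have ac: "almost_covered V t k ?F (\<lambda>_. q - 1) \<sigma>A"
          unfolding almost_covered_def using V(1) inv[OF d(2)] small U[OF d(2)] by (simp add: colour_class_def uncoloured_def, blast?)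
        have "?n \<le> (real t - 1) * real (q - 1) + (\<Sum>i<k. real (q - 1)) + \<beta> * ?n"
          using AT[THEN spec, THEN spec, THEN spec, THEN spec, THEN mp, OF ac, THEN mp, of "q - 1"] by simp
        also have "(real t - 1) * real (q - 1) + (\<Sum>i<k. real (q - 1)) \<le> (real t - 1) * real q + (\<Sum>i<k. real q)"
          using t1 by (intro add_mono mult_left_mono sum_mono) auto
        finally show ?thesis by (simp add: algebra_simps)
      qed
      have Bsize: "(real (count_list \<tau> j) + 1) * real q - 2 * real t * \<beta> * ?n \<le> real (card (B j))" if j: "j < k" for j
      proof -
        let ?a = "count_list \<tau> j + 1"
        define F' where "F' i = (if i = j then {e \<in> ?F j. count_list \<tau> j < card (e \<inter> B j)} else ?F i)" for i
        define m where "m i = (if i = j then min (q - 1) (card (B j) div ?a) else q - 1)" for i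
        have Fj: "matching_le (F' j) (card (B j) div ?a)" unfolding matching_le_def
        proof (intro allI impI)
          fix M assume M: "M \<subseteq> F' j" "pairwise disjnt M"
          have Mj: "M \<subseteq> {e \<in> ?F j. count_list \<tau> j < card (e \<inter> B j)}" using M(1) by (simp add: F'_def)
          have fM: "finite M"
            by (rule finite_subset[of _ "Pow V"]) (use Mj V in \<open>auto simp: colour_class_def\<close>)
          have "card M * ?a = (\<Sum>e\<in>M. ?a)" by simp
          also have "\<dots> \<le> (\<Sum>e\<in>M. card (e \<inter> B j))" using Mj by (intro sum_mono) auto
          also have "\<dots> = card (\<Union>e\<in>M. e \<inter> B j)"
            using M(2) fM fB by (subst card_UN_disjoint) (auto simp: pairwise_def disjnt_def)
          also have "\<dots> \<le> card (B j)" using fB by (intro card_mono) auto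
          finally show "card M \<le> card (B j) div ?a" by (simp add: less_eq_div_iff_mult_less_eq)
        qed
        have FF: "F' i \<subseteq> ?F i" for i by (auto simp: F'_def)
        have F: "\<forall>i<k. F' i \<subseteq> {e. e \<subseteq> V \<and> card e = t} \<and> matching_le (F' i) (m i)"
        proof (intro allI impI conjI)
          fix i assume i: "i < k"
          have "?F i \<subseteq> {e. e \<subseteq> V \<and> card e = t}" by (auto simp: colour_class_def)
          then show "F' i \<subseteq> {e. e \<subseteq> V \<and> card e = t}" using FF[of i] by (rule subset_trans[rotated])
          have Fi: "matching_le (?F i) (q - 1)" using small i by blast
          show "matching_le (F' i) (m i)" unfolding matching_le_def
          proof (intro allI impI)
            fix M assume M: "M \<subseteq> F' i" "pairwise disjnt M"
            have "M \<subseteq> ?F i" by (rule subset_trans[OF M(1) FF])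
            then have 1: "card M \<le> q - 1" using Fi M(2) unfolding matching_le_def by blast
            show "card M \<le> m i"
            proof (cases "i = j")
              case True
              then have "card M \<le> card (B j) div ?a" using Fj M unfolding matching_le_def by blast
              then show ?thesis using 1 True by (simp add: m_def)
            qed (use 1 in \<open>simp add: m_def\<close>)
          qed
        qed
        have "{y \<in> tuples V t. \<not> (\<exists>i<k. set y \<in> F' i)} \<subseteq> Bad"
          unfolding Bad_def F'_def by auto
        then have "card {y \<in> tuples V t. \<not> (\<exists>i<k. set y \<in> F' i)} \<le> card Bad" by (rule card_mono[OF fBad])
        moreover have "\<delta> * ?n ^ t \<le> \<sigma>A * ?n ^ t" using \<delta> by (intro mult_right_mono) auto
        ultimately have "real (card {y \<in> tuples V t. \<not> (\<exists>i<k. set y \<in> F' i)}) \<le> \<sigma>A * ?n ^ t" using Bad(2) by linarith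
        then have ac: "almost_covered V t k F' m \<sigma>A"
          unfolding almost_covered_def using V(1) inv[OF d(2)] F by blast
        have "\<forall>i<k. m i \<le> q - 1" by (simp add: m_def)
        then have "?n \<le> (real t - 1) * real (q - 1) + (\<Sum>i<k. real (m i)) + \<beta> * ?n"
          by (rule AT[THEN spec, THEN spec, THEN spec, THEN spec, THEN mp, OF ac, THEN mp])
        moreover have "(\<Sum>i<k. real (m i)) \<le> (real k - 1) * real q + real (card (B j)) / real ?a"
        proof -
          have 1: "(\<Sum>i<k. real (m i)) = real (m j) + (\<Sum>i\<in>{..<k} - {j}. real (m i))" using j by (subst sum.remove[of _ j]) auto
          have "(\<Sum>i\<in>{..<k} - {j}. real (m i)) \<le> (\<Sum>i\<in>{..<k} - {j}. real q)" by (intro sum_mono) (auto simp: m_def)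
          also have "\<dots> = (real k - 1) * real q" using j k by (simp add: of_nat_diff)
          finally have 2: "(\<Sum>i\<in>{..<k} - {j}. real (m i)) \<le> (real k - 1) * real q" .
          have "m j * ?a \<le> card (B j) div ?a * ?a" by (rule mult_le_mono1) (simp add: m_def)
          also have "\<dots> \<le> card (B j)" by (rule div_times_less_eq_dividend)
          finally have "real (m j) * real ?a \<le> real (card (B j))" by (simp only: of_nat_le_iff flip: of_nat_mult)
          moreover have "real ?a > 0" by simp
          ultimately have "real (m j) \<le> real (card (B j)) / real ?a" by (simp only: pos_le_divide_eq)
          then show ?thesis using 1 2 by linarith
        qed
        moreover have "(real t - 1) * real (q - 1) \<le> (real t - 1) * real q" using t1 by (intro mult_left_mono) auto
        ultimately have "real q - 2 * \<beta> * ?n \<le> real (card (B j)) / real ?a"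
          using L kn by (simp add: algebra_simps)
        then have "real ?a * (real q - 2 * \<beta> * ?n) \<le> real (card (B j))"
          by (simp add: pos_le_divide_eq mult.commute)
        moreover have "real ?a * (2 * \<beta> * ?n) \<le> real t * (2 * \<beta> * ?n)"
          using ct[of j] \<beta> n by (intro mult_right_mono) auto
        ultimately show ?thesis by (simp add: algebra_simps)
      qed
      let ?atyp = "\<lambda>u. \<exists>c<t. \<beta> * ?n ^ (t - 1) < real (card {y \<in> Bad. y ! c = u})"
      define NT where "NT = {u \<in> V. ?atyp u}"
      have fNT: "finite NT" using V(1) by (simp add: NT_def)
      have NT: "real (card NT) \<le> t * \<beta> * ?n"
      proof -
        have "\<delta> * ?n ^ t \<le> \<beta>\<^sup>2 * ?n ^ t" using \<delta> by (intro mult_right_mono) auto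
        then have "real (card Bad) \<le> \<beta>\<^sup>2 * ?n ^ t" using Bad(2) by linarith
        then show ?thesis unfolding NT_def by (rule few_atypical_vertices[OF V(1) t \<beta>(1) Bad(1)])
      qed
      define T where "T j = B j - NT" for j
      have fT: "finite (T j)" for j using fB by (simp add: T_def)
      have Tsize: "(real (count_list \<tau> j) + 1) * real q - 3 * (real t * \<beta>) * ?n \<le> real (card (T j))" if j: "j < k" for j
      proof -
        have "card (B j) - card NT \<le> card (T j)" unfolding T_def by (rule diff_card_le_card_Diff[OF fNT])
        then have "real (card (B j)) - real (card NT) \<le> real (card (T j))" by linarith
        then show ?thesis using Bsize[OF j] NT by (simp add: algebra_simps)
      qed
      have t\<beta>n: "3 * (real t * \<beta>) * ?n \<le> \<gamma> / 2 * ?n"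
        using t\<beta> \<mu>(1,2) n by (intro mult_right_mono) auto
      have Tq: "real (count_list \<tau> j) * real q + \<gamma> / 2 * ?n \<le> real (card (T j))" if j: "j < k" for j
        using Tsize[OF j] t\<beta>n q by (simp add: algebra_simps)
      define X where "X = V - (\<Union>j<k. T j)"
      have Xsize: "real (card X) \<le> \<xi> * ?n"
      proof -
        have "X \<subseteq> (V - (\<Union>j<k. B j)) \<union> NT" by (auto simp: X_def T_def)
        then have "card X \<le> card ((V - (\<Union>j<k. B j)) \<union> NT)" using V(1) fNT by (intro card_mono) auto
        also have "\<dots> \<le> card (V - (\<Union>j<k. B j)) + card NT" by (rule card_Un_le)
        finally have 1: "real (card X) \<le> real (card (V - (\<Union>j<k. B j))) + real (card NT)" by linarith
        have UB: "(\<Union>j<k. B j) \<subseteq> V" using BV by blast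
        have "card (\<Union>j<k. B j) = (\<Sum>j<k. card (B j))" using fB BB by (intro card_UN_disjoint) auto
        then have "real (card (V - (\<Union>j<k. B j))) = ?n - (\<Sum>j<k. real (card (B j)))"
          using UB V(1) fB card_mono[OF V(1) UB] by (subst card_Diff_subset) (auto simp: of_nat_diff)
        also have "\<dots> \<le> ?n - (\<Sum>j<k. (real (count_list \<tau> j) + 1) * real q - 2 * real t * \<beta> * ?n)"
          using Bsize by (intro diff_left_mono sum_mono) auto
        also have "(\<Sum>j<k. (real (count_list \<tau> j) + 1) * real q - 2 * real t * \<beta> * ?n)
          = (\<Sum>j<k. real (count_list \<tau> j) + 1) * real q - real k * (2 * real t * \<beta> * ?n)"
          by (simp add: sum_subtractf flip: sum_distrib_right)
        also have "(\<Sum>j<k. real (count_list \<tau> j) + 1) = real t - 1 + real k"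
        proof -
          have "real (\<Sum>j<k. count_list \<tau> j) = real (t - 1)" using sum_count_set[OF \<tau>(2)] \<tau>(1) by simp
          then show ?thesis using t by (simp add: sum.distrib of_nat_diff)
        qed
        finally have "real (card (V - (\<Union>j<k. B j))) \<le> \<beta> * ?n + real k * (2 * real t * \<beta> * ?n)"
          using n_le by (simp add: algebra_simps)
        then have "real (card X) \<le> \<beta> * ?n + real k * (2 * real t * \<beta> * ?n) + real t * \<beta> * ?n" using 1 NT by linarith
        also have "\<dots> = \<beta> * D * ?n" by (simp add: D_def algebra_simps)
        finally show ?thesis by (simp add: \<beta>(2))
      qed
      define p0 where "p0 = nat \<lfloor>\<xi> * ?n\<rfloor>"
      have p0: "card X \<le> p0" "real p0 \<le> \<xi> * ?n"
      proof -
        show "card X \<le> p0" using Xsize unfolding p0_def by (simp add: le_nat_floor)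
        show "real p0 \<le> \<xi> * ?n" using \<xi> n by (simp add: p0_def)
      qed
      have p0q: "real p0 + \<gamma> / 2 * ?n \<le> real q"
      proof -
        have "\<xi> * ?n \<le> \<gamma> / 2 * ?n" using \<xi>1 \<mu>(1,2) n by (intro mult_right_mono) auto
        then show ?thesis using p0(2) q by linarith
      qed
      have gn: "0 < \<gamma> / 2 * ?n" using \<gamma> n by simp
      have "\<exists>i<k. \<exists>N. N \<subseteq> ?F i \<and> pairwise disjnt N \<and> card N = q"
      proof (rule matching_completion[OF V(1) t \<tau> BB _ _ Bad_def _ X_def p0(1) _ _ _ _ qn])
        show "T j \<subseteq> B j" for j by (auto simp: T_def)
        show "T j \<subseteq> V" for j using BV by (auto simp: T_def)
        show "real (card {y \<in> Bad. y ! c = u}) \<le> \<beta> * ?n ^ (t - 1)" if "j < k" "u \<in> T j" "c < t" for j c u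
        proof -
          have "u \<in> V" "u \<notin> NT" using that(2) BV by (auto simp: T_def)
          then have "\<not> ?atyp u" unfolding NT_def by blast
          then have "\<not> \<beta> * ?n ^ (t - 1) < real (card {y \<in> Bad. y ! c = u})" using that(3) by blast
          then show ?thesis by (simp only: not_less)
        qed
        show "p0 < q" using p0q gn by linarith
        show "count_list \<tau> j * q \<le> card (T j)" if "j < k" for j
        proof -
          have "real (count_list \<tau> j * q) \<le> real (card (T j))" using Tq[OF that] gn by simp
          then show ?thesis by (simp only: of_nat_le_iff)
        qed
        show "real t * (\<beta> * ?n ^ (t - 1)) + real (t * (t - 1) * m ^ (t - 1 - 1)) < real (m ^ (t - 1))" if m: "q - p0 \<le> m" for m
        proof -
          have mn: "\<gamma> / 2 * ?n \<le> real m" using m p0q by linarith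
          then have "(\<gamma> / 2 * ?n) ^ s \<le> real m ^ s" using gn by (intro power_mono) auto
          then have ms: "g0 * ?n ^ s \<le> real m ^ s" by (simp only: g0_def power_mult_distrib)
          have "4 * (real t * \<beta> * ?n ^ s) \<le> g0 * ?n ^ s"
            using t\<beta> \<mu>(1,4) mult_right_mono[of "4 * (real t * \<beta>)" g0 "?n ^ s"] by simp
          then have 1: "4 * (real t * \<beta> * ?n ^ s) \<le> real m ^ s" using ms by linarith
          have m0: "real m > 0" using mn gn by linarith
          have 2: "4 * (real t * (real t - 1) * real m ^ (s - 1)) \<le> real m ^ s"
          proof (cases "s = 0")
            case True
            then have "t = 1" using t by (simp add: s_def)
            then show ?thesis by simp
          next
            case False
            have "4 * (real t * (real t - 1)) \<le> 4 * real t ^ 2" using t1 by (simp add: power2_eq_square algebra_simps)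
            also have "\<dots> \<le> real m" using tn mn by linarith
            finally have "4 * (real t * (real t - 1)) * real m ^ (s - 1) \<le> real m * real m ^ (s - 1)"
              by (intro mult_right_mono) auto
            also have "\<dots> = real m ^ s" using False by (simp flip: power_Suc)
            finally show ?thesis by simp
          qed
          have 3: "real (t * (t - 1) * m ^ (s - 1)) = real t * (real t - 1) * real m ^ (s - 1)"
            using t by (simp add: of_nat_diff)
          have "0 < real m ^ s" using m0 by simp
          then have "real t * \<beta> * ?n ^ s + real t * (real t - 1) * real m ^ (s - 1) < real m ^ s" using 1 2 by linarith
          then have "real t * (\<beta> * ?n ^ s) + real (t * (t - 1) * m ^ (s - 1)) < real (m ^ s)"
            unfolding 3 of_nat_power by (simp only: mult.assoc)
          then show ?thesis by (simp only: s_def)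
        qed
        show "\<exists>i<k. (t - 1) * (p0 * (t - 1)) * card V ^ (t - 1 - 1)
          < card {y \<in> tuples V (t - 1). (\<forall>l<t - 1. y ! l \<in> T (\<tau> ! l)) \<and> set (v # y) \<in> ?F i}" if v: "v \<in> X" for v
        proof (rule ccontr)
          assume no: "\<not> ?thesis"
          let ?c0 = "(t - 1) * (p0 * (t - 1)) * card V ^ (t - 1 - 1)"
          let ?Y = "{y \<in> tuples V (t - 1). \<forall>l<t - 1. y ! l \<in> T (\<tau> ! l)}"
          let ?Yi = "\<lambda>i. {y \<in> tuples V (t - 1). (\<forall>l<t - 1. y ! l \<in> T (\<tau> ! l)) \<and> set (v # y) \<in> ?F i}"
          let ?U = "{y \<in> tuples V (t - 1). v # y \<in> uncoloured V t k col}"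
          have vV: "v \<in> V" using v by (simp add: X_def)
          have fin: "finite (tuples V (t - 1))" by (rule finite_tuples[OF V(1)])
          have "?Y = listset (map T \<tau>)"
          proof (intro set_eqI iffI)
            fix y assume "y \<in> listset (map T \<tau>)"
            then have y: "length y = t - 1" "\<And>l. l < t - 1 \<Longrightarrow> y ! l \<in> T (\<tau> ! l)" using \<tau>(1) by (auto simp: listset_iff)
            have "T j \<subseteq> V" for j using BV by (auto simp: T_def)
            then have "set y \<subseteq> V" using y by (fastforce simp: in_set_conv_nth)
            then show "y \<in> ?Y" using y by (simp add: tuples_def)
          qed (use \<tau>(1) in \<open>auto simp: listset_iff tuples_def\<close>)
          moreover have "(\<gamma> / 2 * ?n) ^ length (map T \<tau>) \<le> card (listset (map T \<tau>))"
          proof (rule power_le_card_listset)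
            fix A assume "A \<in> set (map T \<tau>)"
            then obtain j where j: "j \<in> set \<tau>" "A = T j" by auto
            then have "j < k" using \<tau>(2) by auto
            then have "real (count_list \<tau> j) * real q + \<gamma> / 2 * ?n \<le> real (card A)" using Tq[of j] j(2) by simp
            moreover have "0 \<le> real (count_list \<tau> j) * real q" by simp
            ultimately have "\<gamma> / 2 * ?n \<le> real (card A)" by linarith
            then show "finite A \<and> \<gamma> / 2 * ?n \<le> real (card A)" using fT j(2) by simp
          qed (use gn in simp)
          moreover have "(\<gamma> / 2 * ?n) ^ length (map T \<tau>) = g0 * ?n ^ s"
            by (simp only: g0_def s_def power_mult_distrib length_map \<tau>(1))
          ultimately have Yge: "g0 * ?n ^ s \<le> real (card ?Y)" by simp
          have "?Y \<subseteq> (\<Union>i<k. ?Yi i) \<union> ?U"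
          proof
            fix y assume y: "y \<in> ?Y"
            then have "v # y \<in> tuples V t" using vV t by (auto simp: tuples_def)
            then show "y \<in> (\<Union>i<k. ?Yi i) \<union> ?U" using y by (auto simp: uncoloured_def)
          qed
          then have "card ?Y \<le> card ((\<Union>i<k. ?Yi i) \<union> ?U)" using fin by (intro card_mono) auto
          also have "\<dots> \<le> card (\<Union>i<k. ?Yi i) + card ?U" by (rule card_Un_le)
          also have "card (\<Union>i<k. ?Yi i) \<le> (\<Sum>i<k. card (?Yi i))" by (rule card_UN_le) simp
          also have "\<dots> \<le> (\<Sum>i<k. ?c0)"
          proof (rule sum_mono)
            fix i assume "i \<in> {..<k}"
            then have "\<not> ?c0 < card (?Yi i)" using no by blast
            then show "card (?Yi i) \<le> ?c0" by (simp only: not_less)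
          qed
          finally have "card ?Y \<le> k * ?c0 + card ?U" by simp
          then have "real (card ?Y) \<le> real (k * ?c0 + card ?U)" by (simp only: of_nat_le_iff)
          then have Yle: "real (card ?Y) \<le> real k * real ?c0 + real (card ?U)" by simp
          have Ule: "real (card ?U) \<le> g0 / 2 * ?n ^ s"
          proof -
            have "real (card ?U) \<le> d * ?n ^ s" using deg vV by (simp add: s_def)
            also have "\<dots> \<le> g0 / 2 * ?n ^ s" using d(5) by (intro mult_right_mono) auto
            finally show ?thesis .
          qed
          have ns: "?n ^ s > 0" using n by simp
          have c0: "real ?c0 \<le> \<alpha> / 16 * ?n ^ s"
          proof (cases "s = 0")
            case True
            then have "t - 1 = 0" by (simp add: s_def)
            then show ?thesis using \<alpha> by (simp add: s_def)
          next
            case False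
            have "real ?c0 = (real s) ^ 2 * real p0 * ?n ^ (s - 1)" by (simp add: s_def power2_eq_square)
            also have "\<dots> \<le> (real t) ^ 2 * (\<xi> * ?n) * ?n ^ (s - 1)"
              using p0(2) by (intro mult_right_mono mult_mono power_mono) (auto simp: s_def)
            also have "\<dots> = (real t ^ 2 * \<xi>) * ?n ^ Suc (s - 1)" by simp
            also have "\<dots> \<le> \<alpha> / 16 * ?n ^ Suc (s - 1)" using t\<xi> \<mu>(3) by (intro mult_right_mono) auto
            finally show ?thesis using False by simp
          qed
          then have "real k * real ?c0 \<le> real k * (\<alpha> / 16 * ?n ^ s)" by (intro mult_left_mono) auto
          also have "\<dots> = g0 / 32 * ?n ^ s" using k1 by (simp add: \<alpha>_def)
          finally have "g0 * ?n ^ s \<le> g0 / 32 * ?n ^ s + g0 / 2 * ?n ^ s" using Yge Yle Ule by linarith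
          moreover have "0 < g0 * ?n ^ s" using g0 ns by simp
          ultimately show False by simp
        qed
      qed
      then show False using contra by blast
    qed
  qed
qed

section \<open>The chromatic number\<close>

lemma stable_kneser_vertices:
  "fst (stable_kneser_hypergraph q n t s) = {A. A \<subseteq> {1..n} \<and> card A = t \<and> stable n s A}"
  by (auto simp: stable_kneser_hypergraph_def induced_subhypergraph_def kneser_hypergraph_def subsets_of_size_def)

lemma stable_kneser_edges:
  "snd (stable_kneser_hypergraph q n t s) =
     {e. (\<forall>A\<in>e. A \<subseteq> {1..n} \<and> card A = t \<and> stable n s A) \<and> card e = q \<and> pairwise disjnt e}"
  by (auto simp: stable_kneser_hypergraph_def induced_subhypergraph_def kneser_hypergraph_def subsets_of_size_def)

text \<open>Sets with the same colour below the last one have their minima in one block of \<open>q - 1\<close> points;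
sets of the last colour avoid the first \<open>N - 1\<close> blocks.\<close>

lemma kneser_colouring_exists:
  assumes t: "t \<ge> 1" and q: "q \<ge> 2" and N: "N \<ge> 1" and nN: "n < t * q + (N - 1) * (q - 1)"
  shows "\<exists>f. proper_colouring (stable_kneser_hypergraph q n t s) N f"
proof -
  define f where "f A = min ((Min A - 1) div (q - 1)) (N - 1)" for A :: "nat set"
  have "\<not> (\<exists>a. \<forall>A\<in>e. f A = a)" if e: "e \<in> snd (stable_kneser_hypergraph q n t s)" for e
  proof
    assume "\<exists>a. \<forall>A\<in>e. f A = a"
    then obtain a where a: "\<And>A. A \<in> e \<Longrightarrow> f A = a" by blast
    have e': "\<And>A. A \<in> e \<Longrightarrow> A \<subseteq> {1..n} \<and> card A = t" "card e = q" "pairwise disjnt e"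
      using e by (auto simp: stable_kneser_edges)
    have fin: "finite A" "A \<noteq> {}" if "A \<in> e" for A
      using e'(1)[OF that] t finite_subset[of A "{1..n}"] by auto
    have Min: "Min A \<in> A" if "A \<in> e" for A using fin[OF that] by (rule Min_in)
    have Min1: "1 \<le> Min A" if "A \<in> e" for A using Min[OF that] e'(1)[OF that] by auto
    have fe: "finite e" using e'(2) q by (metis card.infinite not_numeral_le_zero)
    show False
    proof (cases "a < N - 1")
      case True
      have "inj_on Min e"
      proof (rule inj_onI, rule ccontr)
        fix A B assume AB: "A \<in> e" "B \<in> e" "Min A = Min B" "A \<noteq> B"
        then have "A \<inter> B = {}" using e'(3) by (auto simp: pairwise_def disjnt_def)
        then show False using Min[OF AB(1)] Min[OF AB(2)] AB(3) by auto
      qed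
      then have "card (Min ` e) = q" using e'(2) by (simp add: card_image)
      moreover have "Min ` e \<subseteq> {a * (q - 1) + 1..a * (q - 1) + (q - 1)}"
      proof
        fix x assume "x \<in> Min ` e"
        then obtain A where A: "A \<in> e" "x = Min A" by blast
        have "(x - 1) div (q - 1) = a" using a[OF A(1)] True A(2) by (auto simp: f_def min_def split: if_splits)
        then have "x - 1 = a * (q - 1) + (x - 1) mod (q - 1)" using div_mult_mod_eq[of "x - 1" "q - 1"] by simp
        moreover have "(x - 1) mod (q - 1) < q - 1" using q by simp
        ultimately have "a * (q - 1) \<le> x - 1" "x - 1 < a * (q - 1) + (q - 1)" by linarith+
        then show "x \<in> {a * (q - 1) + 1..a * (q - 1) + (q - 1)}" using Min1[OF A(1)] A(2) by auto
      qed
      then have "card (Min ` e) \<le> card {a * (q - 1) + 1..a * (q - 1) + (q - 1)}" by (intro card_mono) auto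
      ultimately show False using q by simp
    next
      case False
      have sub: "A \<subseteq> {(N - 1) * (q - 1) + 1..n}" if A: "A \<in> e" for A
      proof
        fix x assume x: "x \<in> A"
        have "N - 1 \<le> (Min A - 1) div (q - 1)" using a[OF A] False by (auto simp: f_def min_def split: if_splits)
        then have "(N - 1) * (q - 1) \<le> (Min A - 1) div (q - 1) * (q - 1)" by (rule mult_le_mono1)
        also have "\<dots> \<le> Min A - 1" by (rule div_times_less_eq_dividend)
        finally have "(N - 1) * (q - 1) + 1 \<le> Min A" using Min1[OF A] by linarith
        also have "\<dots> \<le> x" using fin(1)[OF A] x by (rule Min_le)
        finally show "x \<in> {(N - 1) * (q - 1) + 1..n}" using e'(1)[OF A] x by auto
      qed
      have "card (\<Union>e) = (\<Sum>A\<in>e. card A)" using e'(3) fin by (intro card_Union_disjoint) auto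
      also have "\<dots> = q * t" using e' by simp
      finally have "card (\<Union>e) = q * t" .
      moreover have "card (\<Union>e) \<le> card {(N - 1) * (q - 1) + 1..n}" using sub by (intro card_mono) auto
      ultimately have "q * t \<le> n - (N - 1) * (q - 1)" by simp
      moreover have "n < q * t + (N - 1) * (q - 1)" using nN by (simp only: mult.commute[of t])
      moreover have "q * t > 0" using q t by simp
      ultimately show False by linarith
    qed
  qed
  moreover have "f A < N" for A using N by (simp add: f_def min_less_iff_disj)
  ultimately show ?thesis unfolding proper_colouring_def by (intro exI[of _ f]) auto
qed

lemma card_cyclically_close_le:
  assumes v: "v \<in> {1..n}"
  shows "card {u \<in> {1..n}. cyclic_dist n v u < int s} \<le> 4 * s"
proof -
  have "{u \<in> {1..n}. cyclic_dist n v u < int s} \<subseteq> {v + 1 - s..<v + s} \<union> {n + 1 - s..n} \<union> {1..s}"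
    using v by (auto simp: cyclic_dist_def min_def split: if_splits)
  then have "card {u \<in> {1..n}. cyclic_dist n v u < int s} \<le> card ({v + 1 - s..<v + s} \<union> {n + 1 - s..n} \<union> {1..s})"
    by (intro card_mono) auto
  also have "\<dots> \<le> card {v + 1 - s..<v + s} + card {n + 1 - s..n} + card {1..s}"
    using card_Un_le[of "{v + 1 - s..<v + s}" "{n + 1 - s..n}"]
      card_Un_le[of "{v + 1 - s..<v + s} \<union> {n + 1 - s..n}" "{1..s}"] by linarith
  also have "\<dots> \<le> 4 * s" by auto
  finally show ?thesis .
qed

text \<open>A tuple fails to be a stable set only if two of its entries are cyclically close; repeated entries
are close as well because \<open>s \<ge> 1\<close>.\<close>

lemma few_unstable_extensions:
  assumes v: "v \<in> {1..n}" and s: "s \<ge> 1" and t: "t \<ge> 1"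
    and U: "U \<subseteq> {y \<in> tuples {1..n} (t - 1). \<not> (distinct (v # y) \<and> stable n s (set (v # y)))}"
  shows "card U \<le> t * (t - 1) * (4 * s) * n ^ (t - 1 - 1)"
proof -
  let ?V = "{1..n}" and ?R = "\<lambda>x y. cyclic_dist n x y < int s"
  define C where "C = {y \<in> tuples ?V (t - 1). \<exists>i<t - 1. \<exists>j<t - 1. i \<noteq> j \<and> ?R (y ! i) (y ! j)}"
  define H where "H = {y \<in> tuples ?V (t - 1). set y \<inter> {u \<in> ?V. ?R v u} \<noteq> {}}"
  have sym: "cyclic_dist n x y = cyclic_dist n y x" for x y by (simp add: cyclic_dist_def abs_minus_commute)
  have self: "cyclic_dist n x x < int s" for x using s by (simp add: cyclic_dist_def)
  have "U \<subseteq> C \<union> H"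
  proof
    fix y assume "y \<in> U"
    then have y: "y \<in> tuples ?V (t - 1)" "\<not> (distinct (v # y) \<and> stable n s (set (v # y)))" using U by auto
    have ly: "length y = t - 1" "set y \<subseteq> ?V" using y(1) by (auto simp: tuples_def)
    show "y \<in> C \<union> H"
    proof (rule ccontr)
      assume not: "y \<notin> C \<union> H"
      have vy: "\<not> ?R v u" if "u \<in> set y" for u
      proof
        assume "?R v u"
        then have "u \<in> set y \<inter> {u \<in> ?V. ?R v u}" using that ly(2) by blast
        then have "y \<in> H" using y(1) unfolding H_def by blast
        then show False using not by blast
      qed
      have yy: "\<not> ?R (y ! i) (y ! j)" if "i < t - 1" "j < t - 1" "i \<noteq> j" for i j using not y(1) that by (auto simp: C_def)
      have "distinct y" unfolding distinct_conv_nth using yy self ly(1) by metis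
      moreover have "v \<notin> set y" using vy self by blast
      moreover have "int s \<le> cyclic_dist n x u" if xu: "x \<in> set (v # y)" "u \<in> set (v # y)" "x \<noteq> u" for x u
      proof -
        consider "x = v" "u \<in> set y" | "u = v" "x \<in> set y" | "x \<in> set y" "u \<in> set y" using xu by auto
        then show ?thesis
        proof cases
          case 1 then show ?thesis using vy[of u] by simp
        next
          case 2 then show ?thesis using vy[of x] sym[of x u] by simp
        next
          case 3
          then obtain i j where "i < t - 1" "j < t - 1" "x = y ! i" "u = y ! j" using ly(1) by (metis in_set_conv_nth)
          then show ?thesis using yy[of i j] xu(3) by force
        qed
      qed
      ultimately show False using y(2) by (simp add: stable_def)
    qed
  qed
  moreover have "finite (C \<union> H)" by (simp add: C_def H_def finite_tuples)
  ultimately have "card U \<le> card (C \<union> H)" by (rule card_mono[rotated])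
  also have "\<dots> \<le> card C + card H" by (rule card_Un_le)
  also have "card C \<le> (t - 1)\<^sup>2 * (4 * s) * card ?V ^ (t - 1 - 1)"
    unfolding C_def by (rule card_colliding_tuples_le) (use card_cyclically_close_le in auto)
  also have "card H \<le> (t - 1) * card {u \<in> ?V. ?R v u} * card ?V ^ (t - 1 - 1)"
    unfolding H_def by (rule card_hitting_tuples_le) auto
  also have "(t - 1) * card {u \<in> ?V. ?R v u} * card ?V ^ (t - 1 - 1) \<le> (t - 1) * (4 * s) * card ?V ^ (t - 1 - 1)"
    by (intro mult_le_mono order_refl card_cyclically_close_le[OF v])
  finally have le: "card U \<le> (t - 1)\<^sup>2 * (4 * s) * n ^ (t - 1 - 1) + (t - 1) * (4 * s) * n ^ (t - 1 - 1)" by simp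
  have "(t - 1)\<^sup>2 + (t - 1) = t * (t - 1)" using t by (cases t) (auto simp: power2_eq_square)
  then have "(t - 1)\<^sup>2 * (4 * s) * n ^ (t - 1 - 1) + (t - 1) * (4 * s) * n ^ (t - 1 - 1) = t * (t - 1) * (4 * s) * n ^ (t - 1 - 1)"
    by (metis add_mult_distrib)
  then show ?thesis using le by simp
qed

text \<open>Unstable sets are treated as uncoloured. The constant \<open>d / (4 * t)\<close> is chosen such that, by
\<open>t * q \<le> n\<close>, at most the proportion \<open>d\<close> of the tuples extending a vertex is unstable.\<close>

lemma no_proper_colouring:
  fixes d \<gamma> :: real
  assumes matching: "\<And>(V :: nat set) col q. finite V \<Longrightarrow> 1 / d \<le> real (card V) \<Longrightarrow> \<gamma> * real (card V) \<le> real q \<Longrightarrow>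
     q * (t - 1 + k) < card V + k \<Longrightarrow>
     (\<forall>v\<in>V. real (card {y \<in> tuples V (t - 1). v # y \<in> uncoloured V t k col}) \<le> d * real (card V) ^ (t - 1)) \<Longrightarrow>
     (\<exists>i<k. \<exists>N. N \<subseteq> colour_class V t col i \<and> pairwise disjnt N \<and> card N = q)"
    and t: "t \<ge> 2" and n: "1 / d \<le> real n" "n \<ge> 1" and q: "\<gamma> * real n \<le> real q" "q * (t - 1 + k) < n + k" "t * q \<le> n"
    and s: "s \<ge> 1" "real s \<le> d / (4 * t) * real q"
  shows "\<not> proper_colouring (stable_kneser_hypergraph q n t s) k f"
proof
  assume f: "proper_colouring (stable_kneser_hypergraph q n t s) k f"
  let ?V = "{1..n}"
  define col where "col A = (if stable n s A then f A else k)" for A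
  have fk: "f A < k" if "A \<subseteq> ?V" "card A = t" "stable n s A" for A
    using f that unfolding proper_colouring_def stable_kneser_vertices by auto
  have deg: "real (card {y \<in> tuples ?V (t - 1). v # y \<in> uncoloured ?V t k col}) \<le> d * real n ^ (t - 1)" if v: "v \<in> ?V" for v
  proof -
    let ?U = "{y \<in> tuples ?V (t - 1). v # y \<in> uncoloured ?V t k col}"
    have "?U \<subseteq> {y \<in> tuples ?V (t - 1). \<not> (distinct (v # y) \<and> stable n s (set (v # y)))}"
    proof clarify
      fix y assume y: "y \<in> tuples ?V (t - 1)" "v # y \<in> uncoloured ?V t k col" and st: "distinct (v # y)" "stable n s (set (v # y))"
      have A: "set (v # y) \<subseteq> ?V" using y(1) v unfolding tuples_def by auto
      have c: "card (set (v # y)) = t" using distinct_card[OF st(1)] y(1) t by (simp add: tuples_def)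
      have "col (set (v # y)) < k" using fk[OF A c st(2)] st(2) by (simp add: col_def)
      then have "\<exists>i<k. set (v # y) \<in> colour_class ?V t col i" using A c by (simp add: colour_class_def)
      then show False using y(2) unfolding uncoloured_def by blast
    qed
    then have "card ?U \<le> t * (t - 1) * (4 * s) * n ^ (t - 1 - 1)"
      using t by (intro few_unstable_extensions[OF v s(1)]) auto
    then have "real (card ?U) \<le> real (t * (t - 1) * (4 * s) * n ^ (t - 1 - 1))" by (simp only: of_nat_le_iff)
    also have "\<dots> = real t * real (t - 1) * (4 * real s) * real n ^ (t - 1 - 1)" by simp
    also have "\<dots> \<le> real t * real t * (4 * real s) * real n ^ (t - 1 - 1)"
      by (intro mult_right_mono mult_left_mono) auto
    also have "\<dots> \<le> real t * real t * (4 * (d / (4 * t) * real q)) * real n ^ (t - 1 - 1)"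
      using s(2) by (intro mult_right_mono mult_left_mono) auto
    also have "\<dots> = d * real (t * q) * real n ^ (t - 1 - 1)" using t by (simp add: field_simps)
    also have "\<dots> \<le> d * real n * real n ^ (t - 1 - 1)"
    proof -
      have "0 \<le> d"
      proof (rule ccontr)
        assume "\<not> 0 \<le> d"
        then have "d / (4 * t) * real q \<le> 0" using t by (simp add: divide_nonpos_pos mult_nonpos_nonneg)
        then show False using s by linarith
      qed
      moreover have "real (t * q) \<le> real n" using q(3) by (simp only: of_nat_le_iff)
      ultimately show ?thesis by (intro mult_right_mono mult_left_mono) auto
    qed
    also have "\<dots> = d * real n ^ Suc (t - 1 - 1)" by simp
    also have "Suc (t - 1 - 1) = t - 1" using t by simp
    finally show ?thesis .
  qed
  obtain i N where i: "i < k" and N: "N \<subseteq> colour_class ?V t col i" "pairwise disjnt N" "card N = q"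
    using matching[of ?V q col] n q deg by auto
  have st: "stable n s A \<and> f A = i" if "A \<in> N" for A
  proof -
    have "col A = i" using N(1) that by (auto simp: colour_class_def)
    then show ?thesis using i by (auto simp: col_def split: if_splits)
  qed
  have "N \<in> snd (stable_kneser_hypergraph q n t s)"
    using N st unfolding stable_kneser_edges by (auto simp: colour_class_def)
  moreover have "\<forall>e\<in>snd (stable_kneser_hypergraph q n t s). \<not> (\<exists>a. \<forall>v\<in>e. f v = a)"
    using f by (simp add: proper_colouring_def)
  ultimately have "\<not> (\<exists>a. \<forall>v\<in>N. f v = a)" by (rule bspec[rotated])
  then show False using st by blast
qed

theorem theorem1p5:
  fixes t :: nat and \<gamma> :: real
  assumes "t \<ge> 2" and "\<gamma> > 0"
  shows "\<exists>c::real. c > 0 \<and>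
    (\<forall>(q :: nat \<Rightarrow> nat) (s :: nat \<Rightarrow> nat).
       (\<forall>\<^sub>F n in sequentially.
          q n \<ge> 2 \<and> s n \<ge> 1 \<and> \<gamma> * real n \<le> real (q n) \<and> t * q n \<le> n
            \<and> real (s n) \<le> c * real (q n))
       \<longrightarrow>
       (\<forall>\<^sub>F n in sequentially.
          int (chromatic_number (stable_kneser_hypergraph (q n) n t (s n)))
            = \<lceil>(real n - real (q n) * (real t - 1)) / (real (q n) - 1)\<rceil>))"
proof -
  \<comment> \<open>\<open>K\<close> bounds the number of colours, so finitely many constants have to be combined\<close>
  define K where "K = nat \<lceil>2 / \<gamma>\<rceil>"
  define P where "P k d \<longleftrightarrow> (\<forall>(V :: nat set) col q. finite V \<longrightarrow> 1 / d \<le> real (card V) \<longrightarrow> \<gamma> * real (card V) \<le> real q \<longrightarrow>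
     q * (t - 1 + k) < card V + k \<longrightarrow>
     (\<forall>v\<in>V. real (card {y \<in> tuples V (t - 1). v # y \<in> uncoloured V t k col}) \<le> d * real (card V) ^ (t - 1)) \<longrightarrow>
     (\<exists>i<k. \<exists>N. N \<subseteq> colour_class V t col i \<and> pairwise disjnt N \<and> card N = q))" for k and d :: real
  have "\<forall>k\<in>{1..K}. \<exists>d. d > 0 \<and> P k d"
    using monochromatic_matching[OF _ _ assms(2), of t, where 'a = nat] assms(1) unfolding P_def by auto
  from bchoice[OF this] obtain dk where dk: "\<forall>k\<in>{1..K}. dk k > 0 \<and> P k (dk k)" ..
  define d where "d = Min (insert 1 (dk ` {1..K}))"
  have d: "d > 0" unfolding d_def using dk by (subst Min_gr_iff) auto
  have d_le: "d \<le> dk k" if "k \<in> {1..K}" for k unfolding d_def using that by (intro Min_le) auto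
  have Pd: "P k d" if k: "k \<in> {1..K}" for k
  proof -
    have "dk k > 0" "P k (dk k)" using dk k by auto
    show ?thesis unfolding P_def
    proof (intro allI impI)
      fix V :: "nat set" and col and q :: nat
      assume V: "finite V" "1 / d \<le> real (card V)" and q: "\<gamma> * real (card V) \<le> real q" "q * (t - 1 + k) < card V + k"
        and deg: "\<forall>v\<in>V. real (card {y \<in> tuples V (t - 1). v # y \<in> uncoloured V t k col}) \<le> d * real (card V) ^ (t - 1)"
      have "1 / dk k \<le> 1 / d" using d d_le[OF k] by (intro divide_left_mono) auto
      then have V2: "1 / dk k \<le> real (card V)" using V(2) by linarith
      have "d * real (card V) ^ (t - 1) \<le> dk k * real (card V) ^ (t - 1)" using d_le[OF k] by (intro mult_right_mono) auto
      then have deg2: "\<forall>v\<in>V. real (card {y \<in> tuples V (t - 1). v # y \<in> uncoloured V t k col}) \<le> dk k * real (card V) ^ (t - 1)"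
        using deg by (meson order_trans)
      show "\<exists>i<k. \<exists>N. N \<subseteq> colour_class V t col i \<and> pairwise disjnt N \<and> card N = q"
        using \<open>P k (dk k)\<close>[unfolded P_def, THEN spec, THEN spec, THEN spec, THEN mp, OF V(1), THEN mp, OF V2, THEN mp, OF q(1), THEN mp, OF q(2), THEN mp, OF deg2] .
    qed
  qed
  have main: "int (chromatic_number (stable_kneser_hypergraph q n t s)) = \<lceil>(real n - real q * (real t - 1)) / (real q - 1)\<rceil>"
    if q: "q \<ge> 2" and s: "s \<ge> 1" and gq: "\<gamma> * real n \<le> real q" and tq: "t * q \<le> n"
      and sc: "real s \<le> d / (4 * t) * real q" and n: "1 / d \<le> real n" for q n s :: nat
  proof -
    let ?x = "(real n - real q * (real t - 1)) / (real q - 1)"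
    let ?H = "stable_kneser_hypergraph q n t s"
    have q1: "real q - 1 > 0" using q by simp
    have tq': "real t * real q \<le> real n" using tq by (metis of_nat_le_iff of_nat_mult)
    then have "real q - 1 < real n - real q * (real t - 1)" by (simp add: algebra_simps)
    then have x1: "?x > 1" using q1 by (simp add: less_divide_eq)
    define N where "N = nat \<lceil>?x\<rceil>"
    have N2: "N \<ge> 2" using x1 unfolding N_def by linarith
    have Nx: "int N = \<lceil>?x\<rceil>" using x1 by (simp add: N_def)
    define k where "k = N - 1"
    have k1: "k \<ge> 1" using N2 by (simp add: k_def)
    have kx: "real k < ?x" "?x \<le> real k + 1" using Nx N2 unfolding k_def by linarith+
    have kq: "real k * (real q - 1) < real n - real q * (real t - 1)" using kx(1) q1 by (simp add: pos_less_divide_eq)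
    have kq': "real n - real q * (real t - 1) \<le> (real k + 1) * (real q - 1)" using kx(2) q1 by (simp add: pos_divide_le_eq)
    have qn: "q * (t - 1 + k) < n + k"
    proof -
      have "real (t - 1) = real t - 1" using assms(1) by (simp add: of_nat_diff)
      then have "real (q * (t - 1 + k)) = real q * (real t - 1 + real k)" by (simp only: of_nat_mult of_nat_add)
      also have "\<dots> < real (n + k)" using kq by (simp add: algebra_simps)
      finally have "real (q * (t - 1 + k)) < real (n + k)" .
      then show ?thesis by (simp only: of_nat_less_iff)
    qed
    have n1: "n \<ge> 1" using tq q assms(1) by (cases n) auto
    have kK: "k \<in> {1..K}"
    proof -
      have "real k * (real q / 2) \<le> real k * (real q - 1)" using q by (intro mult_left_mono) auto
      also have "\<dots> < real n" using kq assms(1) mult_nonneg_nonneg[of "real q" "real t - 1"] by linarith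
      finally have "real k * (real q / 2) < real n" .
      moreover have "real k * (\<gamma> * real n / 2) \<le> real k * (real q / 2)" using gq by (intro mult_left_mono) auto
      ultimately have "(real k * (\<gamma> / 2)) * real n < 1 * real n" by simp
      then have "real k * (\<gamma> / 2) < 1" by (rule mult_right_less_imp_less) simp
      then have "real k < 2 / \<gamma>" using assms(2) by (simp add: field_simps)
      then have "k \<le> K" unfolding K_def by linarith
      then show ?thesis using k1 by simp
    qed
    have "n < t * q + (N - 1) * (q - 1)"
    proof -
      have "real n < real t * real q + real k * (real q - 1)" using kq' by (simp add: algebra_simps)
      then have "real n < real (t * q + k * (q - 1))" using q by (simp add: of_nat_diff)
      then show ?thesis by (simp only: of_nat_less_iff k_def)
    qed
    then have ex: "\<exists>f. proper_colouring ?H N f"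
      using kneser_colouring_exists[of t q N n s] assms(1) q N2 by simp
    have upper: "chromatic_number ?H \<le> N" unfolding chromatic_number_def by (rule Least_le[of _ N]) (rule ex)
    have "\<exists>f. proper_colouring ?H (chromatic_number ?H) f" unfolding chromatic_number_def by (rule LeastI[of _ N]) (rule ex)
    then obtain f where f: "proper_colouring ?H (chromatic_number ?H) f" ..
    have lower: "N \<le> chromatic_number ?H"
    proof (rule ccontr)
      assume "\<not> ?thesis"
      then have sub: "{..<chromatic_number ?H} \<subseteq> {..<k}" by (auto simp: k_def)
      note f' = f[unfolded proper_colouring_def]
      have fk: "proper_colouring ?H k f"
        unfolding proper_colouring_def by (rule conjI[OF subset_trans[OF conjunct1[OF f'] sub] conjunct2[OF f']])
      have "\<not> proper_colouring ?H k f"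
      proof (rule no_proper_colouring[OF _ assms(1) n n1 gq qn tq s sc])
        fix V :: "nat set" and col and q :: nat
        assume "finite V" "1 / d \<le> real (card V)" "\<gamma> * real (card V) \<le> real q" "q * (t - 1 + k) < card V + k"
          "\<forall>v\<in>V. real (card {y \<in> tuples V (t - 1). v # y \<in> uncoloured V t k col}) \<le> d * real (card V) ^ (t - 1)"
        then show "\<exists>i<k. \<exists>N. N \<subseteq> colour_class V t col i \<and> pairwise disjnt N \<and> card N = q"
          using Pd[OF kK] unfolding P_def by simp
      qed
      then show False using fk by blast
    qed
    show ?thesis using upper lower Nx by simp
  qed
  show ?thesis
  proof (intro exI[of _ "d / (4 * real t)"] conjI allI impI)
    show "d / (4 * real t) > 0" using d assms(1) by simp
    fix q s :: "nat \<Rightarrow> nat"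
    assume ev: "\<forall>\<^sub>F n in sequentially. q n \<ge> 2 \<and> s n \<ge> 1 \<and> \<gamma> * real n \<le> real (q n) \<and> t * q n \<le> n
            \<and> real (s n) \<le> d / (4 * real t) * real (q n)"
    have "\<forall>\<^sub>F n in sequentially. 1 / d \<le> real n"
      using eventually_ge_at_top[of "nat \<lceil>1 / d\<rceil>"] by eventually_elim linarith
    with ev show "\<forall>\<^sub>F n in sequentially. int (chromatic_number (stable_kneser_hypergraph (q n) n t (s n)))
            = \<lceil>(real n - real (q n) * (real t - 1)) / (real (q n) - 1)\<rceil>"
      by eventually_elim (rule main, simp_all)
  qed
qed

end
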